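(* Let $d\ge1$, $\nu>0$, $T>0$, and let $b:\mathbb{R}^d\times[0,\infty)\to\mathbb{R}^d$ be bounded, Borel measurable and divergence-free (i.e. $\nabla\cdot b(\cdot,t)=0$ in the sense of distributions for each $t$). Let $b^T$ be a bounded, Borel measurable, divergence-free vector field with $b^T(x,t)=b(x,T-t)$ for all $x\in\mathbb{R}^d$, $t\le T$. Then for all $\xi,\eta\in\mathbb{R}^d$, $$\mathbb{P}_b^{\xi,0\to\eta,T}=\mathbb{P}_{-b^T}^{\eta,0\to\xi,T}\circ\tau_T,$$ where $\tau_T$ is the time-reversal map on paths over $[0,T]$, $(\tau_T w)(t)=w(T-t)$, $t\in[0,T]$. Equivalently, if $(X_t)$ is an $L_b$-diffusion and $(Y_t)$ is an $L_{-b^T}$-diffusion, then for every bounded (or nonnegative) Borel measurable functional $F$ on continuous paths $[0,T]\to\mathbb{R}^d$, $$\mathbb{E}[F(X_\cdot)\mid X_0=\xi,X_T=\eta]=\mathbb{E}[F(Y_{T-\cdot})\mid Y_0=\eta,Y_T=\xi].$$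
   Context: For a bounded Borel time-dependent vector field $c(x,t)$ on $\mathbb{R}^d$, set $L_{c}:=\nu\Delta+c(x,t)\cdot\nabla$, and let $p_{c}(\tau,\xi,t,x)$ ($t>\tau\ge0$) be the (positive, continuous) transition probability density of the diffusion with generator $L_c$, i.e. $p_c(\tau,\xi,t,x)\,\mathrm{d}x=\mathbb{P}[X(\xi,\tau,t)\in\mathrm{d}x]$ where $\mathrm{d}X(t)=c(X(t),t)\,\mathrm{d}t+\sqrt{2\nu}\,\mathrm{d}B(t)$, $X(\tau)=\xi$, $B$ a standard $d$-dimensional Brownian motion. Let $\Omega$ be the space of continuous paths $w:[0,\infty)\to\mathbb{R}^d$ (or on $[0,T]$) with the $\sigma$-algebra generated by the coordinate maps. For $\tau<T$ and $\xi,\eta\in\mathbb{R}^d$, the pinned diffusion (diffusion bridge) measure $\mathbb{P}_c^{\xi,\tau\to\eta,T}$ is the unique probability measure on $\Omega$ such that $w(s)=\xi$ for $s\le\tau$, $w(t)=\eta$ for $t\ge T$ almost surely, and for every partition $\tau=t_0<t_1<\dots<t_n<t_{n+1}=T$, $$\mathbb{P}_c^{\xi,\tau\to\eta,T}[w(t_1)\in\mathrm{d}x_1,\dots,w(t_n)\in\mathrm{d}x_n]=q_c(\tau,\xi,t_1,x_1)\prod_{k=1}^{n-1}q_c(t_k,x_k,t_{k+1},x_{k+1})\,q_c(t_n,x_n,T,\eta)\,\mathrm{d}x_1\cdots\mathrm{d}x_n,$$ where $q_c(s,x,t,y):=\dfrac{p_c(s,x,t,y)\,p_c(t,y,T,\eta)}{p_c(s,x,T,\eta)}$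 for $s<t$ (with the convention $p_c(T,y,T,\eta)\,\mathrm{d}y$ interpreted as $\delta_\eta(\mathrm{d}y)$). It is the law of the $L_c$-diffusion started at $\xi$ at time $\tau$ conditioned on $w(T)=\eta$. *)

theory Defs
  imports "HOL-Probability.Probability"
begin

fun iter_pd :: "'d::finite list \<Rightarrow> (real^'d \<Rightarrow> real) \<Rightarrow> real^'d \<Rightarrow> real" where
  "iter_pd [] f = f"
| "iter_pd (i # is) f = (\<lambda>x. frechet_derivative (iter_pd is f) (at x) (axis i 1))"

definition smooth_fun :: "(real^'d::finite \<Rightarrow> real) \<Rightarrow> bool" where
  "smooth_fun f \<longleftrightarrow> (\<forall>is. (iter_pd is f) differentiable_on UNIV)"

definition test_fun :: "(real^'d::finite \<Rightarrow> real) \<Rightarrow> bool" where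
  "test_fun f \<longleftrightarrow> smooth_fun f \<and> (\<exists>K. compact K \<and> (\<forall>x. x \<notin> K \<longrightarrow> f x = 0))"

definition grad :: "(real^'d::finite \<Rightarrow> real) \<Rightarrow> real^'d \<Rightarrow> real^'d" where
  "grad f x = (\<chi> i. iter_pd [i] f x)"

definition laplacian :: "(real^'d::finite \<Rightarrow> real) \<Rightarrow> real^'d \<Rightarrow> real" where
  "laplacian f x = (\<Sum>i\<in>UNIV. iter_pd [i, i] f x)"

definition bounded_field :: "(real^'d::finite \<Rightarrow> real \<Rightarrow> real^'d) \<Rightarrow> bool" where
  "bounded_field c \<longleftrightarrow> (\<exists>M. \<forall>x t. 0 \<le> t \<longrightarrow> norm (c x t) \<le> M)"

definition borel_field :: "(real^'d::finite \<Rightarrow> real \<Rightarrow> real^'d) \<Rightarrow> bool" where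
  "borel_field c \<longleftrightarrow>
     (\<lambda>z. c (fst z) (snd z)) \<in> borel_measurable (restrict_space borel (UNIV \<times> {0..}))"

definition div_free :: "(real^'d::finite \<Rightarrow> real \<Rightarrow> real^'d) \<Rightarrow> bool" where
  "div_free c \<longleftrightarrow> (\<forall>t\<ge>0. \<forall>\<phi>. test_fun \<phi> \<longrightarrow> (\<integral>x. c x t \<bullet> grad \<phi> x \<partial>lborel) = 0)"

definition gen :: "real \<Rightarrow> (real^'d::finite \<Rightarrow> real \<Rightarrow> real^'d) \<Rightarrow> (real^'d \<Rightarrow> real) \<Rightarrow> real \<Rightarrow> real^'d \<Rightarrow> real" where
  "gen \<nu> c f s x = \<nu> * laplacian f x + c x s \<bullet> grad f x"

text \<open>p(tau,xi,t,x) is the positive continuous transition probability density of the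
  diffusion with generator L_c: for t > tau >= 0, p(tau,xi,t,.) is a probability density and
  the family solves the Kolmogorov forward (Fokker--Planck) equation started at delta_xi,
  tested against smooth compactly supported functions.\<close>
definition trans_density ::
  "real \<Rightarrow> (real^'d::finite \<Rightarrow> real \<Rightarrow> real^'d) \<Rightarrow> (real \<Rightarrow> real^'d \<Rightarrow> real \<Rightarrow> real^'d \<Rightarrow> real) \<Rightarrow> bool" where
  "trans_density \<nu> c p \<longleftrightarrow>
     (\<forall>\<tau> \<xi> t x. 0 \<le> \<tau> \<longrightarrow> \<tau> < t \<longrightarrow> 0 < p \<tau> \<xi> t x) \<and>
     continuous_on {(\<tau>, \<xi>, t, x). 0 \<le> \<tau> \<and> \<tau> < t} (\<lambda>(\<tau>, \<xi>, t, x). p \<tau> \<xi> t x) \<and>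
     (\<forall>\<tau> \<xi> t. 0 \<le> \<tau> \<longrightarrow> \<tau> < t \<longrightarrow> (\<integral>\<^sup>+ x. ennreal (p \<tau> \<xi> t x) \<partial>lborel) = 1) \<and>
     (\<forall>\<tau> \<xi> t f. 0 \<le> \<tau> \<longrightarrow> \<tau> < t \<longrightarrow> test_fun f \<longrightarrow>
        (\<integral>x. p \<tau> \<xi> t x * f x \<partial>lborel)
          = f \<xi> + (LBINT s=\<tau>..t. (\<integral>x. p \<tau> \<xi> s x * gen \<nu> c f s x \<partial>lborel)))"

definition cpaths :: "real \<Rightarrow> (real \<Rightarrow> real^'d::finite) set" where
  "cpaths T = {w. w \<in> extensional {0..T} \<and> continuous_on {0..T} w}"

definition cpath_space :: "real \<Rightarrow> (real \<Rightarrow> real^'d::finite) measure" where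
  "cpath_space T = sigma (cpaths T)
     {{w \<in> cpaths T. w t \<in> A} | t A. t \<in> {0..T} \<and> A \<in> sets borel}"

definition time_rev :: "real \<Rightarrow> (real \<Rightarrow> 'a) \<Rightarrow> (real \<Rightarrow> 'a)" where
  "time_rev T w = (\<lambda>t\<in>{0..T}. w (T - t))"

definition bridge_q ::
  "(real \<Rightarrow> real^'d::finite \<Rightarrow> real \<Rightarrow> real^'d \<Rightarrow> real) \<Rightarrow> real \<Rightarrow> real^'d
     \<Rightarrow> real \<Rightarrow> real^'d \<Rightarrow> real \<Rightarrow> real^'d \<Rightarrow> real" where
  "bridge_q p T \<eta> s x t y = p s x t y * p t y T \<eta> / p s x T \<eta>"

text \<open>Joint density of (w(t_1),...,w(t_n)) (indices shifted to 0..n-1) under the bridge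
  from (xi,tau) to (eta,T). The last factor q(t_n,x_n,T,eta) equals 1 under the
  delta-convention of the paper, so it is omitted.\<close>
definition bridge_density ::
  "(real \<Rightarrow> real^'d::finite \<Rightarrow> real \<Rightarrow> real^'d \<Rightarrow> real) \<Rightarrow> real \<Rightarrow> real^'d \<Rightarrow> real \<Rightarrow> real^'d
     \<Rightarrow> nat \<Rightarrow> (nat \<Rightarrow> real) \<Rightarrow> (nat \<Rightarrow> real^'d) \<Rightarrow> real" where
  "bridge_density p \<tau> \<xi> T \<eta> n t x =
     bridge_q p T \<eta> \<tau> \<xi> (t 0) (x 0) *
     (\<Prod>k<n - 1. bridge_q p T \<eta> (t k) (x k) (t (Suc k)) (x (Suc k)))"

definition is_bridge ::
  "(real \<Rightarrow> real^'d::finite \<Rightarrow> real \<Rightarrow> real^'d \<Rightarrow> real) \<Rightarrow> real^'d \<Rightarrow> real \<Rightarrow> real^'d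
     \<Rightarrow> (real \<Rightarrow> real^'d) measure \<Rightarrow> bool" where
  "is_bridge p \<xi> T \<eta> P \<longleftrightarrow>
     prob_space P \<and> sets P = sets (cpath_space T) \<and>
     (AE w in P. w 0 = \<xi> \<and> w T = \<eta>) \<and>
     (\<forall>n t. 0 < n \<longrightarrow> 0 < t 0 \<longrightarrow> (\<forall>k. Suc k < n \<longrightarrow> t k < t (Suc k)) \<longrightarrow> t (n - 1) < T \<longrightarrow>
        distr P (PiM {..<n} (\<lambda>_. lborel)) (\<lambda>w. \<lambda>k\<in>{..<n}. w (t k))
          = density (PiM {..<n} (\<lambda>_. lborel)) (\<lambda>x. ennreal (bridge_density p 0 \<xi> T \<eta> n t x)))"

end

theory Submission
  imports Defs
begin

text \<open>Both densities solve a Fokker--Planck equation whose mild (Duhamel) form reads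
  \<open>p = G + p * K\<close>, where \<open>G\<close> is the heat kernel, \<open>K = b\<cdot>\<nabla>G\<close> and \<open>*\<close> is composition of
  space-time kernels. The singularity of \<open>K\<close> is integrable in time, so \<open>p\<close> is the sum of the series
  \<open>M\<^sub>0 = G\<close>, \<open>M\<^sub>k\<^sub>+\<^sub>1 = M\<^sub>k * K\<close>, with a geometric remainder in \<open>L\<^sup>1\<close>. As \<open>b\<close> is divergence-free,
  integration by parts at fixed time gives \<open>G * K = L * G\<close> with \<open>L\<close> the kernel whose gradient
  falls on the other factor, and associativity upgrades this to \<open>M\<^sub>k\<^sub>+\<^sub>1 = L * M\<^sub>k\<close>. Time reversal
  exchanges \<open>L\<close> with the \<open>K\<close> of the reversed drift, so the two series agree term by term and
  \<open>p(s, x, t, y) = p\<^sup>T(T - t, y, T - s, x)\<close>. The bridge densities telescope, hence the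
  finite-dimensional distributions of one bridge are those of the other read backwards, and these
  determine a law on path space.\<close>

section \<open>Smooth functions and cutoffs\<close>

text \<open>Differentiating the integral of \<open>p s x r z * pT (T - t) y (T - r) z\<close> over
  \<open>z\<close> in the intermediate time \<open>r\<close> would call for a backward equation, but
  \<open>trans_density\<close> supplies only positivity, mass one, continuity and the forward
  equation against compactly supported functions, for a drift without regularity. Hence each density
  is identified separately with an explicit series, and only the series are compared. Two
  difficulties shape the estimates. The drift kernel has size \<open>1 / sqrt (t - r)\<close>, and
  no Gaussian upper bound on \<open>p\<close> is known; near the end point the mild integral is
  controlled by continuity of \<open>p\<close> there, elsewhere by its mass. Moreover the series
  converges only in \<open>L1\<close> of the later position: in \<open>y\<close> for each
  \<open>x\<close> for \<open>p\<close>, in \<open>x\<close> for each \<open>y\<close> for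
  \<open>pT\<close>. The two statements meet almost everywhere on the product space, and continuity
  removes the null set. Each gradient bound spends half of a Gaussian exponent, but only once: the
  majorants of doubled variance satisfy the semigroup law exactly, so iterating kernels loses
  nothing more.\<close>

definition bump :: "nat \<Rightarrow> real \<Rightarrow> real" where
  "bump k u = (if u > 0 then exp (- (1 / u)) / u ^ k else 0)"

lemma power_le_fact_exp:
  fixes v :: real assumes "v \<ge> 0" shows "v ^ n \<le> fact n * exp v"
proof -
  have "(\<Sum>k\<in>{n}. v ^ k /\<^sub>R fact k) \<le> (\<Sum>k. v ^ k /\<^sub>R fact k)"
    by (rule sum_le_suminf[OF summable_exp_generic]) (use assms in auto)
  then show ?thesis
    by (simp add: exp_def field_simps)
qed

text \<open>Take \<open>v = 1 / u\<close> and exponent \<open>k + j\<close> in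
  \<open>power_le_fact_exp\<close>. This is flatness at 0 to every order: \<open>j = 0\<close> gives
  boundedness, \<open>j = 2\<close> the derivative at the origin.\<close>

lemma bump_le_power: "\<bar>bump k u\<bar> \<le> fact (k + j) * \<bar>u\<bar> ^ j"
proof (cases "u > 0")
  case True
  have "(1/u) ^ (k + j) \<le> fact (k + j) * exp (1/u)"
    by (rule power_le_fact_exp) (use True in auto)
  then have "exp (- (1/u)) * (1/u) ^ (k + j) \<le> fact (k + j)"
    unfolding exp_minus by (subst mult.commute, subst divide_inverse[symmetric], subst divide_le_eq) simp
  then show ?thesis using True
    by (simp add: bump_def power_add field_simps)
qed (simp add: bump_def)

lemma bump_le_fact: "\<bar>bump k u\<bar> \<le> fact k"
  using bump_le_power[of k u 0] by simp

text \<open>The denominator \<open>u ^ k\<close> is part of \<open>bump\<close> for the sake of this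
  rule: differentiation only raises the index, so the family is closed under it and can serve as a
  constructor of \<open>elem_smooth\<close>.\<close>

lemma DERIV_bump:
  "(bump k has_real_derivative (bump (k + 2) u - real k * bump (k + 1) u)) (at u)"
proof -
  consider "u > 0" | "u < 0" | "u = 0" by linarith
  then show ?thesis
  proof cases
    case 1
    have "((\<lambda>u. exp (- (1 / u)) / u ^ k) has_real_derivative
            (exp (- (1 / u)) / u ^ (k + 2) - real k * (exp (- (1 / u)) / u ^ (k + 1)))) (at u)"
    proof (cases k)
      case 0
      then show ?thesis using 1 by (auto intro!: derivative_eq_intros simp: power2_eq_square)
    next
      case (Suc m)
      have D: "((\<lambda>u. exp (- inverse u) * inverse u ^ Suc m) has_real_derivative
            (exp (- inverse u) * (inverse u)\<^sup>2 * inverse u ^ Suc m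
             + exp (- inverse u) * (real (Suc m) * (- (inverse u)\<^sup>2 * inverse u ^ m)))) (at u)"
      proof -
        have e: "((\<lambda>u. exp (- inverse u)) has_real_derivative (exp (- inverse u) * (inverse u)\<^sup>2)) (at u)"
          using 1 by (auto intro!: derivative_eq_intros simp: power2_eq_square)
        have i: "(inverse has_real_derivative - (inverse u)\<^sup>2) (at u)"
          using 1 DERIV_inverse[of u UNIV] by (simp add: numeral_2_eq_2)
        show ?thesis
          using DERIV_mult[OF e DERIV_power_Suc[OF i, of m]]
          by (rule DERIV_cong) (simp add: algebra_simps)
      qed
      have F: "(\<lambda>u. exp (- (1 / u)) / u ^ k) = (\<lambda>u::real. exp (- inverse u) * inverse u ^ Suc m)"
        unfolding Suc by (simp add: fun_eq_iff divide_inverse power_inverse del: power_Suc)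
      have V: "exp (- (1 / u)) / u ^ (k + 2) - real k * (exp (- (1 / u)) / u ^ (k + 1)) =
          exp (- inverse u) * inverse u ^ (Suc m + 2) - real (Suc m) * (exp (- inverse u) * inverse u ^ (Suc m + 1))"
        unfolding Suc by (simp only: divide_inverse power_inverse mult_1_left)
      show ?thesis
        unfolding F V by (rule DERIV_cong[OF D]) (simp add: algebra_simps power2_eq_square)
    qed
    moreover have "bump (k + 2) u - real k * bump (k + 1) u =
        exp (- (1 / u)) / u ^ (k + 2) - real k * (exp (- (1 / u)) / u ^ (k + 1))"
      using 1 by (simp add: bump_def)
    ultimately have "((\<lambda>u. exp (- (1 / u)) / u ^ k) has_real_derivative
        (bump (k + 2) u - real k * bump (k + 1) u)) (at u)" by simp
    then show ?thesis
      by (rule has_field_derivative_transform_within_open[where S="{0<..}"])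
         (use 1 in \<open>simp_all add: bump_def\<close>)
  next
    case 2
    then have "((\<lambda>u. 0) has_real_derivative (bump (k + 2) u - real k * bump (k + 1) u)) (at u)"
      by (simp add: bump_def)
    then show ?thesis
      by (rule has_field_derivative_transform_within_open[where S="{..<0}"])
         (use 2 in \<open>simp_all add: bump_def\<close>)
  next
    case 3
    \<comment> \<open>The claimed derivative is 0 here, since every \<open>bump\<close> vanishes at
      0, and the quadratic bound makes the difference quotient \<open>O(h)\<close>.\<close>
    have "((\<lambda>h. bump k h / h) \<longlongrightarrow> 0) (at 0)"
    proof (rule Lim_null_comparison)
      show "\<forall>\<^sub>F h in at 0. norm (bump k h / h) \<le> fact (k + 2) * \<bar>h\<bar>"
        unfolding eventually_at_filter
      proof (intro always_eventually allI impI)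
        fix h :: real assume "h \<noteq> 0"
        then show "norm (bump k h / h) \<le> fact (k + 2) * \<bar>h\<bar>"
          using bump_le_power[of k h 2] unfolding power2_eq_square
          by (simp only: real_norm_def abs_divide mult.assoc[symmetric]) (simp add: pos_divide_le_eq)
      qed
      show "((\<lambda>h::real. fact (k + 2) * \<bar>h\<bar>) \<longlongrightarrow> 0) (at 0)"
        by (rule tendsto_eq_rhs, (rule tendsto_intros)+) auto
    qed
    then show ?thesis using 3 by (simp add: DERIV_def bump_def)
  qed
qed

text \<open>This class is closed under partial derivatives, which yields \<open>smooth_fun\<close> without
  computing iterated derivatives.\<close>

inductive elem_smooth :: "(real^'d::finite \<Rightarrow> real) \<Rightarrow> bool" where
  const: "elem_smooth (\<lambda>x. c)"
| coord: "elem_smooth (\<lambda>x. x $ i)"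
| add: "elem_smooth f \<Longrightarrow> elem_smooth g \<Longrightarrow> elem_smooth (\<lambda>x. f x + g x)"
| mult: "elem_smooth f \<Longrightarrow> elem_smooth g \<Longrightarrow> elem_smooth (\<lambda>x. f x * g x)"
| exp: "elem_smooth f \<Longrightarrow> elem_smooth (\<lambda>x. exp (f x))"
| bump: "elem_smooth f \<Longrightarrow> elem_smooth (\<lambda>x. bump k (f x))"

lemma elem_smooth_sum:
  "(\<And>i. i \<in> A \<Longrightarrow> elem_smooth (f i)) \<Longrightarrow> elem_smooth (\<lambda>x. \<Sum>i\<in>A. f i x)"
  by (induction A rule: infinite_finite_induct) (auto intro: elem_smooth.intros)

lemma elem_smooth_diff:
  assumes "elem_smooth f" "elem_smooth g" shows "elem_smooth (\<lambda>x. f x - g x)"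
proof -
  have "elem_smooth (\<lambda>x. f x + (-1) * g x)"
    by (intro elem_smooth.intros assms)
  then show ?thesis by simp
qed

lemma elem_smooth_inner:
  "elem_smooth (\<lambda>x. (x - a) \<bullet> (x - b))"
  unfolding inner_vec_def
  by (simp, intro elem_smooth_sum elem_smooth.intros elem_smooth_diff)

text \<open>Differentiability and membership of the partial derivatives go through one induction
  with the derivative as witness: product and chain rule return the functions themselves,
  \<open>exp (f x)\<close>, or \<open>bump\<close> with indices \<open>k + 1\<close> and
  \<open>k + 2\<close>, all of them again in the class.\<close>

lemma elem_smooth_has_derivative:
  assumes "elem_smooth f"
  shows "\<exists>f'. (\<forall>x. (f has_derivative f' x) (at x)) \<and> (\<forall>i. elem_smooth (\<lambda>x. f' x (axis i 1)))"
  using assms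
proof induction
  case (const c)
  show ?case by (rule exI[of _ "\<lambda>x h. 0"]) (auto intro: elem_smooth.intros)
next
  case (coord i)
  show ?case
    by (rule exI[of _ "\<lambda>x h. h $ i"])
       (auto intro!: elem_smooth.intros bounded_linear_imp_has_derivative bounded_linear_vec_nth)
next
  case (add f g)
  then obtain f' g' where "\<And>x. (f has_derivative f' x) (at x)" "\<And>i. elem_smooth (\<lambda>x. f' x (axis i 1))"
    "\<And>x. (g has_derivative g' x) (at x)" "\<And>i. elem_smooth (\<lambda>x. g' x (axis i 1))" by blast
  then show ?case
    by (intro exI[of _ "\<lambda>x h. f' x h + g' x h"]) (auto intro!: elem_smooth.intros has_derivative_add)
next
  case (mult f g)
  then obtain f' g' where "\<And>x. (f has_derivative f' x) (at x)" "\<And>i. elem_smooth (\<lambda>x. f' x (axis i 1))"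
    "\<And>x. (g has_derivative g' x) (at x)" "\<And>i. elem_smooth (\<lambda>x. g' x (axis i 1))" by blast
  then show ?case using mult.hyps
    by (intro exI[of _ "\<lambda>x h. f x * g' x h + f' x h * g x"])
       (auto intro!: elem_smooth.intros has_derivative_mult)
next
  case (exp f)
  then obtain f' where "\<And>x. (f has_derivative f' x) (at x)" "\<And>i. elem_smooth (\<lambda>x. f' x (axis i 1))"
    by blast
  then show ?case using exp.hyps
    by (intro exI[of _ "\<lambda>x h. exp (f x) * f' x h"])
       (auto intro!: elem_smooth.intros derivative_eq_intros)
next
  case (bump f k)
  then obtain f' where f': "\<And>x. (f has_derivative f' x) (at x)" "\<And>i. elem_smooth (\<lambda>x. f' x (axis i 1))"
    by blast
  have "((\<lambda>x. bump k (f x)) has_derivative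
      (\<lambda>h. f' x h * (bump (k + 2) (f x) - real k * bump (k + 1) (f x)))) (at x)" for x
    using DERIV_compose_FDERIV[OF DERIV_bump f'(1)] .
  then show ?case using f'(2) bump.hyps
    by (intro exI[of _ "\<lambda>x h. f' x h * (bump (k + 2) (f x) - real k * bump (k + 1) (f x))"])
       (auto intro!: elem_smooth.intros elem_smooth_diff)
qed

lemma elem_smooth_differentiable:
  "elem_smooth f \<Longrightarrow> f differentiable (at x)"
  using elem_smooth_has_derivative differentiable_def by blast

lemma iter_pd_single_eq:
  "(f has_derivative f') (at x) \<Longrightarrow> iter_pd [i] f x = f' (axis i 1)"
  using frechet_derivative_at[of f f' x] by simp

lemma elem_smooth_pd:
  assumes "elem_smooth f" shows "elem_smooth (iter_pd [i] f)"
proof -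
  obtain f' where f': "\<And>x. (f has_derivative f' x) (at x)" "\<And>i. elem_smooth (\<lambda>x. f' x (axis i 1))"
    using elem_smooth_has_derivative[OF assms] by blast
  have "iter_pd [i] f = (\<lambda>x. f' x (axis i 1))"
    using iter_pd_single_eq[OF f'(1)] by blast
  then show ?thesis using f'(2) by simp
qed

lemma elem_smooth_iter_pd: "elem_smooth f \<Longrightarrow> elem_smooth (iter_pd is f)"
proof (induction "is")
  case (Cons i "is")
  then show ?case using elem_smooth_pd[of "iter_pd is f" i] by simp
qed simp

lemma elem_smooth_imp_smooth: "elem_smooth f \<Longrightarrow> smooth_fun f"
  unfolding smooth_fun_def differentiable_on_def
  using elem_smooth_differentiable elem_smooth_iter_pd differentiable_at_withinI by blast

lemma elem_smooth_continuous: "elem_smooth f \<Longrightarrow> continuous_on UNIV f"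
  by (meson continuous_at_imp_continuous_on differentiable_imp_continuous_within
      elem_smooth_differentiable)

lemma elem_smooth_measurable: "elem_smooth f \<Longrightarrow> f \<in> borel_measurable borel"
  by (intro borel_measurable_continuous_onI elem_smooth_continuous)

lemma pd_mult:
  assumes "elem_smooth f" "elem_smooth g"
  shows "iter_pd [i] (\<lambda>x. f x * g x) = (\<lambda>x. f x * iter_pd [i] g x + iter_pd [i] f x * g x)"
proof
  fix x
  obtain f' g' where f': "(f has_derivative f') (at x)" and g': "(g has_derivative g') (at x)"
    using assms elem_smooth_differentiable differentiable_def by metis
  show "iter_pd [i] (\<lambda>x. f x * g x) x = f x * iter_pd [i] g x + iter_pd [i] f x * g x"
    using iter_pd_single_eq[OF has_derivative_mult[OF f' g'], of i] iter_pd_single_eq[OF f', of i]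
      iter_pd_single_eq[OF g', of i] by simp
qed

lemma pd_add:
  assumes "elem_smooth f" "elem_smooth g"
  shows "iter_pd [i] (\<lambda>x. f x + g x) = (\<lambda>x. iter_pd [i] f x + iter_pd [i] g x)"
proof
  fix x
  obtain f' g' where f': "(f has_derivative f') (at x)" and g': "(g has_derivative g') (at x)"
    using assms elem_smooth_differentiable differentiable_def by metis
  show "iter_pd [i] (\<lambda>x. f x + g x) x = iter_pd [i] f x + iter_pd [i] g x"
    using iter_pd_single_eq[OF has_derivative_add[OF f' g'], of i] iter_pd_single_eq[OF f', of i]
      iter_pd_single_eq[OF g', of i] by simp
qed

lemma pd2_eq: "iter_pd [i, j] f = iter_pd [i] (iter_pd [j] f)"
  by simp

lemma pd2_mult:
  assumes f: "elem_smooth f" and g: "elem_smooth g"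
  shows "iter_pd [i, i] (\<lambda>x. f x * g x) = (\<lambda>x. f x * iter_pd [i, i] g x
     + 2 * (iter_pd [i] f x * iter_pd [i] g x) + iter_pd [i, i] f x * g x)"
  unfolding pd2_eq pd_mult[OF f g]
  by (subst pd_add) (auto intro!: elem_smooth.mult elem_smooth_pd f g
       simp: pd_mult f g elem_smooth_pd simp del: iter_pd.simps)

text \<open>No plateau is needed: \<open>cutoff n\<close> tends to 1 pointwise and its derivatives are \<open>O(1/n)\<close>.\<close>

definition cutoff :: "nat \<Rightarrow> real^'d::finite \<Rightarrow> real" where
  "cutoff n x = exp 1 * bump 0 (1 - (x \<bullet> x) / (real (Suc n))\<^sup>2)"

lemma elem_smooth_affine_norm: "elem_smooth (\<lambda>x. 1 - (x \<bullet> x) / c)"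
proof -
  have "elem_smooth (\<lambda>x. 1 - ((x - 0) \<bullet> (x - 0)) * (1 / c))"
    by (intro elem_smooth_diff elem_smooth.intros elem_smooth_inner)
  then show ?thesis by simp
qed

lemma elem_smooth_cutoff: "elem_smooth (cutoff n)"
  unfolding cutoff_def[abs_def] by (intro elem_smooth.intros elem_smooth_affine_norm)

lemma cutoff_eq_0:
  assumes "norm x \<ge> real (Suc n)" shows "cutoff n x = 0"
proof -
  have "(real (Suc n))\<^sup>2 \<le> x \<bullet> x"
    using assms by (simp add: dot_square_norm power_mono)
  then have "(x \<bullet> x) / (real (Suc n))\<^sup>2 \<ge> 1" by (simp add: field_simps)
  then show ?thesis by (simp add: cutoff_def bump_def)
qed

text \<open>The link between the two classes: weak identities assumed for test functions become
  available for truncated elementary functions, in particular for truncated Gaussians.\<close>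

lemma test_fun_cutoff_mult:
  assumes "elem_smooth f" shows "test_fun (\<lambda>x. cutoff n x * f x)"
  unfolding test_fun_def
proof (intro conjI exI allI impI)
  show "smooth_fun (\<lambda>x. cutoff n x * f x)"
    by (intro elem_smooth_imp_smooth elem_smooth.intros elem_smooth_cutoff assms)
  show "compact (cball (0::real^'a) (real (Suc n)))" by simp
  show "x \<notin> cball 0 (real (Suc n)) \<Longrightarrow> cutoff n x * f x = 0" for x
    using cutoff_eq_0[of n x] by simp
qed

lemma abs_cutoff_le: "\<bar>cutoff n x\<bar> \<le> exp 1"
  using bump_le_fact[of 0] by (simp add: cutoff_def abs_mult)

lemma has_derivative_bump_affine_norm:
  "((\<lambda>x::real^'d. bump k (1 - (x \<bullet> x) / c)) has_derivative
     (\<lambda>h. (- (2 * (x \<bullet> h) / c)) * (bump (k + 2) (1 - (x \<bullet> x) / c)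
        - real k * bump (k + 1) (1 - (x \<bullet> x) / c)))) (at x)"
proof -
  have "((\<lambda>x. 1 - (x \<bullet> x) / c) has_derivative (\<lambda>h. - (2 * (x \<bullet> h) / c))) (at x)"
    by (auto intro!: derivative_eq_intros simp: inner_commute divide_inverse)
  from DERIV_compose_FDERIV[OF DERIV_bump this] show ?thesis .
qed

lemma pd_cutoff:
  "iter_pd [i] (cutoff n) = (\<lambda>x. x $ i * (- (2 * exp 1 / (real (Suc n))\<^sup>2) *
     bump 2 (1 - (x \<bullet> x) / (real (Suc n))\<^sup>2)))"
proof
  fix x :: "real^'a"
  have "(cutoff n has_derivative (\<lambda>h. exp 1 * ((- (2 * (x \<bullet> h) / (real (Suc n))\<^sup>2)) * (bump (0 + 2) (1 - (x \<bullet> x) / (real (Suc n))\<^sup>2)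
        - real 0 * bump (0 + 1) (1 - (x \<bullet> x) / (real (Suc n))\<^sup>2))))) (at x)"
    unfolding cutoff_def[abs_def] by (rule has_derivative_mult_right[OF has_derivative_bump_affine_norm])
  from iter_pd_single_eq[OF this, of i]
  show "iter_pd [i] (cutoff n) x = x $ i * (- (2 * exp 1 / (real (Suc n))\<^sup>2) *
     bump 2 (1 - (x \<bullet> x) / (real (Suc n))\<^sup>2))"
    by (simp add: inner_axis numeral_2_eq_2)
qed

lemma pd2_cutoff:
  "iter_pd [i, i] (cutoff n) x = - (2 * exp 1 / (real (Suc n))\<^sup>2) *
     (bump 2 (1 - (x \<bullet> x) / (real (Suc n))\<^sup>2)
       - 2 * (x $ i)\<^sup>2 / (real (Suc n))\<^sup>2 * (bump 4 (1 - (x \<bullet> x) / (real (Suc n))\<^sup>2)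
        - 2 * bump 3 (1 - (x \<bullet> x) / (real (Suc n))\<^sup>2)))"
proof -
  define N where "N = (real (Suc n))\<^sup>2"
  let ?D = "\<lambda>h. x $ i * (- (2 * exp 1 / N) * ((- (2 * (x \<bullet> h) / N)) * (bump (2 + 2) (1 - (x \<bullet> x) / N)
        - real 2 * bump (2 + 1) (1 - (x \<bullet> x) / N)))) + h $ i * (- (2 * exp 1 / N) * bump 2 (1 - (x \<bullet> x) / N))"
  have "((\<lambda>x::real^'a. x $ i * (- (2 * exp 1 / N) * bump 2 (1 - (x \<bullet> x) / N))) has_derivative ?D) (at x)"
    by (rule has_derivative_mult[OF bounded_linear_imp_has_derivative[OF bounded_linear_vec_nth]
         has_derivative_mult_right[OF has_derivative_bump_affine_norm]])
  from iter_pd_single_eq[OF this, of i]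
  have "iter_pd [i, i] (cutoff n) x = ?D (axis i 1)"
    unfolding pd2_eq pd_cutoff N_def[symmetric] .
  also have "?D (axis i 1) = - (2 * exp 1 / N) * (bump 2 (1 - (x \<bullet> x) / N)
       - 2 * (x $ i)\<^sup>2 / N * (bump 4 (1 - (x \<bullet> x) / N) - 2 * bump 3 (1 - (x \<bullet> x) / N)))"
  proof -
    have "bump (2 + 1) = bump 3" "bump (2 + 2) = bump 4" by simp_all
    moreover define B2 B3 B4 where "B2 = bump 2 (1 - (x \<bullet> x) / N)"
      "B3 = bump 3 (1 - (x \<bullet> x) / N)" "B4 = bump 4 (1 - (x \<bullet> x) / N)"
    ultimately have "?D (axis i 1) = x $ i * (- (2 * exp 1 / N) * ((- (2 * x $ i / N)) * (B4
        - 2 * B3))) + - (2 * exp 1 / N) * B2"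
      by (simp only:) (simp add: inner_axis)
    then show ?thesis
      unfolding B2_B3_B4_def[symmetric] by (simp add: power2_eq_square algebra_simps)
  qed
  finally show ?thesis unfolding N_def .
qed

text \<open>Where \<open>bump\<close> does not vanish, \<open>norm x < n + 1\<close>; a factor
  \<open>x $ i\<close> thus costs one power of \<open>n + 1\<close>, against the inverse square in
  front of the derivative of the cutoff.\<close>

lemma bump_coord_bound:
  "\<bar>x $ i\<bar> * \<bar>bump k (1 - (x \<bullet> x) / (real (Suc n))\<^sup>2)\<bar> \<le> real (Suc n) * fact k"
proof (cases "norm x \<ge> real (Suc n)")
  case True
  have "(real (Suc n))\<^sup>2 \<le> x \<bullet> x"
    using True by (simp add: dot_square_norm power_mono)
  then have "(x \<bullet> x) / (real (Suc n))\<^sup>2 \<ge> 1" by (simp add: field_simps)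
  then show ?thesis by (simp add: bump_def)
next
  case False
  then have "\<bar>x $ i\<bar> \<le> real (Suc n)" using component_le_norm_cart[of x i] by linarith
  then show ?thesis by (intro mult_mono bump_le_fact) auto
qed

lemma abs_pd_cutoff_le:
  "\<bar>iter_pd [i] (cutoff n) x\<bar> \<le> 4 * exp 1 / real (Suc n)"
proof -
  have "\<bar>iter_pd [i] (cutoff n) x\<bar> = (2 * exp 1 / (real (Suc n))\<^sup>2) *
     (\<bar>x $ i\<bar> * \<bar>bump 2 (1 - (x \<bullet> x) / (real (Suc n))\<^sup>2)\<bar>)"
    unfolding pd_cutoff by (simp add: abs_mult)
  also have "\<dots> \<le> (2 * exp 1 / (real (Suc n))\<^sup>2) * (real (Suc n) * fact 2)"
    by (intro mult_left_mono bump_coord_bound) auto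
  also have "\<dots> = 4 * exp 1 / real (Suc n)"
    by (simp add: power2_eq_square fact_numeral del: of_nat_Suc)
  finally show ?thesis .
qed

text \<open>The decay is in fact of order \<open>1 / n ^ 2\<close>; order \<open>1 / n\<close>
  suffices for the limit and lets first and second derivatives share
  \<open>tendsto_0_over_Suc\<close>.\<close>

lemma abs_pd2_cutoff_le:
  "\<bar>iter_pd [i, i] (cutoff n) x\<bar> \<le> 200 * exp 1 / real (Suc n)"
proof -
  let ?N = "real (Suc n)"
  let ?b = "\<lambda>k. \<bar>bump k (1 - (x \<bullet> x) / ?N\<^sup>2)\<bar>"
  have q: "(x $ i)\<^sup>2 * ?b k \<le> ?N\<^sup>2 * fact k" for k
  proof (cases "norm x \<ge> ?N")
    case True
    have "?N\<^sup>2 \<le> x \<bullet> x"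
      using True by (simp add: dot_square_norm power_mono)
    then have "(x \<bullet> x) / ?N\<^sup>2 \<ge> 1" by (simp add: field_simps)
    then show ?thesis by (simp add: bump_def)
  next
    case False
    then have "\<bar>x $ i\<bar> \<le> ?N" using component_le_norm_cart[of x i] by linarith
    then have "(x $ i)\<^sup>2 \<le> ?N\<^sup>2" using abs_le_square_iff by fastforce
    then show ?thesis by (intro mult_mono bump_le_fact) auto
  qed
  have q': "2 * (x $ i)\<^sup>2 / ?N\<^sup>2 * ?b k \<le> 2 * fact k" for k
    using q[of k] by (simp add: field_simps)
  have t: "\<bar>B2 - c * (B4 - 2 * B3)\<bar> \<le> \<bar>B2\<bar> + c * \<bar>B4\<bar> + 2 * (c * \<bar>B3\<bar>)" if "c \<ge> 0" for B2 B3 B4 c :: real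
  proof -
    have "\<bar>B2 - c * (B4 - 2 * B3)\<bar> \<le> \<bar>B2\<bar> + \<bar>c * B4\<bar> + 2 * \<bar>c * B3\<bar>" by (simp add: algebra_simps)
    then show ?thesis using that by (simp add: abs_mult)
  qed
  have "\<bar>iter_pd [i, i] (cutoff n) x\<bar> = (2 * exp 1 / ?N\<^sup>2) *
     \<bar>bump 2 (1 - (x \<bullet> x) / ?N\<^sup>2)
       - 2 * (x $ i)\<^sup>2 / ?N\<^sup>2 * (bump 4 (1 - (x \<bullet> x) / ?N\<^sup>2)
        - 2 * bump 3 (1 - (x \<bullet> x) / ?N\<^sup>2))\<bar>"
    unfolding pd2_cutoff abs_mult by simp
  also have "\<dots> \<le> (2 * exp 1 / ?N\<^sup>2) * (?b 2 + 2 * (x $ i)\<^sup>2 / ?N\<^sup>2 * ?b 4 + 2 * (2 * (x $ i)\<^sup>2 / ?N\<^sup>2 * ?b 3))"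
    by (intro mult_left_mono t) auto
  also have "\<dots> \<le> (2 * exp 1 / ?N\<^sup>2) * (fact 2 + 2 * fact 4 + 2 * (2 * fact 3))"
    by (intro mult_left_mono add_mono q' bump_le_fact) auto
  \<comment> \<open>148 is \<open>2 * (2! + 2 * 4! + 4 * 3!)\<close>; it is then rounded up to
    200.\<close>
  also have "\<dots> = 148 * exp 1 / ?N\<^sup>2"
    by (simp add: fact_numeral)
  also have "\<dots> \<le> 200 * exp 1 / ?N\<^sup>2"
    by (intro divide_right_mono) auto
  also have "\<dots> \<le> 200 * exp 1 / ?N"
    by (intro divide_left_mono self_le_power) auto
  finally show ?thesis .
qed

lemma cutoff_tendsto: "(\<lambda>n. cutoff n x) \<longlonglongrightarrow> 1"
proof -
  have i: "isCont (bump 0) 1"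
    using DERIV_bump DERIV_isCont by blast
  have "(\<lambda>n. (x \<bullet> x) * inverse (real (Suc n)) ^ 2) \<longlonglongrightarrow> (x \<bullet> x) * 0 ^ 2"
    by (intro tendsto_intros LIMSEQ_inverse_real_of_nat)
  then have "(\<lambda>n. 1 - (x \<bullet> x) / (real (Suc n))\<^sup>2) \<longlonglongrightarrow> 1 - 0"
    by (intro tendsto_intros) (simp add: divide_inverse power_inverse)
  then have "(\<lambda>n. bump 0 (1 - (x \<bullet> x) / (real (Suc n))\<^sup>2)) \<longlonglongrightarrow> bump 0 1"
    using isCont_tendsto_compose[OF i] by simp
  then have "(\<lambda>n. cutoff n x) \<longlonglongrightarrow> exp 1 * bump 0 1"
    unfolding cutoff_def by (intro tendsto_intros)
  \<comment> \<open>\<open>bump 0 1\<close> is \<open>exp (- 1)\<close>, which the prefactor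
    \<open>exp 1\<close> of \<open>cutoff\<close> cancels.\<close>
  then show ?thesis by (simp add: bump_def exp_minus)
qed

lemma tendsto_0_over_Suc:
  fixes a :: "nat \<Rightarrow> real" assumes "\<And>n. \<bar>a n\<bar> \<le> C / real (Suc n)" shows "a \<longlonglongrightarrow> 0"
proof (rule Lim_null_comparison)
  show "\<forall>\<^sub>F n in sequentially. norm (a n) \<le> C / real (Suc n)" using assms by simp
  have "(\<lambda>n. C * inverse (real (Suc n))) \<longlonglongrightarrow> C * 0"
    by (intro tendsto_intros LIMSEQ_inverse_real_of_nat)
  then show "(\<lambda>n. C / real (Suc n)) \<longlonglongrightarrow> 0" by (simp add: divide_inverse)
qed

lemma pd_cutoff_tendsto: "(\<lambda>n. iter_pd [i] (cutoff n) x) \<longlonglongrightarrow> 0"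
  by (rule tendsto_0_over_Suc[OF abs_pd_cutoff_le])

lemma pd2_cutoff_tendsto: "(\<lambda>n. iter_pd [i, i] (cutoff n) x) \<longlonglongrightarrow> 0"
  by (rule tendsto_0_over_Suc[OF abs_pd2_cutoff_le])

section \<open>Gaussian kernels\<close>

text \<open>\<open>gau s\<close> is the heat kernel of \<open>\<nu>\<Delta>\<close> at time \<open>s / (4 * \<nu>)\<close>; \<open>dgau\<close>, \<open>lgau\<close>,
  \<open>dlgau\<close> and \<open>llgau\<close> are its gradient, Laplacian, gradient of the Laplacian and bi-Laplacian.
  Writing the normalisation inside the exponential reduces all product formulas to
  identities between exponents.\<close>

definition gau :: "real \<Rightarrow> real^'d::finite \<Rightarrow> real" where
  "gau s x = exp (- (real CARD('d) / 2) * ln (pi * s) - (x \<bullet> x) / s)"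

definition dgau :: "real \<Rightarrow> real^'d::finite \<Rightarrow> real^'d" where
  "dgau s x = (- (2 / s) * gau s x) *\<^sub>R x"

text \<open>The quotient of the Laplacian of \<open>gau s\<close> by \<open>gau s\<close>. Keeping
  this polynomial factor apart lets the higher derivatives be formed by the product rule.\<close>

definition lapfac :: "real \<Rightarrow> real^'d::finite \<Rightarrow> real" where
  "lapfac s x = 4 * (x \<bullet> x) / s\<^sup>2 - 2 * real CARD('d) / s"

definition lgau :: "real \<Rightarrow> real^'d::finite \<Rightarrow> real" where
  "lgau s x = lapfac s x * gau s x"

definition dlgau :: "real \<Rightarrow> real^'d::finite \<Rightarrow> real^'d" where
  "dlgau s x = ((8 / s\<^sup>2 - 2 * lapfac s x / s) * gau s x) *\<^sub>R x"

definition llgau :: "real \<Rightarrow> real^'d::finite \<Rightarrow> real" where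
  "llgau s x = (8 * real CARD('d) / s\<^sup>2 - 32 * (x \<bullet> x) / s ^ 3 + (lapfac s x)\<^sup>2) * gau s x"

lemma gau_nonneg [simp]: "gau s x \<ge> 0" by (simp add: gau_def)

lemma gau_minus [simp]: "gau s (- x) = gau s x" by (simp add: gau_def)

lemma gau_commute: "gau s (x - y) = gau s (y - x)"
  by (metis gau_minus minus_diff_eq)

lemma dgau_minus [simp]: "dgau s (- x) = - dgau s x" by (simp add: dgau_def)

lemma measurable_gau [measurable (raw)]:
  assumes "f \<in> borel_measurable M" "g \<in> borel_measurable M"
  shows "(\<lambda>w. gau (f w) (g w)) \<in> borel_measurable M"
  unfolding gau_def using assms by measurable

lemma measurable_dgau [measurable (raw)]:
  assumes "f \<in> borel_measurable M" "g \<in> borel_measurable M"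
  shows "(\<lambda>w. dgau (f w) (g w)) \<in> borel_measurable M"
  unfolding dgau_def using assms by measurable

lemma measurable_lgau [measurable (raw)]:
  assumes "f \<in> borel_measurable M" "g \<in> borel_measurable M"
  shows "(\<lambda>w. lgau (f w) (g w)) \<in> borel_measurable M"
  unfolding lgau_def lapfac_def using assms by measurable

lemma measurable_dlgau [measurable (raw)]:
  assumes "f \<in> borel_measurable M" "g \<in> borel_measurable M"
  shows "(\<lambda>w. dlgau (f w) (g w)) \<in> borel_measurable M"
  unfolding dlgau_def lapfac_def using assms by measurable

lemma measurable_llgau [measurable (raw)]:
  assumes "f \<in> borel_measurable M" "g \<in> borel_measurable M"
  shows "(\<lambda>w. llgau (f w) (g w)) \<in> borel_measurable M"
  unfolding llgau_def lapfac_def using assms by measurable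

text \<open>The exponent is a sum over coordinates, so the kernel is a product of one-dimensional
  normal densities of mean 0 and variance \<open>s / 2\<close>.\<close>

lemma nn_integral_gau:
  assumes "s > 0" shows "(\<integral>\<^sup>+ x. ennreal (gau s (x::real^'d)) \<partial>lborel) = 1"
proof -
  let ?f = "\<lambda>u. ennreal (normal_density 0 (sqrt (s / 2)) u)"
  have eq: "ennreal (gau s x) = (\<Prod>b\<in>Basis. ?f (x \<bullet> b))" for x :: "real^'d"
  proof -
    have nd: "normal_density 0 (sqrt (s / 2)) u = exp (- (1/2) * ln (pi * s) - u\<^sup>2 / s)" for u
    proof -
      have "exp ((1/2) * ln (pi * s)) = sqrt (pi * s)"
        using assms powr_half_sqrt[of "pi * s"] by (simp add: powr_def)
      then have "exp (- (1/2) * ln (pi * s)) = 1 / sqrt (pi * s)"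
        by (simp add: exp_minus inverse_eq_divide)
      moreover have "exp (- (1/2) * ln (pi * s) - u\<^sup>2 / s) = exp (- (1/2) * ln (pi * s)) * exp (- (u\<^sup>2 / s))"
        by (simp only: mult_exp_exp) simp
      moreover have "2 * pi * (sqrt (s / 2))\<^sup>2 = pi * s" "2 * (sqrt (s / 2))\<^sup>2 = s"
        using assms by simp_all
      ultimately show ?thesis
        by (simp only: normal_density_def) simp
    qed
    have "(\<Prod>b\<in>Basis. normal_density 0 (sqrt (s / 2)) (x \<bullet> b))
        = exp (\<Sum>b\<in>(Basis::(real^'d) set). - (1/2) * ln (pi * s) - (x \<bullet> b)\<^sup>2 / s)"
      unfolding nd by (simp add: exp_sum)
    also have "(\<Sum>b\<in>(Basis::(real^'d) set). - (1/2) * ln (pi * s) - (x \<bullet> b)\<^sup>2 / s)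
        = - (real CARD('d) / 2) * ln (pi * s) - (x \<bullet> x) / s"
      by (simp add: sum_subtractf sum_divide_distrib[symmetric] euclidean_inner[of x x] power2_eq_square)
    finally show ?thesis
      by (subst prod_ennreal) (simp_all add: gau_def)
  qed
  have "(\<integral>\<^sup>+ x. ennreal (gau s (x::real^'d)) \<partial>lborel) = (\<Prod>b\<in>(Basis::(real^'d) set). \<integral>\<^sup>+ u. ?f u \<partial>lborel)"
    unfolding eq by (rule nn_integral_lborel_prod) auto
  also have "(\<integral>\<^sup>+ u. ?f u \<partial>lborel) = 1"
  proof -
    interpret prob_space "density lborel (normal_density 0 (sqrt (s / 2)))"
      using assms by (intro prob_space_normal_density) simp
    show ?thesis using emeasure_space_1 by (simp add: emeasure_density)
  qed
  finally show ?thesis by simp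
qed

lemma nn_integral_lborel_shift:
  fixes f :: "'a::euclidean_space \<Rightarrow> ennreal"
  assumes [measurable]: "f \<in> borel_measurable borel"
  shows "(\<integral>\<^sup>+ x. f (x - a) \<partial>lborel) = (\<integral>\<^sup>+ x. f x \<partial>lborel)"
  by (subst (2) lborel_distr_plus[of "- a", symmetric]) (simp add: nn_integral_distr)

lemma nn_integral_gau_shift:
  assumes "s > 0" shows "(\<integral>\<^sup>+ x. ennreal (gau s (x - a)) \<partial>lborel) = 1"
  using nn_integral_lborel_shift[of "\<lambda>x. ennreal (gau s x)" a] nn_integral_gau[OF assms] by simp

text \<open>Completing the square in \<open>z\<close>: one Gaussian in \<open>x - y\<close>, free of
  \<open>z\<close>, and one centred at a weighted mean of \<open>x\<close> and \<open>y\<close>.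
  Integrating \<open>z\<close> out then gives the semigroup law exactly.\<close>

lemma gau_mult_gau:
  assumes "a > 0" "c > 0"
  shows "gau a (x - z) * gau c (z - y) =
     gau (a + c) (x - y) * gau (a * c / (a + c)) (z - (1 / (a + c)) *\<^sub>R (c *\<^sub>R x + a *\<^sub>R y))"
proof -
  have l: "ln (pi * a) + ln (pi * c) = ln (pi * (a + c)) + ln (pi * (a * c / (a + c)))"
    using assms by (simp add: ln_mult ln_div)
  define m where "m = (1 / (a + c)) *\<^sub>R (c *\<^sub>R x + a *\<^sub>R y)"
  have p: "a + c > 0" "a * c > 0" using assms by auto
  \<comment> \<open>Both differences are written through \<open>x - y\<close> and the deviation
    \<open>z - m\<close>; after division by \<open>a\<close> and \<open>c\<close> the mixed terms of
    the two quadratic forms cancel.\<close>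
  have xm: "x - z = (a / (a + c)) *\<^sub>R (x - y) - (z - m)"
  proof -
    have "x - m = (a / (a + c)) *\<^sub>R (x - y)"
    proof -
      have "x = ((a + c) / (a + c)) *\<^sub>R x" using p by simp
      then have "x - m = (1 / (a + c)) *\<^sub>R ((a + c) *\<^sub>R x - (c *\<^sub>R x + a *\<^sub>R y))"
        unfolding m_def by (simp add: scaleR_diff_right)
      then show ?thesis by (simp add: algebra_simps)
    qed
    then show ?thesis by (simp add: algebra_simps)
  qed
  have zy: "z - y = (z - m) + (c / (a + c)) *\<^sub>R (x - y)"
  proof -
    have "y = ((a + c) / (a + c)) *\<^sub>R y" using p by simp
    then have "m - y = (1 / (a + c)) *\<^sub>R (c *\<^sub>R x + a *\<^sub>R y - (a + c) *\<^sub>R y)"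
      unfolding m_def by (simp add: scaleR_diff_right)
    then have "m - y = (c / (a + c)) *\<^sub>R (x - y)" by (simp add: algebra_simps)
    then show ?thesis by (simp add: algebra_simps)
  qed
  obtain u v where u: "u = x - y" and v: "v = z - m" by blast
  have "((x - z) \<bullet> (x - z)) / a + ((z - y) \<bullet> (z - y)) / c
      = ((x - y) \<bullet> (x - y)) / (a + c) + ((z - m) \<bullet> (z - m)) / (a * c / (a + c))"
  proof -
    have e1: "(x - z) \<bullet> (x - z) = (a / (a + c))\<^sup>2 * (u \<bullet> u) - 2 * (a / (a + c)) * (u \<bullet> v) + v \<bullet> v"
      unfolding xm u[symmetric] v[symmetric]
      by (simp add: inner_diff_left inner_diff_right inner_commute power2_eq_square)
    have e2: "(z - y) \<bullet> (z - y) = (c / (a + c))\<^sup>2 * (u \<bullet> u) + 2 * (c / (a + c)) * (u \<bullet> v) + v \<bullet> v"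
      unfolding zy u[symmetric] v[symmetric]
      by (simp add: inner_add_left inner_add_right inner_commute power2_eq_square)
    have r: "((a / q)\<^sup>2 * U - 2 * (a / q) * W + V) / a + ((c / q)\<^sup>2 * U + 2 * (c / q) * W + V) / c
       = U / q + V / (a * c / q)" if "q = a + c" for q U V W
    proof -
      have "q \<noteq> 0" "a \<noteq> 0" "c \<noteq> 0" using that assms by auto
      then have "((a / q)\<^sup>2 * U - 2 * (a / q) * W + V) / a + ((c / q)\<^sup>2 * U + 2 * (c / q) * W + V) / c
        = (a + c) * U / q\<^sup>2 + V * (a + c) / (a * c)"
        by (simp add: field_simps power2_eq_square)
      also have "\<dots> = U / q + V / (a * c / q)" using \<open>q \<noteq> 0\<close> that by (simp add: power2_eq_square)
      finally show ?thesis .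
    qed
    show ?thesis unfolding e1 e2 u[symmetric] v[symmetric] by (rule r) simp
  qed
  then have "- (real CARD('a) / 2) * ln (pi * a) - ((x - z) \<bullet> (x - z)) / a +
     (- (real CARD('a) / 2) * ln (pi * c) - ((z - y) \<bullet> (z - y)) / c) =
     - (real CARD('a) / 2) * ln (pi * (a + c)) - ((x - y) \<bullet> (x - y)) / (a + c) +
     (- (real CARD('a) / 2) * ln (pi * (a * c / (a + c))) - ((z - m) \<bullet> (z - m)) / (a * c / (a + c)))"
    using arg_cong[OF l, of "\<lambda>t. (real CARD('a) / 2) * t"] by (simp add: distrib_left)
  then show ?thesis
    unfolding gau_def m_def[symmetric] mult_exp_exp by simp
qed

lemma nn_integral_gau_semigroup:
  assumes "a > 0" "c > 0"
  shows "(\<integral>\<^sup>+ z. ennreal (gau a (x - z) * gau c (z - y)) \<partial>lborel) = ennreal (gau (a + c) (x - y))"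
  unfolding gau_mult_gau[OF assms] using assms
  by (simp add: ennreal_mult nn_integral_cmult nn_integral_gau_shift)

lemma gau_le_double:
  assumes "s > 0"
  shows "gau s (x::real^'d) \<le> exp (real CARD('d) / 2 * ln 2) * gau (2 * s) x"
proof -
  have "ln (pi * (2 * s)) = ln 2 + ln (pi * s)" using assms by (simp add: ln_mult)
  moreover have "x \<bullet> x / (2 * s) \<le> x \<bullet> x / s" using assms by (simp add: field_simps)
  ultimately show ?thesis
    unfolding gau_def mult_exp_exp by (simp add: algebra_simps)
qed

text \<open>With \<open>v = norm x / sqrt s\<close> one has
  \<open>v \<le> exp (v\<^sup>2 / 2)\<close>, so half of the exponent absorbs the linear factor of
  the gradient. The other half is a Gaussian of twice the variance, up to the ratio of the
  normalisations, and there remains \<open>1 / sqrt s\<close>, integrable in time.\<close>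

lemma norm_dgau_le:
  assumes "s > 0"
  shows "norm (dgau s (x::real^'d)) \<le> 2 * exp (real CARD('d) / 2 * ln 2) / sqrt s * gau (2 * s) x"
proof -
  let ?v = "norm x / sqrt s"
  have v: "?v \<ge> 0" using assms by simp
  have "?v \<le> 1 + ?v\<^sup>2 / 2"
    using sum_squares_bound[of ?v 1] zero_le_power2[of ?v] by (simp only: one_power2 mult_1_right)
  also have "\<dots> \<le> exp (?v\<^sup>2 / 2)" by (rule exp_ge_add_one_self)
  also have "?v\<^sup>2 / 2 = (x \<bullet> x) / (2 * s)"
    using assms by (simp add: power_divide dot_square_norm)
  finally have 1: "?v \<le> exp ((x \<bullet> x) / (2 * s))" .
  have 2: "exp ((x \<bullet> x) / (2 * s)) * gau s x = exp (real CARD('d) / 2 * ln 2) * gau (2 * s) x"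
  proof -
    have "ln (pi * (2 * s)) = ln 2 + ln (pi * s)" using assms by (simp add: ln_mult)
    moreover have "(x \<bullet> x) / (2 * s) + - (x \<bullet> x / s) = - (x \<bullet> x / (2 * s))" using assms by (simp add: field_simps)
    ultimately show ?thesis
      unfolding gau_def mult_exp_exp by (simp add: algebra_simps)
  qed
  have "norm (dgau s x) = 2 / sqrt s * (?v * gau s x)"
    using assms by (simp add: dgau_def abs_mult real_div_sqrt field_simps)
  also have "\<dots> \<le> 2 / sqrt s * (exp ((x \<bullet> x) / (2 * s)) * gau s x)"
    using assms by (intro mult_left_mono mult_right_mono 1) auto
  finally show ?thesis unfolding 2 by simp
qed

section \<open>Derivatives of the heat kernel in space and time\<close>

lemma has_derivative_gau:
  "((\<lambda>z. gau s (z - y)) has_derivative (\<lambda>h. dgau s (z - y) \<bullet> h)) (at z)"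
proof -
  let ?c = "- (real CARD('a) / 2) * ln (pi * s)"
  have "((\<lambda>z. (z - y) \<bullet> (z - y)) has_derivative (\<lambda>h. 2 * ((z - y) \<bullet> h))) (at z)"
    by (auto intro!: derivative_eq_intros simp: inner_commute)
  then have "((\<lambda>z. ?c - (1 / s) * ((z - y) \<bullet> (z - y))) has_derivative
      (\<lambda>h. 0 - (1 / s) * (2 * ((z - y) \<bullet> h)))) (at z)"
    by (intro has_derivative_diff has_derivative_const has_derivative_mult_right)
  from has_derivative_exp[OF this]
  have "((\<lambda>z. gau s (z - y)) has_derivative (\<lambda>h. (0 - (1 / s) * (2 * ((z - y) \<bullet> h))) * gau s (z - y))) (at z)"
    unfolding gau_def by (simp only: mult_1_left times_divide_eq_left)
  then show ?thesis
    by (rule has_derivative_eq_rhs) (simp add: dgau_def fun_eq_iff)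
qed

lemma grad_eqI:
  assumes "(f has_derivative (\<lambda>h. v \<bullet> h)) (at x)" shows "grad f x = v"
  unfolding grad_def iter_pd_single_eq[OF assms] by (simp add: inner_axis vec_eq_iff)

lemma grad_gau: "grad (\<lambda>z. gau s (z - y)) z = dgau s (z - y)"
  by (rule grad_eqI[OF has_derivative_gau])

lemma pd_eqI:
  assumes "\<And>x. (f has_derivative (\<lambda>h. v x \<bullet> h)) (at x)" shows "iter_pd [i] f = (\<lambda>x. v x $ i)"
  by (rule ext) (simp add: iter_pd_single_eq[OF assms] inner_axis del: iter_pd.simps)

text \<open>The common shape of the first partial derivatives of \<open>gau\<close> and
  \<open>lgau\<close>: a coordinate, a radial factor \<open>F\<close> and the Gaussian.
  \<open>F\<close> is \<open>- (2 / s)\<close> for \<open>gau\<close> and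
  \<open>8 / s\<^sup>2 - 2 * lapfac / s\<close> for \<open>lgau\<close>, so one rule serves both
  Laplacians.\<close>

lemma has_derivative_gau_coord:
  assumes "\<And>z. (F has_derivative (\<lambda>h. k z * ((z - y) \<bullet> h))) (at z)"
  shows "((\<lambda>z. (z - y) $ i * (F z * gau s (z - y))) has_derivative
    (\<lambda>h. h $ i * (F z * gau s (z - y)) + (z - y) $ i * (k z * ((z - y) \<bullet> h) * gau s (z - y)
       + F z * (dgau s (z - y) \<bullet> h)))) (at z)"
  by (auto intro!: derivative_eq_intros assms has_derivative_gau bounded_linear.has_derivative[OF bounded_linear_vec_nth]
      simp: algebra_simps)

lemma sum_coord_squares:
  "(\<Sum>i\<in>UNIV. a + b * (w $ i * w $ i)) = real CARD('d) * a + b * ((w::real^'d) \<bullet> w)"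
  by (simp add: sum.distrib sum_distrib_left[symmetric] inner_vec_def)

lemma laplacian_gau:
  "laplacian (\<lambda>z. gau s (z - y)) z = lgau s (z - (y::real^'d))"
proof -
  have "iter_pd [i, i] (\<lambda>z. gau s (z - y)) z = - (2 / s) * gau s (z - y)
     + (z - y) $ i * (- (2 / s) * (dgau s (z - y) $ i))" for i
  proof -
    have 1: "iter_pd [i] (\<lambda>z. gau s (z - y)) = (\<lambda>z. (z - y) $ i * (- (2 / s) * gau s (z - y)))"
      unfolding pd_eqI[OF has_derivative_gau] by (simp add: dgau_def fun_eq_iff)
    have "((\<lambda>z. - (2 / s)) has_derivative (\<lambda>h. 0 * ((z - y) \<bullet> h))) (at z)" for z by simp
    from iter_pd_single_eq[OF has_derivative_gau_coord[OF this], of i i]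
    show ?thesis unfolding pd2_eq 1
      by (simp add: inner_axis del: iter_pd.simps)
  qed
  note pd = this
  have "laplacian (\<lambda>z. gau s (z - y)) z = (\<Sum>i\<in>UNIV. - (2 / s) * gau s (z - y)
     + 4 / s\<^sup>2 * gau s (z - y) * ((z - y) $ i * (z - y) $ i))"
    unfolding laplacian_def by (intro sum.cong refl, subst pd) (simp add: dgau_def power2_eq_square del: vector_minus_component)
  also have "\<dots> = lgau s (z - y)"
    unfolding sum_coord_squares by (simp add: lgau_def lapfac_def algebra_simps del: inner_diff_left inner_diff_right)
  finally show ?thesis .
qed

lemma has_derivative_lapfac:
  "((\<lambda>z. lapfac s (z - y)) has_derivative (\<lambda>h. 8 / s\<^sup>2 * ((z - y) \<bullet> h))) (at z)"
proof -
  have "((\<lambda>z. (z - y) \<bullet> (z - y)) has_derivative (\<lambda>h. 2 * ((z - y) \<bullet> h))) (at z)"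
    by (auto intro!: derivative_eq_intros simp: inner_commute)
  then have "((\<lambda>z. 4 / s\<^sup>2 * ((z - y) \<bullet> (z - y)) - 2 * real CARD('a) / s) has_derivative
      (\<lambda>h. 4 / s\<^sup>2 * (2 * ((z - y) \<bullet> h)) - 0)) (at z)"
    by (intro has_derivative_diff has_derivative_const has_derivative_mult_right)
  then show ?thesis unfolding lapfac_def by simp
qed

lemma has_derivative_lgau:
  "((\<lambda>z. lgau s (z - y)) has_derivative (\<lambda>h. dlgau s (z - y) \<bullet> h)) (at z)"
proof -
  have *: "L * ((- (2 / s) * g) * X) + 8 / s\<^sup>2 * X * g = (8 / s\<^sup>2 - 2 * L / s) * g * X" for L g X :: real
    by (simp add: algebra_simps)
  show ?thesis
    unfolding lgau_def
  proof (rule has_derivative_eq_rhs[OF has_derivative_mult[OF has_derivative_lapfac has_derivative_gau]], rule ext)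
    fix h
    show "lapfac s (z - y) * (dgau s (z - y) \<bullet> h) + 8 / s\<^sup>2 * ((z - y) \<bullet> h) * gau s (z - y) = dlgau s (z - y) \<bullet> h"
      unfolding dgau_def dlgau_def inner_scaleR_left by (rule *)
  qed
qed

lemma grad_lgau: "grad (\<lambda>z. lgau s (z - y)) z = dlgau s (z - y)"
  by (rule grad_eqI[OF has_derivative_lgau])

lemma laplacian_lgau:
  "laplacian (\<lambda>z. lgau s (z - y)) z = llgau s (z - (y::real^'d))"
proof -
  define F where "F = (\<lambda>z. 8 / s\<^sup>2 - 2 * lapfac s (z - y) / s)"
  have F: "(F has_derivative (\<lambda>h. - (16 / s ^ 3) * ((z - y) \<bullet> h))) (at z)" for z
  proof -
    have "(F has_derivative (\<lambda>h. 0 - 2 / s * (8 / s\<^sup>2 * ((z - y) \<bullet> h)))) (at z)"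
      unfolding F_def times_divide_eq_left[symmetric]
      by (intro has_derivative_diff has_derivative_const has_derivative_mult_right has_derivative_lapfac)
    then show ?thesis
      by (rule has_derivative_eq_rhs) (simp add: fun_eq_iff power2_eq_square power3_eq_cube)
  qed
  have "iter_pd [i, i] (\<lambda>z. lgau s (z - y)) z = F z * gau s (z - y)
     + (z - y) $ i * (- (16 / s ^ 3) * (z - y) $ i * gau s (z - y) + F z * (dgau s (z - y) $ i))" for i
  proof -
    have 1: "iter_pd [i] (\<lambda>z. lgau s (z - y)) = (\<lambda>z. (z - y) $ i * (F z * gau s (z - y)))"
      unfolding pd_eqI[OF has_derivative_lgau] by (simp add: dlgau_def F_def fun_eq_iff)
    from iter_pd_single_eq[OF has_derivative_gau_coord[OF F], of i i]
    show ?thesis unfolding pd2_eq 1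
      by (simp add: inner_axis del: iter_pd.simps)
  qed
  note pd = this
  have "laplacian (\<lambda>z. lgau s (z - y)) z = (\<Sum>i\<in>UNIV. F z * gau s (z - y)
     + (- (16 / s ^ 3) - 2 * F z / s) * gau s (z - y) * ((z - y) $ i * (z - y) $ i))"
    unfolding laplacian_def by (intro sum.cong refl, subst pd) (simp add: dgau_def left_diff_distrib mult.assoc mult.left_commute del: vector_minus_component)
  also have "\<dots> = (real CARD('d) * F z + (- (16 / s ^ 3) - 2 * F z / s) * ((z - y) \<bullet> (z - y))) * gau s (z - y)"
  proof -
    have "D * (f * g) + c * g * w = (D * f + c * w) * g" for D f g c w :: real by (simp add: algebra_simps)
    then show ?thesis unfolding sum_coord_squares .
  qed
  also have "\<dots> = llgau s (z - y)"
  proof -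
    have "D * (8 / s\<^sup>2 - 2 * (4 * N / s\<^sup>2 - 2 * D / s) / s) + (- (16 / s ^ 3) - 2 * (8 / s\<^sup>2 - 2 * (4 * N / s\<^sup>2 - 2 * D / s) / s) / s) * N
      = 8 * D / s\<^sup>2 - 32 * N / s ^ 3 + (4 * N / s\<^sup>2 - 2 * D / s)\<^sup>2" for D N :: real
    proof -
      \<comment> \<open>In terms of \<open>r\<close> the identity is polynomial, hence valid without
        a sign condition on \<open>s\<close>.\<close>
      obtain r where r: "r = inverse s" by blast
      show ?thesis unfolding divide_inverse power_inverse[symmetric] r[symmetric]
        by (simp add: algebra_simps power2_eq_square power3_eq_cube)
    qed
    then show ?thesis unfolding llgau_def F_def lapfac_def by simp
  qed
  finally show ?thesis .
qed

text \<open>The heat equation in rescaled time: \<open>s\<close> stands for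
  \<open>4 * \<nu> * a\<close> with \<open>a\<close> the elapsed time, whence the factor
  1/4.\<close>

lemma DERIV_gau:
  assumes "s > 0" shows "((\<lambda>s. gau s x) has_real_derivative lgau s x / 4) (at s)"
proof -
  have "((\<lambda>s. gau s x) has_real_derivative
     gau s x * (- (real CARD('a) / 2) * (1 / s) + (x \<bullet> x) / s\<^sup>2)) (at s)"
  proof -
    have 1: "((\<lambda>s. ln (pi * s)) has_real_derivative 1 / s) (at s)"
      using assms by (auto intro!: derivative_eq_intros)
    have 2: "((\<lambda>s. (x \<bullet> x) / s) has_real_derivative - (x \<bullet> x) / s\<^sup>2) (at s)"
      using assms by (auto intro!: derivative_eq_intros simp: power2_eq_square)
    from DERIV_fun_exp[OF DERIV_diff[OF DERIV_cmult[OF 1] 2], of "- (real CARD('a) / 2)"]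
    show ?thesis unfolding gau_def by simp
  qed
  then show ?thesis
    by (rule DERIV_cong) (simp add: lgau_def lapfac_def algebra_simps)
qed

lemma DERIV_lapfac:
  assumes "s > 0" shows "((\<lambda>s. lapfac s x) has_real_derivative
    2 * real CARD('d) / s\<^sup>2 - 8 * ((x::real^'d) \<bullet> x) / s ^ 3) (at s)"
  unfolding lapfac_def using assms
  by (auto intro!: derivative_eq_intros simp: power2_eq_square power3_eq_cube field_simps)

lemma DERIV_lgau:
  assumes "s > 0" shows "((\<lambda>s. lgau s x) has_real_derivative llgau s x / 4) (at s)"
  unfolding lgau_def
  by (rule DERIV_cong[OF DERIV_mult[OF DERIV_lapfac[OF assms] DERIV_gau[OF assms]]])
     (simp add: lgau_def llgau_def algebra_simps power2_eq_square)

lemma DERIV_dgau: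
  assumes "s > 0" shows "((\<lambda>s. v \<bullet> dgau s x) has_real_derivative (v \<bullet> dlgau s x) / 4) (at s)"
proof -
  have 1: "((\<lambda>s. - (2 / s)) has_real_derivative 2 / s\<^sup>2) (at s)"
    using assms by (auto intro!: derivative_eq_intros simp: power2_eq_square field_simps)
  have "((\<lambda>s. (- (2 / s) * gau s x) * (v \<bullet> x)) has_real_derivative
      (- (2 / s) * (lgau s x / 4) + 2 / s\<^sup>2 * gau s x) * (v \<bullet> x)) (at s)"
    by (rule DERIV_cmult_right[OF DERIV_mult'[OF 1 DERIV_gau[OF assms]]])
  then show ?thesis unfolding dgau_def inner_scaleR_right
    by (rule DERIV_cong) (simp add: dlgau_def lgau_def algebra_simps)
qed

text \<open>Bounding \<open>((x \<bullet> x) / s) ^ k\<close> by \<open>fact k\<close> times an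
  exponential cancels the Gaussian factor. On the interval \<open>s ^ k\<close> is largest at
  \<open>A\<close> and the normalisation at \<open>e\<close>, so the bound is uniform in
  \<open>s\<close> and \<open>x\<close>.\<close>

lemma gau_moment_le:
  assumes "0 < e" "e \<le> s" "s \<le> A"
  shows "(x \<bullet> x) ^ k * gau s (x::real^'d) \<le> fact k * A ^ k * exp (- (real CARD('d) / 2) * ln (pi * e))"
proof -
  have s: "s > 0" using assms by simp
  have "((x \<bullet> x) / s) ^ k \<le> fact k * exp ((x \<bullet> x) / s)"
    by (rule power_le_fact_exp) (use s in auto)
  then have "((x \<bullet> x) / s) ^ k * exp (- ((x \<bullet> x) / s)) \<le> fact k"
    unfolding exp_minus by (subst divide_inverse[symmetric], subst divide_le_eq) simp
  then have "s ^ k * (((x \<bullet> x) / s) ^ k * exp (- ((x \<bullet> x) / s))) \<le> A ^ k * fact k"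
    using assms s by (intro mult_mono power_mono) auto
  then have 1: "(x \<bullet> x) ^ k * exp (- ((x \<bullet> x) / s)) \<le> fact k * A ^ k"
    using s by (simp add: power_divide mult.commute)
  have 2: "exp (- (real CARD('d) / 2) * ln (pi * s)) \<le> exp (- (real CARD('d) / 2) * ln (pi * e))"
    using assms s by (simp add: mult_left_mono)
  have "(x \<bullet> x) ^ k * gau s x = ((x \<bullet> x) ^ k * exp (- ((x \<bullet> x) / s))) * exp (- (real CARD('d) / 2) * ln (pi * s))"
    by (simp add: gau_def mult_exp_exp exp_add[symmetric] mult.assoc)
  also have "\<dots> \<le> (fact k * A ^ k) * exp (- (real CARD('d) / 2) * ln (pi * e))"
    using assms by (intro mult_mono 1 2) auto
  finally show ?thesis .
qed

text \<open>Away from time 0 every derivative is a polynomial in \<open>x\<close> times a Gaussian,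
  with negative powers of \<open>s\<close> bounded by those of \<open>e\<close>. The single constant
  serves the dominated convergence and Fubini arguments behind the mild formula.\<close>

lemma gau_bounds:
  assumes "0 < e" "e \<le> A"
  obtains B where "B \<ge> 0" "\<And>s (x::real^'d). e \<le> s \<Longrightarrow> s \<le> A \<Longrightarrow>
     gau s x \<le> B \<and> norm (dgau s x) \<le> B \<and> \<bar>lgau s x\<bar> \<le> B \<and> norm (dlgau s x) \<le> B \<and> \<bar>llgau s x\<bar> \<le> B"
proof -
  define D where "D = real CARD('d)"
  define m where "m k = fact k * A ^ k * exp (- (real CARD('d) / 2) * ln (pi * e))" for k :: nat
  have m0: "m k \<ge> 0" for k using assms by (simp add: m_def)
  define B1 where "B1 = 2 / e * (m 0 + m 1)"
  define B2 where "B2 = 4 / e\<^sup>2 * m 1 + 2 * D / e * m 0"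
  define B3 where "B3 = (8 / e\<^sup>2 + 4 * D / e\<^sup>2) * (m 0 + m 1) + 8 / e ^ 3 * (m 1 + m 2)"
  define B4 where "B4 = 8 * D / e\<^sup>2 * m 0 + 32 / e ^ 3 * m 1 + 32 / e ^ 4 * m 2 + 8 * D\<^sup>2 / e\<^sup>2 * m 0"
  have nn: "B1 \<ge> 0" "B2 \<ge> 0" "B3 \<ge> 0" "B4 \<ge> 0"
    using m0 assms unfolding B1_def B2_def B3_def B4_def D_def by auto
  have "gau s x \<le> m 0 \<and> norm (dgau s x) \<le> B1 \<and> \<bar>lgau s x\<bar> \<le> B2 \<and> norm (dlgau s x) \<le> B3 \<and> \<bar>llgau s x\<bar> \<le> B4"
    if s: "e \<le> s" "s \<le> A" for s and x :: "real^'d"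
  proof -
    define N where "N = x \<bullet> x"
    define g where "g = gau s x"
    have N0: "N \<ge> 0" by (simp add: N_def)
    have g0: "g \<ge> 0" by (simp add: g_def)
    have sp: "s > 0" using s assms by simp
    have mom: "N ^ k * g \<le> m k" for k
      unfolding N_def g_def m_def by (rule gau_moment_le[OF assms(1) s])
    have g1: "g \<le> m 0" and g2: "N * g \<le> m 1" and g3: "N\<^sup>2 * g \<le> m 2"
      using mom[of 0] mom[of 1] mom[of 2] by simp_all
    \<comment> \<open>Odd powers of \<open>norm x\<close> are traded for powers of \<open>N\<close>,
      to which \<open>mom\<close> applies.\<close>
    have nx: "norm x \<le> 1 + N"
    proof -
      have "norm x \<le> (1 + (norm x)\<^sup>2)"
        using zero_le_power2[of "norm x - 1"] unfolding power2_diff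
        by (smt (verit) norm_ge_zero one_power2 power2_eq_square mult_left_mono)
      then show ?thesis by (simp add: N_def dot_square_norm)
    qed
    have inv: "1 / s ^ k \<le> 1 / e ^ k" for k
      using assms s by (intro divide_left_mono power_mono) (auto simp: sp)
    have i1: "1 / s \<le> 1 / e" using inv[of 1] by simp
    have D0: "D \<ge> 0" by (simp add: D_def)
    have "norm (dgau s x) = 2 * (1 / s * (norm x * g))"
      using sp by (simp add: dgau_def g_def abs_mult)
    also have "\<dots> \<le> 2 * (1 / e * (m 0 + m 1))"
    proof (intro mult_left_mono mult_mono i1)
      have "norm x * g \<le> (1 + N) * g" by (intro mult_right_mono nx g0)
      then show "norm x * g \<le> m 0 + m 1" using g1 g2 by (simp add: algebra_simps)
    qed (use assms g0 in auto)
    finally have b1: "norm (dgau s x) \<le> B1" by (simp add: B1_def)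
    have lf: "\<bar>lapfac s x\<bar> \<le> 4 * (1 / s ^ 2 * N) + 2 * (D * (1 / s))"
    proof -
      have "lapfac s x = 4 * (1 / s ^ 2 * N) - 2 * (D * (1 / s))"
        by (simp add: lapfac_def N_def D_def)
      moreover have "4 * (1 / s ^ 2 * N) \<ge> 0" "2 * (D * (1 / s)) \<ge> 0" using N0 D0 sp by auto
      ultimately show ?thesis by linarith
    qed
    have lfe: "\<bar>lapfac s x\<bar> \<le> 4 / e\<^sup>2 * N + 2 * D / e"
    proof -
      have "1 / s ^ 2 * N \<le> 1 / e ^ 2 * N" "D * (1 / s) \<le> D * (1 / e)"
        using inv[of 2] i1 N0 D0 by (auto intro: mult_right_mono mult_left_mono simp del: times_divide_eq_right times_divide_eq_left)
      then show ?thesis using lf by simp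
    qed
    have "\<bar>lgau s x\<bar> = \<bar>lapfac s x\<bar> * g" by (simp add: lgau_def g_def abs_mult)
    also have "\<dots> \<le> (4 / e\<^sup>2 * N + 2 * D / e) * g" by (intro mult_right_mono lfe g0)
    also have "\<dots> = 4 / e\<^sup>2 * (N * g) + 2 * D / e * g" by (simp add: algebra_simps)
    also have "\<dots> \<le> B2" unfolding B2_def
      using assms D0 by (intro add_mono mult_left_mono g1 g2) auto
    finally have b2: "\<bar>lgau s x\<bar> \<le> B2" .
    have fac: "\<bar>8 / s\<^sup>2 - 2 * lapfac s x / s\<bar> \<le> 8 / e\<^sup>2 + 2 * (4 / e\<^sup>2 * N + 2 * D / e) / e"
    proof -
      have "\<bar>8 / s\<^sup>2 - 2 * lapfac s x / s\<bar> \<le> 8 * (1 / s ^ 2) + 2 * (\<bar>lapfac s x\<bar> * (1 / s))"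
        using sp abs_triangle_ineq4[of "8 / s\<^sup>2" "2 * lapfac s x / s"] by (simp add: abs_mult)
      also have "\<dots> \<le> 8 * (1 / e ^ 2) + 2 * ((4 / e\<^sup>2 * N + 2 * D / e) * (1 / e))"
        using sp order_trans[OF abs_ge_zero lfe] by (intro add_mono mult_left_mono mult_mono lfe inv i1) simp_all
      finally show ?thesis by simp
    qed
    have "norm (dlgau s x) = \<bar>8 / s\<^sup>2 - 2 * lapfac s x / s\<bar> * (norm x * g)"
      by (simp add: dlgau_def g_def abs_mult)
    also have "\<dots> \<le> (8 / e\<^sup>2 + 2 * (4 / e\<^sup>2 * N + 2 * D / e) / e) * ((1 + N) * g)"
      using N0 g0 D0 assms by (intro mult_mono fac mult_right_mono nx) auto
    also have "\<dots> = (8 / e\<^sup>2 + 4 * D / e\<^sup>2) * (g + N * g) + 8 / e ^ 3 * (N * g + N\<^sup>2 * g)"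
    proof -
      have "e \<noteq> 0" using assms by simp
      then show ?thesis by (simp add: field_simps power2_eq_square power3_eq_cube)
    qed
    also have "\<dots> \<le> B3" unfolding B3_def
      using assms D0 by (intro add_mono mult_left_mono g1 g2 g3) auto
    finally have b3: "norm (dlgau s x) \<le> B3" .
    have f4: "\<bar>8 * D / s\<^sup>2 - 32 * N / s ^ 3 + (lapfac s x)\<^sup>2\<bar> \<le>
         8 * D / e\<^sup>2 + 32 / e ^ 3 * N + 2 * ((4 / e\<^sup>2 * N)\<^sup>2 + (2 * D / e)\<^sup>2)"
    proof -
      have "\<bar>8 * D / s\<^sup>2 - 32 * N / s ^ 3 + (lapfac s x)\<^sup>2\<bar> \<le> 8 * D * (1 / s ^ 2) + 32 * N * (1 / s ^ 3) + (lapfac s x)\<^sup>2"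
      proof -
        have "8 * D / s\<^sup>2 \<ge> 0" "32 * N / s ^ 3 \<ge> 0" using D0 N0 sp by auto
        moreover have "\<bar>a - b + c\<^sup>2\<bar> \<le> a + b + c\<^sup>2" if "a \<ge> 0" "b \<ge> 0" for a b c :: real
          using that zero_le_power2[of c] by linarith
        ultimately show ?thesis by simp
      qed
      also have "\<dots> \<le> 8 * D * (1 / e ^ 2) + 32 * N * (1 / e ^ 3) + (4 / e\<^sup>2 * N + 2 * D / e)\<^sup>2"
      proof (intro add_mono mult_left_mono inv)
        show "(lapfac s x)\<^sup>2 \<le> (4 / e\<^sup>2 * N + 2 * D / e)\<^sup>2"
          using lfe by (subst abs_le_square_iff[symmetric]) linarith
      qed (use D0 N0 in auto)
      also have "(4 / e\<^sup>2 * N + 2 * D / e)\<^sup>2 \<le> 2 * ((4 / e\<^sup>2 * N)\<^sup>2 + (2 * D / e)\<^sup>2)"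
      proof -
        have "(p + q)\<^sup>2 \<le> 2 * (p\<^sup>2 + q\<^sup>2)" for p q :: real
          using sum_squares_bound[of p q] by (simp add: power2_sum)
        then show ?thesis .
      qed
      finally show ?thesis by simp
    qed
    have "\<bar>llgau s x\<bar> = \<bar>8 * D / s\<^sup>2 - 32 * N / s ^ 3 + (lapfac s x)\<^sup>2\<bar> * g"
      by (simp add: llgau_def g_def D_def N_def abs_mult)
    also have "\<dots> \<le> (8 * D / e\<^sup>2 + 32 / e ^ 3 * N + 2 * ((4 / e\<^sup>2 * N)\<^sup>2 + (2 * D / e)\<^sup>2)) * g"
      by (intro mult_right_mono f4 g0)
    also have "\<dots> = 8 * D / e\<^sup>2 * g + 32 / e ^ 3 * (N * g) + 32 / e ^ 4 * (N\<^sup>2 * g) + 8 * D\<^sup>2 / e\<^sup>2 * g"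
      by (simp add: algebra_simps power_mult_distrib power_divide power2_eq_square power4_eq_xxxx)
    also have "\<dots> \<le> B4" unfolding B4_def
      using assms D0 by (intro add_mono mult_left_mono g1 g2 g3) auto
    finally have b4: "\<bar>llgau s x\<bar> \<le> B4" .
    show ?thesis using g1 b1 b2 b3 b4 unfolding g_def by blast
  qed
  then have *: "gau s x \<le> m 0 + B1 + B2 + B3 + B4 \<and> norm (dgau s x) \<le> m 0 + B1 + B2 + B3 + B4
    \<and> \<bar>lgau s x\<bar> \<le> m 0 + B1 + B2 + B3 + B4 \<and> norm (dlgau s x) \<le> m 0 + B1 + B2 + B3 + B4
    \<and> \<bar>llgau s x\<bar> \<le> m 0 + B1 + B2 + B3 + B4"
    if "e \<le> s" "s \<le> A" for s and x :: "real^'d"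
    using that nn m0[of 0] by (smt (verit))
  show ?thesis
    by (rule that[of "m 0 + B1 + B2 + B3 + B4"]) (use * nn m0[of 0] in auto)
qed

lemma elem_smooth_gau: "elem_smooth (\<lambda>z. gau s (z - y))"
proof -
  have "elem_smooth (\<lambda>z. exp (- (real CARD('a) / 2) * ln (pi * s) - ((z - y) \<bullet> (z - y)) * (1 / s)))"
    by (intro elem_smooth.intros elem_smooth_diff elem_smooth_inner)
  then show ?thesis unfolding gau_def by simp
qed

lemma elem_smooth_lgau: "elem_smooth (\<lambda>z. lgau s (z - y))"
proof -
  have "elem_smooth (\<lambda>z. (4 / s\<^sup>2 * ((z - y) \<bullet> (z - y)) - 2 * real CARD('a) / s) * gau s (z - y))"
    by (intro elem_smooth.mult elem_smooth.const elem_smooth_diff elem_smooth_inner elem_smooth_gau)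
  then show ?thesis unfolding lgau_def lapfac_def by simp
qed

section \<open>Space-time kernels and the Duhamel series\<close>

lemma borel_measurable_fst [measurable (raw)]:
  "u \<in> borel_measurable M \<Longrightarrow> (\<lambda>w. fst (u w :: 'a::second_countable_topology \<times> 'b::second_countable_topology)) \<in> borel_measurable M"
  by (rule measurable_compose[OF _ borel_measurable_continuous_onI]) (auto intro: continuous_intros)

lemma borel_measurable_snd [measurable (raw)]:
  "u \<in> borel_measurable M \<Longrightarrow> (\<lambda>w. snd (u w :: 'a::second_countable_topology \<times> 'b::second_countable_topology)) \<in> borel_measurable M"
  by (rule measurable_compose[OF _ borel_measurable_continuous_onI]) (auto intro: continuous_intros)

lemma fst_snd_borel_measurable [measurable]:
  "(fst :: 'a::second_countable_topology \<times> 'b::second_countable_topology \<Rightarrow> 'a) \<in> borel_measurable borel"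
  "(snd :: 'a::second_countable_topology \<times> 'b::second_countable_topology \<Rightarrow> 'b) \<in> borel_measurable borel"
  by (intro borel_measurable_continuous_onI continuous_intros)+

lemma nn_integral_lborel_iterated:
  fixes f :: "'a::euclidean_space \<times> 'b::euclidean_space \<Rightarrow> ennreal"
  assumes [measurable]: "f \<in> borel_measurable borel"
  shows "(\<integral>\<^sup>+ m. f m \<partial>lborel) = (\<integral>\<^sup>+ r. \<integral>\<^sup>+ z. f (r, z) \<partial>lborel \<partial>lborel)"
  by (subst lborel.nn_integral_fst) (simp_all add: lborel_prod)

lemma integral_lborel_iterated:
  fixes f :: "'a::euclidean_space \<times> 'b::euclidean_space \<Rightarrow> real"
  assumes "integrable lborel f"
  shows "(\<integral> m. f m \<partial>lborel) = (\<integral> r. \<integral> z. f (r, z) \<partial>lborel \<partial>lborel)"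
  using lborel_pair.integral_fst'[of f] assms by (simp add: lborel_prod)

lemma borel_measurable_pairI:
  fixes f :: "'a::euclidean_space \<times> 'b::euclidean_space \<Rightarrow> 'c::topological_space"
  assumes "f \<in> borel_measurable borel"
  shows "f \<in> borel_measurable (borel \<Otimes>\<^sub>M lborel)" "f \<in> borel_measurable (lborel \<Otimes>\<^sub>M lborel)"
    "f \<in> borel_measurable (borel \<Otimes>\<^sub>M borel)"
proof -
  show "f \<in> borel_measurable (borel \<Otimes>\<^sub>M borel)" using assms by (simp add: borel_prod)
  moreover have "sets (borel \<Otimes>\<^sub>M lborel) = sets (borel \<Otimes>\<^sub>M (borel :: 'b measure))" for M :: "'a measure"
    by (intro sets_pair_measure_cong) simp_all
  moreover have "sets (lborel \<Otimes>\<^sub>M lborel) = sets ((borel :: 'a measure) \<Otimes>\<^sub>M (borel :: 'b measure))"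
    by (intro sets_pair_measure_cong) simp_all
  ultimately show "f \<in> borel_measurable (borel \<Otimes>\<^sub>M lborel)" "f \<in> borel_measurable (lborel \<Otimes>\<^sub>M lborel)"
    using measurable_cong_sets by blast+
qed

definition kmeas :: "('a::second_countable_topology \<Rightarrow> 'b::second_countable_topology \<Rightarrow> real) \<Rightarrow> bool" where
  "kmeas f \<longleftrightarrow> (\<lambda>p. f (fst p) (snd p)) \<in> borel_measurable borel"

lemma kmeas_compose:
  assumes "kmeas f" "u \<in> borel_measurable M" "v \<in> borel_measurable M"
  shows "(\<lambda>w. f (u w) (v w)) \<in> borel_measurable M"
proof -
  have "(\<lambda>w. (u w, v w)) \<in> borel_measurable M" using assms by (intro borel_measurable_Pair)
  from measurable_compose[OF this assms(1)[unfolded kmeas_def]] show ?thesis by simp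
qed

definition kcomp :: "('a::euclidean_space \<Rightarrow> 'a \<Rightarrow> real) \<Rightarrow> ('a \<Rightarrow> 'a \<Rightarrow> real) \<Rightarrow> 'a \<Rightarrow> 'a \<Rightarrow> real" where
  "kcomp f g a b = (\<integral> m. f a m * g m b \<partial>lborel)"

lemma kmeas_kcomp:
  fixes f g :: "'a::euclidean_space \<Rightarrow> 'a \<Rightarrow> real"
  assumes f: "kmeas f" and g: "kmeas g" shows "kmeas (kcomp f g)"
proof -
  have [measurable]: "(\<lambda>q :: ('a \<times> 'a) \<times> 'a. f (fst (fst q)) (snd q)) \<in> borel_measurable (borel \<Otimes>\<^sub>M lborel)"
    by (rule borel_measurable_pairI, intro kmeas_compose[OF f]
        borel_measurable_fst borel_measurable_snd measurable_ident_sets[OF refl])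
  have [measurable]: "(\<lambda>q :: ('a \<times> 'a) \<times> 'a. g (snd q) (snd (fst q))) \<in> borel_measurable (borel \<Otimes>\<^sub>M lborel)"
    by (rule borel_measurable_pairI, intro kmeas_compose[OF g]
        borel_measurable_fst borel_measurable_snd measurable_ident_sets[OF refl])
  have "(\<lambda>p. \<integral> m. f (fst p) m * g m (snd p) \<partial>lborel) \<in> borel_measurable borel"
    by (rule lborel.borel_measurable_lebesgue_integral) (simp add: case_prod_unfold)
  then show ?thesis by (simp add: kmeas_def kcomp_def)
qed

text \<open>Fubini at one pair \<open>(a, b)\<close>. Absolute convergence is demanded pair by pair
  because the available bounds blow up as the end points approach each other.\<close>

lemma kcomp_assoc:
  assumes f: "kmeas f" and g: "kmeas g" and h: "kmeas h"
    and fin: "(\<integral>\<^sup>+ m. \<integral>\<^sup>+ m'. ennreal (\<bar>f a m\<bar> * \<bar>g m m'\<bar> * \<bar>h m' b\<bar>) \<partial>lborel \<partial>lborel) < \<infinity>"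
  shows "kcomp (kcomp f g) h a b = kcomp f (kcomp g h) a b"
proof -
  have [measurable]: "(\<lambda>q. f a (fst q)) \<in> borel_measurable (lborel \<Otimes>\<^sub>M lborel)"
    by (rule borel_measurable_pairI, intro kmeas_compose[OF f]
        borel_measurable_fst borel_measurable_const measurable_ident_sets[OF refl])
  have [measurable]: "(\<lambda>q. g (fst q) (snd q)) \<in> borel_measurable (lborel \<Otimes>\<^sub>M lborel)"
    by (rule borel_measurable_pairI, intro kmeas_compose[OF g]
        borel_measurable_fst borel_measurable_snd measurable_ident_sets[OF refl])
  have [measurable]: "(\<lambda>q. h (snd q) b) \<in> borel_measurable (lborel \<Otimes>\<^sub>M lborel)"
    by (rule borel_measurable_pairI, intro kmeas_compose[OF h]
        borel_measurable_snd borel_measurable_const measurable_ident_sets[OF refl])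
  have "integrable (lborel \<Otimes>\<^sub>M lborel) (\<lambda>q. f a (fst q) * g (fst q) (snd q) * h (snd q) b)"
  proof (rule integrableI_bounded)
    have "(\<integral>\<^sup>+ q. ennreal (norm (f a (fst q) * g (fst q) (snd q) * h (snd q) b)) \<partial>(lborel \<Otimes>\<^sub>M lborel))
      = (\<integral>\<^sup>+ m. \<integral>\<^sup>+ m'. ennreal (\<bar>f a m\<bar> * \<bar>g m m'\<bar> * \<bar>h m' b\<bar>) \<partial>lborel \<partial>lborel)"
      by (subst lborel.nn_integral_fst[symmetric]) (simp_all add: abs_mult)
    then show "(\<integral>\<^sup>+ q. ennreal (norm (f a (fst q) * g (fst q) (snd q) * h (snd q) b)) \<partial>(lborel \<Otimes>\<^sub>M lborel)) < \<infinity>"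
      using fin by simp
  qed measurable
  then have "integrable (lborel \<Otimes>\<^sub>M lborel) (\<lambda>(m, m'). f a m * g m m' * h m' b)"
    by (simp add: case_prod_unfold)
  from lborel_pair.Fubini_integral[OF this]
  have "(\<integral> m'. (\<integral> m. f a m * g m m' * h m' b \<partial>lborel) \<partial>lborel) =
     (\<integral> m. (\<integral> m'. f a m * (g m m' * h m' b) \<partial>lborel) \<partial>lborel)"
    by (simp add: mult.assoc)
  then show ?thesis by (simp add: kcomp_def)
qed

subsection \<open>Kernels\<close>

text \<open>Kernels live on space-time points \<open>(time, position)\<close> and vanish unless \<open>0 \<le> s < t \<le> T\<close>, so that
  composition of kernels is a plain integral over space-time. \<open>KK\<close> and \<open>LL\<close> are \<open>c\<cdot>\<nabla>G\<close> with the
  gradient falling on the earlier and (with a minus sign) on the later point.\<close>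

definition kreg :: "real \<Rightarrow> real \<times> 'a \<Rightarrow> real \<times> 'a \<Rightarrow> bool" where
  "kreg T a b \<longleftrightarrow> 0 \<le> fst a \<and> fst a < fst b \<and> fst b \<le> T"

definition GK :: "real \<Rightarrow> real \<Rightarrow> real \<times> (real^'d::finite) \<Rightarrow> real \<times> (real^'d) \<Rightarrow> real" where
  "GK \<nu> T a b = (if kreg T a b then gau (4 * \<nu> * (fst b - fst a)) (snd a - snd b) else 0)"

definition KK :: "real \<Rightarrow> real \<Rightarrow> (real \<times> (real^'d::finite) \<Rightarrow> real^'d) \<Rightarrow> real \<times> (real^'d) \<Rightarrow> real \<times> (real^'d) \<Rightarrow> real" where
  "KK \<nu> T c a b = (if kreg T a b then c a \<bullet> dgau (4 * \<nu> * (fst b - fst a)) (snd a - snd b) else 0)"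

definition LL :: "real \<Rightarrow> real \<Rightarrow> (real \<times> (real^'d::finite) \<Rightarrow> real^'d) \<Rightarrow> real \<times> (real^'d) \<Rightarrow> real \<times> (real^'d) \<Rightarrow> real" where
  "LL \<nu> T c a b = (if kreg T a b then c b \<bullet> dgau (4 * \<nu> * (fst b - fst a)) (snd a - snd b) else 0)"

text \<open>\<open>B0\<close> and \<open>B1\<close> are majorants. Their variance is twice that of
  \<open>GK\<close>, which pays for the gradient in \<open>norm_dgau_le\<close>; \<open>B1\<close>
  carries the leftover singularity. As both have the same variance rate, composing them reproduces
  the Gaussian and only a time integral is left.\<close>

definition B0 :: "real \<Rightarrow> real \<Rightarrow> real \<times> (real^'d::finite) \<Rightarrow> real \<times> (real^'d) \<Rightarrow> real" where
  "B0 \<nu> T a b = (if kreg T a b then gau (8 * \<nu> * (fst b - fst a)) (snd a - snd b) else 0)"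

definition B1 :: "real \<Rightarrow> real \<Rightarrow> real \<times> (real^'d::finite) \<Rightarrow> real \<times> (real^'d) \<Rightarrow> real" where
  "B1 \<nu> T a b = (if kreg T a b then 1 / sqrt (fst b - fst a) * gau (8 * \<nu> * (fst b - fst a)) (snd a - snd b) else 0)"

fun MM :: "real \<Rightarrow> real \<Rightarrow> (real \<times> (real^'d::finite) \<Rightarrow> real^'d) \<Rightarrow> nat \<Rightarrow> real \<times> (real^'d) \<Rightarrow> real \<times> (real^'d) \<Rightarrow> real" where
  "MM \<nu> T c 0 = GK \<nu> T"
| "MM \<nu> T c (Suc n) = kcomp (MM \<nu> T c n) (KK \<nu> T c)"

section \<open>The integrable singularity in time\<close>

lemma nn_integral_inverse_sqrt:
  "(\<integral>\<^sup>+ u. ennreal (indicator {0<..<l} u * (1 / sqrt u)) \<partial>lborel) \<le> ennreal (2 * sqrt l)"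
proof (cases "l \<ge> 0")
  case True
  have "((\<lambda>x. x powr (-1/2)) has_integral (l powr (-1/2+1) / (-1/2+1))) {0..l}"
    by (rule has_integral_powr_from_0) (use True in auto)
  then have "((\<lambda>x. x powr (-1/2)) has_integral (2 * sqrt l)) {0..l}"
    using True by (simp add: powr_half_sqrt mult.commute)
  from nn_integral_has_integral_lebesgue[OF _ this]
  have "(\<integral>\<^sup>+ x. ennreal (indicator {0..l} x * x powr (-1/2)) \<partial>lborel) = ennreal (2 * sqrt l)"
    by simp
  moreover have "indicator {0<..<l} u * (1 / sqrt u) \<le> indicator {0..l} u * u powr (-1/2)" for u
  proof (cases "u > 0")
    case True
    have "u powr (-1/2) = 1 / (u powr (1/2))"
      using powr_minus_divide[of u "1/2"] by simp
    then have "u powr (-1/2) = 1 / sqrt u"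
      using True by (simp only: powr_half_sqrt[OF less_imp_le])
    then show ?thesis using True by (auto simp: indicator_def)
  qed (auto simp: indicator_def)
  then have "(\<integral>\<^sup>+ u. ennreal (indicator {0<..<l} u * (1 / sqrt u)) \<partial>lborel) \<le>
      (\<integral>\<^sup>+ x. ennreal (indicator {0..l} x * x powr (-1/2)) \<partial>lborel)"
    by (intro nn_integral_mono ennreal_leI)
  ultimately show ?thesis by simp
next
  case False
  \<comment> \<open>For negative \<open>l\<close> the interval is empty, and the right-hand side is
    0 because \<open>sqrt l\<close> is negative.\<close>
  then have "indicator {0<..<l} u = (0::real)" for u by (auto simp: indicator_def)
  then show ?thesis by simp
qed

lemma nn_integral_inverse_sqrt_right:
  "(\<integral>\<^sup>+ r. ennreal (indicator {s<..<t} r * (1 / sqrt (t - r))) \<partial>lborel) \<le> ennreal (2 * sqrt (t - s))"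
proof -
  have "(\<integral>\<^sup>+ r. ennreal (indicator {s<..<t} r * (1 / sqrt (t - r))) \<partial>lborel)
     = (\<integral>\<^sup>+ u. ennreal (indicator {s<..<t} (t + (-1) * u) * (1 / sqrt (t - (t + (-1) * u)))) \<partial>lborel)"
    by (subst nn_integral_real_affine[where c = "-1" and t = t]) auto
  also have "\<dots> = (\<integral>\<^sup>+ u. ennreal (indicator {0<..<t - s} u * (1 / sqrt u)) \<partial>lborel)"
    by (intro nn_integral_cong) (auto simp: indicator_def)
  finally show ?thesis using nn_integral_inverse_sqrt by metis
qed

lemma nn_integral_inverse_sqrt_left:
  "(\<integral>\<^sup>+ r. ennreal (indicator {s<..<t} r * (1 / sqrt (r - s))) \<partial>lborel) \<le> ennreal (2 * sqrt (t - s))"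
proof -
  have "(\<integral>\<^sup>+ r. ennreal (indicator {s<..<t} r * (1 / sqrt (r - s))) \<partial>lborel)
     = (\<integral>\<^sup>+ u. ennreal (indicator {s<..<t} (s + 1 * u) * (1 / sqrt ((s + 1 * u) - s))) \<partial>lborel)"
    by (subst nn_integral_real_affine[where c = 1 and t = s]) auto
  also have "\<dots> = (\<integral>\<^sup>+ u. ennreal (indicator {0<..<t - s} u * (1 / sqrt u)) \<partial>lborel)"
    by (intro nn_integral_cong) (auto simp: indicator_def)
  finally show ?thesis using nn_integral_inverse_sqrt by metis
qed

text \<open>An exponential weight makes the Volterra operator with singular kernel a contraction.\<close>

lemma weighted_inverse_sqrt_small:
  assumes T: "T > 0" and C: "C \<ge> 0"
  obtains \<kappa> where "\<kappa> \<ge> 0" "\<And>s t. t - s \<le> T \<Longrightarrow>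
    (\<integral>\<^sup>+ r. ennreal (indicator {s<..<t} r * (C / sqrt (t - r) * exp (\<kappa> * (r - s)))) \<partial>lborel)
      \<le> ennreal (exp (\<kappa> * (t - s)) / 2)"
proof -
  \<comment> \<open>The time interval is split at distance \<open>\<delta>\<close> from the
    singularity. This \<open>\<delta>\<close> makes the near part at most 1/4, and
    \<open>\<kappa>\<close> is then so large that \<open>exp (- \<kappa> * \<delta>)\<close>,
    bounded by \<open>1 / (\<kappa> * \<delta>)\<close>, brings the far part below 1/4. Using
    \<open>C + 1\<close> avoids a division by 0.\<close>
  define \<delta> where "\<delta> = (1 / (8 * (C + 1)))\<^sup>2"
  have d: "\<delta> > 0" and sd: "sqrt \<delta> = 1 / (8 * (C + 1))" using C by (auto simp: \<delta>_def)
  define \<kappa> where "\<kappa> = 8 * (C + 1) * sqrt T / \<delta>"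
  have l: "\<kappa> \<ge> 0" using d C T by (simp add: \<kappa>_def)
  have small: "C * (2 * sqrt \<delta> + exp (- \<kappa> * \<delta>) * (2 * sqrt T)) \<le> 1 / 2"
  proof -
    have "\<kappa> * \<delta> = 8 * (C + 1) * sqrt T" using d by (simp add: \<kappa>_def)
    moreover have "\<kappa> * \<delta> \<le> exp (\<kappa> * \<delta>)" using exp_ge_add_one_self[of "\<kappa> * \<delta>"] by linarith
    ultimately have "exp (- \<kappa> * \<delta>) * (8 * (C + 1) * sqrt T) \<le> 1"
      by (simp add: exp_minus inverse_eq_divide divide_le_eq)
    then have 1: "(C + 1) * (exp (- \<kappa> * \<delta>) * (2 * sqrt T)) \<le> 1 / 4" by (simp add: algebra_simps)
    have 2: "(C + 1) * (2 * sqrt \<delta>) = 1 / 4" using C unfolding sd by (simp add: field_simps)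
    have "C * (2 * sqrt \<delta> + exp (- \<kappa> * \<delta>) * (2 * sqrt T)) \<le> (C + 1) * (2 * sqrt \<delta> + exp (- \<kappa> * \<delta>) * (2 * sqrt T))"
      using d T by (intro mult_right_mono) auto
    also have "\<dots> = (C + 1) * (2 * sqrt \<delta>) + (C + 1) * (exp (- \<kappa> * \<delta>) * (2 * sqrt T))" by (simp add: distrib_left)
    also have "\<dots> \<le> 1 / 2" using 1 2 by linarith
    finally show ?thesis .
  qed
  show ?thesis
  proof (rule that[OF l])
    fix s t :: real assume st: "t - s \<le> T"
    let ?E = "C * exp (\<kappa> * (t - s))"
    have E: "?E \<ge> 0" using C by simp
    \<comment> \<open>After factoring out \<open>exp (\<kappa> * (t - s))\<close>, the weight
      \<open>exp (- \<kappa> * (t - r))\<close> is bounded by 1 near \<open>t\<close> and by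
      \<open>exp (- \<kappa> * \<delta>)\<close> farther away.\<close>
    have pt: "indicator {s<..<t} r * (C / sqrt (t - r) * exp (\<kappa> * (r - s))) \<le>
       ?E * (indicator {t - \<delta><..<t} r * (1 / sqrt (t - r))) + (?E * exp (- \<kappa> * \<delta>)) * (indicator {s<..<t} r * (1 / sqrt (t - r)))" for r
    proof (cases "r \<in> {s<..<t}")
      case True
      have e: "exp (\<kappa> * (r - s)) = exp (\<kappa> * (t - s)) * exp (- \<kappa> * (t - r))"
        by (simp add: mult_exp_exp algebra_simps)
      have "exp (- \<kappa> * (t - r)) \<le> indicator {t - \<delta><..<t} r + exp (- \<kappa> * \<delta>)"
      proof (cases "r > t - \<delta>")
        case True
        then have "exp (- \<kappa> * (t - r)) \<le> 1" using \<open>r \<in> {s<..<t}\<close> l by (simp add: mult_nonneg_nonneg)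
        moreover have "indicator {t - \<delta><..<t} r = (1::real)" using True \<open>r \<in> {s<..<t}\<close> by simp
        moreover have "exp (- \<kappa> * \<delta>) \<ge> 0" by simp
        ultimately show ?thesis by linarith
      next
        case False
        then show ?thesis using l by (simp add: indicator_def mult_left_mono)
      qed
      then have "C / sqrt (t - r) * exp (\<kappa> * (t - s)) * exp (- \<kappa> * (t - r)) \<le>
          C / sqrt (t - r) * exp (\<kappa> * (t - s)) * (indicator {t - \<delta><..<t} r + exp (- \<kappa> * \<delta>))"
        using C True by (intro mult_left_mono) auto
      then show ?thesis unfolding e using True by (simp add: algebra_simps add_divide_distrib)
    next
      case False
      then show ?thesis using E by (auto simp: indicator_def)
    qed
    have "(\<integral>\<^sup>+ r. ennreal (indicator {s<..<t} r * (C / sqrt (t - r) * exp (\<kappa> * (r - s)))) \<partial>lborel)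
      \<le> (\<integral>\<^sup>+ r. (ennreal ?E * ennreal (indicator {t - \<delta><..<t} r * (1 / sqrt (t - r))) +
           ennreal (?E * exp (- \<kappa> * \<delta>)) * ennreal (indicator {s<..<t} r * (1 / sqrt (t - r)))) \<partial>lborel)"
    proof (rule nn_integral_mono)
      fix r
      have n: "indicator {t - \<delta><..<t} r * (1 / sqrt (t - r)) \<ge> 0" "indicator {s<..<t} r * (1 / sqrt (t - r)) \<ge> 0"
        by (auto simp: indicator_def)
      show "ennreal (indicator {s<..<t} r * (C / sqrt (t - r) * exp (\<kappa> * (r - s)))) \<le>
         ennreal ?E * ennreal (indicator {t - \<delta><..<t} r * (1 / sqrt (t - r))) +
           ennreal (?E * exp (- \<kappa> * \<delta>)) * ennreal (indicator {s<..<t} r * (1 / sqrt (t - r)))"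
      proof -
        have "ennreal a \<le> ennreal e * ennreal X + ennreal f * ennreal Y"
          if "a \<le> e * X + f * Y" "e \<ge> 0" "f \<ge> 0" "X \<ge> 0" "Y \<ge> 0" for a e f X Y :: real
          using that by (simp add: ennreal_mult[symmetric] ennreal_plus[symmetric] ennreal_leI del: ennreal_plus)
        from this[OF pt[of r] E _ n] E show ?thesis by simp
      qed
    qed
    also have "\<dots> = ennreal ?E * (\<integral>\<^sup>+ r. ennreal (indicator {t - \<delta><..<t} r * (1 / sqrt (t - r))) \<partial>lborel) +
        ennreal (?E * exp (- \<kappa> * \<delta>)) * (\<integral>\<^sup>+ r. ennreal (indicator {s<..<t} r * (1 / sqrt (t - r))) \<partial>lborel)"
      by (simp add: nn_integral_add nn_integral_cmult)
    also have "\<dots> \<le> ennreal ?E * ennreal (2 * sqrt (t - (t - \<delta>))) + ennreal (?E * exp (- \<kappa> * \<delta>)) * ennreal (2 * sqrt T)"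
    proof (intro add_mono mult_left_mono nn_integral_inverse_sqrt_right)
      show "(\<integral>\<^sup>+ r. ennreal (indicator {s<..<t} r * (1 / sqrt (t - r))) \<partial>lborel) \<le> ennreal (2 * sqrt T)"
        by (rule order_trans[OF nn_integral_inverse_sqrt_right]) (use st in \<open>auto intro!: ennreal_leI\<close>)
    qed auto
    also have "\<dots> = ennreal (exp (\<kappa> * (t - s)) * (C * (2 * sqrt \<delta> + exp (- \<kappa> * \<delta>) * (2 * sqrt T))))"
      using E d T C by (simp add: ennreal_mult[symmetric] ennreal_plus[symmetric] algebra_simps del: ennreal_plus)
    also have "\<dots> \<le> ennreal (exp (\<kappa> * (t - s)) * (1 / 2))"
      by (intro ennreal_leI mult_left_mono small) auto
    finally show "(\<integral>\<^sup>+ r. ennreal (indicator {s<..<t} r * (C / sqrt (t - r) * exp (\<kappa> * (r - s)))) \<partial>lborel)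
      \<le> ennreal (exp (\<kappa> * (t - s)) / 2)" by simp
  qed
qed

text \<open>The drift is a total function of the space-time point, bounded and Borel everywhere, so
  that the kernels are jointly measurable without side conditions.\<close>

locale drift =
  fixes \<nu> T M :: real and c :: "real \<times> (real^'d::finite) \<Rightarrow> real^'d"
  assumes nu: "\<nu> > 0" and T: "T > 0" and c_meas [measurable]: "c \<in> borel_measurable borel"
    and c_bound: "\<And>a. norm (c a) \<le> M"
begin

abbreviation "G \<equiv> GK \<nu> T"
abbreviation "K \<equiv> KK \<nu> T c"
abbreviation "L \<equiv> LL \<nu> T c"
abbreviation "b0 \<equiv> (B0 \<nu> T :: real \<times> (real^'d) \<Rightarrow> real \<times> (real^'d) \<Rightarrow> real)"
abbreviation "b1 \<equiv> (B1 \<nu> T :: real \<times> (real^'d) \<Rightarrow> real \<times> (real^'d) \<Rightarrow> real)"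

text \<open>\<open>C0\<close> is 2 to the power \<open>d / 2\<close>, the ratio of normalisations
  when the variance doubles. \<open>C1\<close> is the drift bound times the constant of
  \<open>norm_dgau_le\<close> at \<open>4 * \<nu> * (t - s)\<close>, with the time factor split off.
  \<open>C2\<close> is the integral of \<open>1 / sqrt u\<close> over \<open>(0, T)\<close>.\<close>

definition "C0 = exp (real CARD('d) / 2 * ln 2)"
definition "C1 = M * (2 * C0 / sqrt (4 * \<nu>))"
definition "C2 = 2 * sqrt T"

lemma M_nonneg: "M \<ge> 0" using c_bound[of undefined] norm_ge_zero order_trans by blast

lemma C_nonneg: "C0 \<ge> 0" "C1 \<ge> 0" "C2 \<ge> 0"
  using M_nonneg nu T by (auto simp: C0_def C1_def C2_def)

lemma kmeas_G: "kmeas G"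
  unfolding kmeas_def GK_def kreg_def by measurable
lemma kmeas_K: "kmeas K"
  unfolding kmeas_def KK_def kreg_def by measurable
lemma kmeas_L: "kmeas L"
  unfolding kmeas_def LL_def kreg_def by measurable
lemma kmeas_b0: "kmeas b0"
  unfolding kmeas_def B0_def kreg_def by measurable
lemma kmeas_b1: "kmeas b1"
  unfolding kmeas_def B1_def kreg_def by measurable

lemma b_nonneg [simp]: "b0 a b \<ge> 0" "b1 a b \<ge> 0"
  by (auto simp: B0_def B1_def kreg_def)

lemma G_bound: "\<bar>G a b\<bar> \<le> C0 * b0 a b"
  using nu gau_le_double[of "4 * \<nu> * (fst b - fst a)" "snd a - snd b"]
  by (auto simp: GK_def B0_def C0_def kreg_def mult.assoc)

lemma drift_dgau_bound:
  assumes "s < (t::real)"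
  shows "\<bar>c m \<bullet> dgau (4 * \<nu> * (t - s)) x\<bar> \<le> C1 * (1 / sqrt (t - s) * gau (8 * \<nu> * (t - s)) x)"
proof -
  have p: "4 * \<nu> * (t - s) > 0" using nu assms by simp
  have "\<bar>c m \<bullet> dgau (4 * \<nu> * (t - s)) x\<bar> \<le> norm (c m) * norm (dgau (4 * \<nu> * (t - s)) x)"
    by (rule Cauchy_Schwarz_ineq2)
  also have "\<dots> \<le> M * (2 * C0 / sqrt (4 * \<nu> * (t - s)) * gau (2 * (4 * \<nu> * (t - s))) x)"
    unfolding C0_def by (intro mult_mono c_bound norm_dgau_le[OF p]) (auto simp: M_nonneg)
  also have "\<dots> = C1 * (1 / sqrt (t - s) * gau (8 * \<nu> * (t - s)) x)"
    by (simp add: C1_def real_sqrt_mult mult.assoc)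
  finally show ?thesis .
qed

lemma K_bound: "\<bar>K a b\<bar> \<le> C1 * b1 a b"
  using drift_dgau_bound[of "fst a" "fst b" a "snd a - snd b"] by (auto simp: KK_def B1_def kreg_def)

lemma L_bound: "\<bar>L a b\<bar> \<le> C1 * b1 a b"
  using drift_dgau_bound[of "fst a" "fst b" b "snd a - snd b"] by (auto simp: LL_def B1_def kreg_def)

lemma gau_chain:
  assumes "s < r" "r < t"
  shows "(\<integral>\<^sup>+ z. ennreal (gau (8 * \<nu> * (r - s)) (x - z) * gau (8 * \<nu> * (t - r)) (z - y)) \<partial>lborel)
    = ennreal (gau (8 * \<nu> * (t - s)) (x - y))"
  using assms nu by (subst nn_integral_gau_semigroup) (simp_all add: algebra_simps)

text \<open>At a fixed intermediate time the position integral is the semigroup law and returns the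
  Gaussian of the whole interval, independent of that time. What remains is the integral of the
  inverse root over a length at most \<open>T\<close>.\<close>

lemma nn_integral_b0_b1_le: "(\<integral>\<^sup>+ m. ennreal (b0 a m * b1 m b) \<partial>lborel) \<le> ennreal (C2 * b0 a b)"
proof (cases "kreg T a b")
  case False
  then have "b0 a m * b1 m b = 0" for m by (auto simp: B0_def B1_def kreg_def)
  then show ?thesis by (simp only:) simp
next
  case True
  obtain s x t y where ab: "a = (s, x)" "b = (t, y)" by fastforce
  have st: "0 \<le> s" "s < t" "t \<le> T" using True by (auto simp: ab kreg_def)
  have [measurable]: "(\<lambda>m. b0 a m) \<in> borel_measurable borel" "(\<lambda>m. b1 m b) \<in> borel_measurable borel"
    by (intro kmeas_compose[OF kmeas_b0] kmeas_compose[OF kmeas_b1]; measurable)+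
  have "(\<integral>\<^sup>+ m. ennreal (b0 a m * b1 m b) \<partial>lborel)
     = (\<integral>\<^sup>+ r. \<integral>\<^sup>+ z. ennreal (b0 a (r, z) * b1 (r, z) b) \<partial>lborel \<partial>lborel)"
    by (rule nn_integral_lborel_iterated) measurable
  also have "\<dots> = (\<integral>\<^sup>+ r. ennreal (indicator {s<..<t} r * (1 / sqrt (t - r))) * ennreal (b0 a b) \<partial>lborel)"
  proof (rule nn_integral_cong)
    fix r
    show "(\<integral>\<^sup>+ z. ennreal (b0 a (r, z) * b1 (r, z) b) \<partial>lborel) = ennreal (indicator {s<..<t} r * (1 / sqrt (t - r))) * ennreal (b0 a b)"
    proof (cases "r \<in> {s<..<t}")
      case r: True
      have "(\<integral>\<^sup>+ z. ennreal (b0 a (r, z) * b1 (r, z) b) \<partial>lborel) =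
        (\<integral>\<^sup>+ z. ennreal (1 / sqrt (t - r)) * ennreal (gau (8 * \<nu> * (r - s)) (x - z) * gau (8 * \<nu> * (t - r)) (z - y)) \<partial>lborel)"
        using r st by (intro nn_integral_cong) (simp add: ab B0_def B1_def kreg_def ennreal_mult[symmetric] algebra_simps)
      also have "\<dots> = ennreal (1 / sqrt (t - r)) * ennreal (gau (8 * \<nu> * (t - s)) (x - y))"
        using r by (subst nn_integral_cmult) (auto simp: gau_chain)
      finally show ?thesis using r True by (simp add: ab B0_def)
    next
      case False
      then have z: "b0 a (r, z) * b1 (r, z) b = 0" for z by (auto simp: ab B0_def B1_def kreg_def)
      show ?thesis using False unfolding z by simp
    qed
  qed
  also have "\<dots> = (\<integral>\<^sup>+ r. ennreal (indicator {s<..<t} r * (1 / sqrt (t - r))) \<partial>lborel) * ennreal (b0 a b)"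
    by (rule nn_integral_multc) measurable
  also have "\<dots> \<le> ennreal C2 * ennreal (b0 a b)"
    by (intro mult_right_mono order_trans[OF nn_integral_inverse_sqrt_right])
       (use st in \<open>auto simp: C2_def intro!: ennreal_leI\<close>)
  finally show ?thesis using C_nonneg by (simp add: ennreal_mult)
qed

text \<open>The same computation with the singularity at the earlier end.\<close>

lemma nn_integral_b1_b0_le: "(\<integral>\<^sup>+ m. ennreal (b1 a m * b0 m b) \<partial>lborel) \<le> ennreal (C2 * b0 a b)"
proof (cases "kreg T a b")
  case False
  then have "b1 a m * b0 m b = 0" for m by (auto simp: B0_def B1_def kreg_def)
  then show ?thesis by (simp only:) simp
next
  case True
  obtain s x t y where ab: "a = (s, x)" "b = (t, y)" by fastforce
  have st: "0 \<le> s" "s < t" "t \<le> T" using True by (auto simp: ab kreg_def)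
  have [measurable]: "(\<lambda>m. b1 a m) \<in> borel_measurable borel" "(\<lambda>m. b0 m b) \<in> borel_measurable borel"
    by (intro kmeas_compose[OF kmeas_b0] kmeas_compose[OF kmeas_b1]; measurable)+
  have "(\<integral>\<^sup>+ m. ennreal (b1 a m * b0 m b) \<partial>lborel)
     = (\<integral>\<^sup>+ r. \<integral>\<^sup>+ z. ennreal (b1 a (r, z) * b0 (r, z) b) \<partial>lborel \<partial>lborel)"
    by (rule nn_integral_lborel_iterated) measurable
  also have "\<dots> = (\<integral>\<^sup>+ r. ennreal (indicator {s<..<t} r * (1 / sqrt (r - s))) * ennreal (b0 a b) \<partial>lborel)"
  proof (rule nn_integral_cong)
    fix r
    show "(\<integral>\<^sup>+ z. ennreal (b1 a (r, z) * b0 (r, z) b) \<partial>lborel) = ennreal (indicator {s<..<t} r * (1 / sqrt (r - s))) * ennreal (b0 a b)"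
    proof (cases "r \<in> {s<..<t}")
      case r: True
      have "(\<integral>\<^sup>+ z. ennreal (b1 a (r, z) * b0 (r, z) b) \<partial>lborel) =
        (\<integral>\<^sup>+ z. ennreal (1 / sqrt (r - s)) * ennreal (gau (8 * \<nu> * (r - s)) (x - z) * gau (8 * \<nu> * (t - r)) (z - y)) \<partial>lborel)"
        using r st by (intro nn_integral_cong) (simp add: ab B0_def B1_def kreg_def ennreal_mult[symmetric] algebra_simps)
      also have "\<dots> = ennreal (1 / sqrt (r - s)) * ennreal (gau (8 * \<nu> * (t - s)) (x - y))"
        using r by (subst nn_integral_cmult) (auto simp: gau_chain)
      finally show ?thesis using r True by (simp add: ab B0_def)
    next
      case False
      then have z: "b1 a (r, z) * b0 (r, z) b = 0" for z by (auto simp: ab B0_def B1_def kreg_def)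
      show ?thesis using False unfolding z by simp
    qed
  qed
  also have "\<dots> = (\<integral>\<^sup>+ r. ennreal (indicator {s<..<t} r * (1 / sqrt (r - s))) \<partial>lborel) * ennreal (b0 a b)"
    by (rule nn_integral_multc) measurable
  also have "\<dots> \<le> ennreal C2 * ennreal (b0 a b)"
    by (intro mult_right_mono order_trans[OF nn_integral_inverse_sqrt_left])
       (use st in \<open>auto simp: C2_def intro!: ennreal_leI\<close>)
  finally show ?thesis using C_nonneg by (simp add: ennreal_mult)
qed

text \<open>Composition with \<open>K\<close> preserves the shape \<open>\<alpha> * b0\<close>. The
  factor \<open>C1 * C2\<close> may exceed 1, so this yields finiteness of each iterate only;
  convergence of the series comes from the exponential weight in
  \<open>mild_solution_series\<close>.\<close>

lemma kcomp_K_bound: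
  assumes f: "kmeas f" and fb: "\<And>a b. \<bar>f a b\<bar> \<le> \<alpha> * b0 a b" and \<alpha>: "\<alpha> \<ge> 0"
  shows "integrable lborel (\<lambda>m. f a m * K m b)" "\<bar>kcomp f K a b\<bar> \<le> \<alpha> * C1 * C2 * b0 a b"
proof -
  have [measurable]: "(\<lambda>m. f a m) \<in> borel_measurable borel" "(\<lambda>m. K m b) \<in> borel_measurable borel"
      "(\<lambda>m. b0 a m) \<in> borel_measurable borel" "(\<lambda>m. b1 m b) \<in> borel_measurable borel"
    by (intro kmeas_compose[OF f] kmeas_compose[OF kmeas_K] kmeas_compose[OF kmeas_b0] kmeas_compose[OF kmeas_b1]; measurable)+
  have "(\<integral>\<^sup>+ m. ennreal (norm (f a m * K m b)) \<partial>lborel) \<le> (\<integral>\<^sup>+ m. ennreal (\<alpha> * C1) * ennreal (b0 a m * b1 m b) \<partial>lborel)"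
  proof (rule nn_integral_mono)
    fix m
    have "norm (f a m * K m b) \<le> (\<alpha> * b0 a m) * (C1 * b1 m b)"
      unfolding real_norm_def abs_mult by (intro mult_mono fb K_bound) (auto simp: \<alpha>)
    then show "ennreal (norm (f a m * K m b)) \<le> ennreal (\<alpha> * C1) * ennreal (b0 a m * b1 m b)"
      using \<alpha> C_nonneg by (simp add: ennreal_mult[symmetric] ennreal_leI mult_ac)
  qed
  also have "\<dots> = ennreal (\<alpha> * C1) * (\<integral>\<^sup>+ m. ennreal (b0 a m * b1 m b) \<partial>lborel)"
    by (rule nn_integral_cmult) measurable
  also have "\<dots> \<le> ennreal (\<alpha> * C1) * ennreal (C2 * b0 a b)"
    by (intro mult_left_mono nn_integral_b0_b1_le) auto
  also have "\<dots> = ennreal (\<alpha> * C1 * C2 * b0 a b)"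
    using \<alpha> C_nonneg by (simp add: ennreal_mult[symmetric] mult_ac)
  finally have *: "(\<integral>\<^sup>+ m. ennreal (norm (f a m * K m b)) \<partial>lborel) \<le> ennreal (\<alpha> * C1 * C2 * b0 a b)" .
  show I: "integrable lborel (\<lambda>m. f a m * K m b)"
    by (rule integrableI_bounded, measurable) (use le_less_trans[OF * ennreal_less_top] in simp)
  show "\<bar>kcomp f K a b\<bar> \<le> \<alpha> * C1 * C2 * b0 a b"
    using order_trans[OF integral_norm_bound_ennreal[OF I] *] \<alpha> C_nonneg by (simp add: kcomp_def)
qed

lemma LG_integrable: "integrable lborel (\<lambda>m. L a m * G m b)"
proof -
  have [measurable]: "(\<lambda>m. L a m) \<in> borel_measurable borel" "(\<lambda>m. G m b) \<in> borel_measurable borel"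
      "(\<lambda>m. b1 a m) \<in> borel_measurable borel" "(\<lambda>m. b0 m b) \<in> borel_measurable borel"
    by (intro kmeas_compose[OF kmeas_G] kmeas_compose[OF kmeas_L] kmeas_compose[OF kmeas_b0] kmeas_compose[OF kmeas_b1]; measurable)+
  have "(\<integral>\<^sup>+ m. ennreal (norm (L a m * G m b)) \<partial>lborel) \<le> (\<integral>\<^sup>+ m. ennreal (C1 * C0) * ennreal (b1 a m * b0 m b) \<partial>lborel)"
  proof (rule nn_integral_mono)
    fix m
    have "norm (L a m * G m b) \<le> (C1 * b1 a m) * (C0 * b0 m b)"
      unfolding real_norm_def abs_mult by (intro mult_mono L_bound G_bound) (auto simp: C_nonneg)
    then show "ennreal (norm (L a m * G m b)) \<le> ennreal (C1 * C0) * ennreal (b1 a m * b0 m b)"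
      using C_nonneg by (simp add: ennreal_mult[symmetric] ennreal_leI mult_ac)
  qed
  also have "\<dots> = ennreal (C1 * C0) * (\<integral>\<^sup>+ m. ennreal (b1 a m * b0 m b) \<partial>lborel)"
    by (rule nn_integral_cmult) measurable
  also have "\<dots> \<le> ennreal (C1 * C0) * ennreal (C2 * b0 a b)"
    by (intro mult_left_mono nn_integral_b1_b0_le) auto
  also have "\<dots> < \<infinity>" by (simp add: ennreal_mult[symmetric] ennreal_mult_less_top)
  finally show ?thesis by (intro integrableI_bounded) auto
qed

lemma MM_measurable_bounded:
  "kmeas (MM \<nu> T c n) \<and> (\<exists>\<alpha>\<ge>0. \<forall>a b. \<bar>MM \<nu> T c n a b\<bar> \<le> \<alpha> * b0 a b)"
proof (induction n)
  case 0
  then show ?case using kmeas_G G_bound C_nonneg(1) by auto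
next
  case (Suc n)
  then obtain \<alpha> where a: "\<alpha> \<ge> 0" "\<And>a b. \<bar>MM \<nu> T c n a b\<bar> \<le> \<alpha> * b0 a b" and m: "kmeas (MM \<nu> T c n)" by blast
  show ?case using kmeas_kcomp[OF m kmeas_K] kcomp_K_bound(2)[OF m a(2,1)] a(1) C_nonneg
    by (auto intro!: exI[of _ "\<alpha> * C1 * C2"])
qed

lemma kmeas_MM: "kmeas (MM \<nu> T c n)" using MM_measurable_bounded by blast

lemma MM_K_integrable: "integrable lborel (\<lambda>m. MM \<nu> T c n a m * K m b)"
proof -
  obtain \<alpha> where "\<alpha> \<ge> 0" "\<And>a b. \<bar>MM \<nu> T c n a b\<bar> \<le> \<alpha> * b0 a b" using MM_measurable_bounded by blast
  then show ?thesis by (intro kcomp_K_bound(1)[OF kmeas_MM])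
qed

lemma MM_eq_0: "\<not> kreg T a b \<Longrightarrow> MM \<nu> T c n a b = 0"
proof -
  assume k: "\<not> kreg T a b"
  obtain \<alpha> where "\<bar>MM \<nu> T c n a b\<bar> \<le> \<alpha> * b0 a b" using MM_measurable_bounded by blast
  with k show ?thesis by (simp add: B0_def)
qed

lemma nn_integral_b1:
  "(\<integral>\<^sup>+ y. ennreal (b1 (r, z) (t, y)) \<partial>lborel) \<le> ennreal (indicator {..<t} r * (1 / sqrt (t - r)))"
\<comment> \<open>The position \<open>undefined\<close> is a placeholder: \<open>kreg\<close> looks
  at the times only.\<close>
proof (cases "kreg T (r, z) (t, undefined::real^'d)")
  case True
  then have k: "kreg T (r, z) (t, y)" for y by (simp add: kreg_def)
  have rt: "r < t" using True by (simp add: kreg_def)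
  have "(\<integral>\<^sup>+ y. ennreal (b1 (r, z) (t, y)) \<partial>lborel) = (\<integral>\<^sup>+ y. ennreal (1 / sqrt (t - r)) * ennreal (gau (8 * \<nu> * (t - r)) (y - z)) \<partial>lborel)"
    using rt by (intro nn_integral_cong) (simp add: B1_def k ennreal_mult[symmetric] gau_commute[of _ z])
  also have "\<dots> = ennreal (1 / sqrt (t - r))"
    using rt nu by (subst nn_integral_cmult) (auto simp: nn_integral_gau_shift)
  finally show ?thesis using rt by simp
next
  case False
  then have k: "\<not> kreg T (r, z) (t, y)" for y by (simp add: kreg_def)
  show ?thesis by (simp add: B1_def k)
qed

text \<open>The remainder after \<open>n + 1\<close> terms is the remainder after \<open>n\<close>
  terms composed with \<open>K\<close>. In \<open>L1\<close> of the position, weighted by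
  \<open>exp (\<kappa> * (t - s))\<close>, this composition contracts by 1/2, so the mass bound on
  \<open>u\<close> is the only size information that enters.\<close>

lemma mild_solution_series:
  fixes u :: "real \<times> (real^'d) \<Rightarrow> real"
  assumes s: "0 \<le> s" and [measurable]: "u \<in> borel_measurable borel"
    and u0: "\<And>t y. t \<le> s \<Longrightarrow> u (t, y) = 0"
    and u1: "\<And>t. s < t \<Longrightarrow> t \<le> T \<Longrightarrow> (\<integral>\<^sup>+ y. ennreal \<bar>u (t, y)\<bar> \<partial>lborel) \<le> 1"
    and int: "\<And>t y. s < t \<Longrightarrow> t \<le> T \<Longrightarrow> integrable lborel (\<lambda>m. u m * K m (t, y))"
    and eq: "\<And>t y. s < t \<Longrightarrow> t \<le> T \<Longrightarrow> u (t, y) = G (s, x) (t, y) + (\<integral> m. u m * K m (t, y) \<partial>lborel)"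
  obtains \<Lambda> where "\<And>n t. s < t \<Longrightarrow> t \<le> T \<Longrightarrow>
    (\<integral>\<^sup>+ y. ennreal \<bar>u (t, y) - (\<Sum>k<n. MM \<nu> T c k (s, x) (t, y))\<bar> \<partial>lborel) \<le> ennreal (\<Lambda> / 2 ^ n)"
proof -
  define R where "R n b = u b - (\<Sum>k<n. MM \<nu> T c k (s, x) b)" for n b
  have Mm [measurable]: "(\<lambda>b. MM \<nu> T c k (s, x) b) \<in> borel_measurable borel" for k
    by (rule kmeas_compose[OF kmeas_MM]) measurable
  have Rm [measurable]: "R n \<in> borel_measurable borel" for n
    unfolding R_def[abs_def] by measurable
  have Km [measurable]: "(\<lambda>p. K (snd p) (t, fst p)) \<in> borel_measurable (lborel \<Otimes>\<^sub>M lborel)"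
      "(\<lambda>p. K (fst p) (t, snd p)) \<in> borel_measurable (lborel \<Otimes>\<^sub>M lborel)" for t
    subgoal by (rule borel_measurable_pairI, intro kmeas_compose[OF kmeas_K] borel_measurable_Pair
        borel_measurable_fst borel_measurable_snd borel_measurable_const measurable_ident_sets[OF refl])
    subgoal by (rule borel_measurable_pairI, intro kmeas_compose[OF kmeas_K] borel_measurable_Pair
        borel_measurable_fst borel_measurable_snd borel_measurable_const measurable_ident_sets[OF refl])
    done
  have Km1 [measurable]: "(\<lambda>y. K m (t, y)) \<in> borel_measurable borel" for m t
    by (rule kmeas_compose[OF kmeas_K]) measurable
  have R0: "R n (r, z) = 0" if "r \<le> s" for n r z
    using that u0 by (auto simp: R_def kreg_def intro!: sum.neutral MM_eq_0)
  \<comment> \<open>The sum is shifted by one: its first term is \<open>G\<close> and each later one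
    is its predecessor composed with \<open>K\<close>, so \<open>eq\<close> becomes a
    recursion.\<close>
  have step: "R (Suc n) (t, y) = (\<integral> m. R n m * K m (t, y) \<partial>lborel)" if t: "s < t" "t \<le> T" for n t y
  proof -
    have "(\<Sum>k<Suc n. MM \<nu> T c k (s, x) (t, y)) = G (s, x) (t, y) + (\<Sum>k<n. \<integral> m. MM \<nu> T c k (s, x) m * K m (t, y) \<partial>lborel)"
      by (subst sum.lessThan_Suc_shift) (simp add: kcomp_def)
    also have "(\<Sum>k<n. \<integral> m. MM \<nu> T c k (s, x) m * K m (t, y) \<partial>lborel) =
        (\<integral> m. (\<Sum>k<n. MM \<nu> T c k (s, x) m * K m (t, y)) \<partial>lborel)"
      by (rule Bochner_Integration.integral_sum[symmetric]) (rule MM_K_integrable)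
    finally have "R (Suc n) (t, y) = (\<integral> m. u m * K m (t, y) \<partial>lborel) - (\<integral> m. (\<Sum>k<n. MM \<nu> T c k (s, x) m * K m (t, y)) \<partial>lborel)"
      using eq[OF t] by (simp add: R_def)
    also have "\<dots> = (\<integral> m. u m * K m (t, y) - (\<Sum>k<n. MM \<nu> T c k (s, x) m * K m (t, y)) \<partial>lborel)"
      by (rule Bochner_Integration.integral_diff[symmetric])
         (intro int[OF t] Bochner_Integration.integrable_sum MM_K_integrable)+
    finally show ?thesis by (simp add: R_def left_diff_distrib sum_distrib_right)
  qed
  obtain \<kappa> where l: "\<kappa> \<ge> 0" and contr: "\<And>s t. t - s \<le> T \<Longrightarrow>
    (\<integral>\<^sup>+ r. ennreal (indicator {s<..<t} r * (C1 / sqrt (t - r) * exp (\<kappa> * (r - s)))) \<partial>lborel)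
      \<le> ennreal (exp (\<kappa> * (t - s)) / 2)"
    using weighted_inverse_sqrt_small[OF T C_nonneg(2)] by blast
  have main: "(\<integral>\<^sup>+ y. ennreal \<bar>R n (t, y)\<bar> \<partial>lborel) \<le> ennreal (exp (\<kappa> * (t - s)) / 2 ^ n)"
    if "s < t" "t \<le> T" for n t
    using that
  proof (induction n arbitrary: t)
    case 0
    have "(1::ennreal) \<le> ennreal (exp (\<kappa> * (t - s)))"
      using 0 l by (subst ennreal_1[symmetric]) (intro ennreal_leI, simp)
    from order_trans[OF u1[OF 0] this] show ?case by (simp add: R_def)
  next
    case (Suc n)
    have "(\<integral>\<^sup>+ y. ennreal \<bar>R (Suc n) (t, y)\<bar> \<partial>lborel) \<le>
        (\<integral>\<^sup>+ y. (\<integral>\<^sup>+ m. ennreal (\<bar>R n m\<bar> * \<bar>K m (t, y)\<bar>) \<partial>lborel) \<partial>lborel)"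
    proof (rule nn_integral_mono)
      fix y
      show "ennreal \<bar>R (Suc n) (t, y)\<bar> \<le> (\<integral>\<^sup>+ m. ennreal (\<bar>R n m\<bar> * \<bar>K m (t, y)\<bar>) \<partial>lborel)"
      proof (cases "integrable lborel (\<lambda>m. R n m * K m (t, y))")
        case True
        from integral_norm_bound_ennreal[OF this] show ?thesis
          unfolding step[OF Suc.prems] by (simp add: abs_mult)
      next
        case False
        \<comment> \<open>Without integrability the Bochner integral is 0 by convention, and the
          bound is trivial.\<close>
        then show ?thesis unfolding step[OF Suc.prems] by (simp add: not_integrable_integral_eq)
      qed
    qed
    \<comment> \<open>The end point \<open>y\<close> is now integrated first, where \<open>K\<close>
      contributes at most \<open>C1 / sqrt (t - r)\<close>.\<close>
    also have "\<dots> = (\<integral>\<^sup>+ m. (\<integral>\<^sup>+ y. ennreal (\<bar>R n m\<bar> * \<bar>K m (t, y)\<bar>) \<partial>lborel) \<partial>lborel)"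
      by (rule lborel_pair.Fubini') (simp add: case_prod_unfold)
    also have "\<dots> \<le> (\<integral>\<^sup>+ m. ennreal \<bar>R n m\<bar> * ennreal (C1 * (indicator {s<..<t} (fst m) * (1 / sqrt (t - fst m)))) \<partial>lborel)"
    proof (rule nn_integral_mono)
      fix m :: "real \<times> (real^'d)"
      obtain r z where m: "m = (r, z)" by fastforce
      have "(\<integral>\<^sup>+ y. ennreal (\<bar>R n m\<bar> * \<bar>K m (t, y)\<bar>) \<partial>lborel) = ennreal \<bar>R n m\<bar> * (\<integral>\<^sup>+ y. ennreal \<bar>K m (t, y)\<bar> \<partial>lborel)"
        by (simp add: ennreal_mult nn_integral_cmult)
      also have "\<dots> \<le> ennreal \<bar>R n m\<bar> * (ennreal C1 * ennreal (indicator {..<t} r * (1 / sqrt (t - r))))"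
      proof (rule mult_left_mono)
        have [measurable]: "(\<lambda>y. b1 m (t, y)) \<in> borel_measurable borel"
          by (rule kmeas_compose[OF kmeas_b1]) measurable
        have "(\<integral>\<^sup>+ y. ennreal \<bar>K m (t, y)\<bar> \<partial>lborel) \<le> (\<integral>\<^sup>+ y. ennreal C1 * ennreal (b1 m (t, y)) \<partial>lborel)"
          using C_nonneg by (intro nn_integral_mono) (simp add: ennreal_mult[symmetric] ennreal_leI K_bound)
        also have "\<dots> = ennreal C1 * (\<integral>\<^sup>+ y. ennreal (b1 m (t, y)) \<partial>lborel)"
          by (rule nn_integral_cmult) measurable
        also have "\<dots> \<le> ennreal C1 * ennreal (indicator {..<t} r * (1 / sqrt (t - r)))"
          unfolding m by (intro mult_left_mono nn_integral_b1) auto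
        finally show "(\<integral>\<^sup>+ y. ennreal \<bar>K m (t, y)\<bar> \<partial>lborel) \<le> ennreal C1 * ennreal (indicator {..<t} r * (1 / sqrt (t - r)))" .
      qed auto
      also have "\<dots> = ennreal \<bar>R n m\<bar> * ennreal (C1 * (indicator {s<..<t} (fst m) * (1 / sqrt (t - fst m))))"
      proof (cases "r \<le> s")
        case True
        then show ?thesis by (simp add: m R0)
      next
        case False
        then show ?thesis using C_nonneg by (auto simp: m indicator_def ennreal_mult[symmetric])
      qed
      finally show "(\<integral>\<^sup>+ y. ennreal (\<bar>R n m\<bar> * \<bar>K m (t, y)\<bar>) \<partial>lborel) \<le>
        ennreal \<bar>R n m\<bar> * ennreal (C1 * (indicator {s<..<t} (fst m) * (1 / sqrt (t - fst m))))" .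
    qed
    also have "\<dots> = (\<integral>\<^sup>+ r. \<integral>\<^sup>+ z. ennreal \<bar>R n (r, z)\<bar> * ennreal (C1 * (indicator {s<..<t} r * (1 / sqrt (t - r)))) \<partial>lborel \<partial>lborel)"
    proof -
      have "(\<lambda>r. C1 * (indicator {s<..<t} r * (1 / sqrt (t - r)))) \<in> borel_measurable borel" by measurable
      from measurable_compose[OF fst_snd_borel_measurable(1) this]
      have g: "(\<lambda>m :: real \<times> (real^'d). C1 * (indicator {s<..<t} (fst m) * (1 / sqrt (t - fst m)))) \<in> borel_measurable borel" .
      have "(\<lambda>m. \<bar>R n m\<bar>) \<in> borel_measurable borel" by measurable
      from nn_integral_lborel_iterated[OF borel_measurable_times_ennreal[OF
            measurable_compose[OF this measurable_ennreal] measurable_compose[OF g measurable_ennreal]]]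
      show ?thesis by simp
    qed
    also have "\<dots> = (\<integral>\<^sup>+ r. (\<integral>\<^sup>+ z. ennreal \<bar>R n (r, z)\<bar> \<partial>lborel) * ennreal (C1 * (indicator {s<..<t} r * (1 / sqrt (t - r)))) \<partial>lborel)"
      by (intro nn_integral_cong nn_integral_multc) measurable
    \<comment> \<open>The induction hypothesis at the intermediate time \<open>r\<close> brings in
      the weight \<open>exp (\<kappa> * (r - s))\<close>, against which \<open>contr\<close> yields
      the missing factor 1/2.\<close>
    also have "\<dots> \<le> (\<integral>\<^sup>+ r. ennreal (1 / 2 ^ n) * ennreal (indicator {s<..<t} r * (C1 / sqrt (t - r) * exp (\<kappa> * (r - s)))) \<partial>lborel)"
    proof (rule nn_integral_mono)
      fix r
      show "(\<integral>\<^sup>+ z. ennreal \<bar>R n (r, z)\<bar> \<partial>lborel) * ennreal (C1 * (indicator {s<..<t} r * (1 / sqrt (t - r)))) \<le>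
        ennreal (1 / 2 ^ n) * ennreal (indicator {s<..<t} r * (C1 / sqrt (t - r) * exp (\<kappa> * (r - s))))"
      proof (cases "r \<in> {s<..<t}")
        case True
        then have "(\<integral>\<^sup>+ z. ennreal \<bar>R n (r, z)\<bar> \<partial>lborel) * ennreal (C1 * (1 / sqrt (t - r))) \<le> ennreal (exp (\<kappa> * (r - s)) / 2 ^ n) * ennreal (C1 * (1 / sqrt (t - r)))"
          using Suc.prems by (intro mult_right_mono Suc.IH) auto
        also have "\<dots> = ennreal (1 / 2 ^ n) * ennreal (C1 / sqrt (t - r) * exp (\<kappa> * (r - s)))"
          using True C_nonneg by (simp add: ennreal_mult[symmetric] mult_ac)
        finally show ?thesis using True by simp
      qed simp
    qed
    also have "\<dots> = ennreal (1 / 2 ^ n) * (\<integral>\<^sup>+ r. ennreal (indicator {s<..<t} r * (C1 / sqrt (t - r) * exp (\<kappa> * (r - s)))) \<partial>lborel)"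
      by (rule nn_integral_cmult) measurable
    also have "\<dots> \<le> ennreal (1 / 2 ^ n) * ennreal (exp (\<kappa> * (t - s)) / 2)"
      using Suc.prems s by (intro mult_left_mono contr) auto
    also have "\<dots> = ennreal (exp (\<kappa> * (t - s)) / 2 ^ Suc n)"
      by (simp add: ennreal_mult[symmetric] mult_ac)
    finally show ?case .
  qed
  show ?thesis
  proof (rule that[of "exp (\<kappa> * (T - s))"])
    fix n t assume t: "s < t" "t \<le> T"
    have "(\<integral>\<^sup>+ y. ennreal \<bar>R n (t, y)\<bar> \<partial>lborel) \<le> ennreal (exp (\<kappa> * (t - s)) / 2 ^ n)" by (rule main[OF t])
    also have "\<dots> \<le> ennreal (exp (\<kappa> * (T - s)) / 2 ^ n)"
      using t l by (intro ennreal_leI divide_right_mono) (auto intro: mult_left_mono)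
    finally show "(\<integral>\<^sup>+ y. ennreal \<bar>u (t, y) - (\<Sum>k<n. MM \<nu> T c k (s, x) (t, y))\<bar> \<partial>lborel) \<le> ennreal (exp (\<kappa> * (T - s)) / 2 ^ n)"
      by (simp add: R_def)
  qed
qed

text \<open>\<open>df\<close> expresses at a fixed time that \<open>c\<close> is orthogonal to the
  gradient of a product of two Gaussians. It settles \<open>n = 0\<close>; in the inductive step
  \<open>L\<close> stays on the left while \<open>K\<close> is appended on the right.\<close>

lemma MM_Suc_left:
  assumes df: "\<And>r x y \<alpha> \<gamma>. 0 \<le> r \<Longrightarrow> r \<le> T \<Longrightarrow> \<alpha> > 0 \<Longrightarrow> \<gamma> > 0 \<Longrightarrow>
     (\<integral> z. c (r, z) \<bullet> (gau \<alpha> (x - z) *\<^sub>R dgau \<gamma> (z - y) + gau \<gamma> (z - y) *\<^sub>R dgau \<alpha> (z - x)) \<partial>lborel) = 0"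
  shows "MM \<nu> T c (Suc n) = kcomp L (MM \<nu> T c n)"
proof (induction n)
  case 0
  have "kcomp G K a b = kcomp L G a b" for a b
  proof -
    obtain s x t y where ab: "a = (s, x)" "b = (t, y)" by fastforce
    have GKi: "integrable lborel (\<lambda>m. G a m * K m b)" using MM_K_integrable[of 0] by simp
    have "kcomp G K a b - kcomp L G a b = (\<integral> m. G a m * K m b - L a m * G m b \<partial>lborel)"
      unfolding kcomp_def by (rule Bochner_Integration.integral_diff[symmetric]) (fact GKi LG_integrable)+
    also have "\<dots> = (\<integral> r. \<integral> z. G a (r, z) * K (r, z) b - L a (r, z) * G (r, z) b \<partial>lborel \<partial>lborel)"
      by (rule integral_lborel_iterated) (intro Bochner_Integration.integrable_diff GKi LG_integrable)
    also have "\<dots> = (\<integral> r. 0 \<partial>(lborel::real measure))"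
    proof (rule Bochner_Integration.integral_cong[OF refl])
      fix r
      show "(\<integral> z. G a (r, z) * K (r, z) b - L a (r, z) * G (r, z) b \<partial>lborel) = 0"
      proof (cases "0 \<le> s \<and> s < r \<and> r < t \<and> t \<le> T")
        case True
        \<comment> \<open>\<open>dgau\<close> is odd, so the difference becomes a sum: the two terms
          of the product rule for the gradient in \<open>z\<close>.\<close>
        have "G a (r, z) * K (r, z) b - L a (r, z) * G (r, z) b =
          c (r, z) \<bullet> (gau (4 * \<nu> * (r - s)) (x - z) *\<^sub>R dgau (4 * \<nu> * (t - r)) (z - y) + gau (4 * \<nu> * (t - r)) (z - y) *\<^sub>R dgau (4 * \<nu> * (r - s)) (z - x))" for z
        proof -
          have "dgau (4 * \<nu> * (r - s)) (z - x) = - dgau (4 * \<nu> * (r - s)) (x - z)"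
            by (metis dgau_minus minus_diff_eq)
          then show ?thesis
            using True by (simp add: ab GK_def KK_def LL_def kreg_def inner_add_right inner_diff_right)
        qed
        then show ?thesis using True nu by (simp add: df)
      next
        case False
        then have "G a (r, z) * K (r, z) b - L a (r, z) * G (r, z) b = 0" for z
          by (auto simp: ab GK_def KK_def LL_def kreg_def)
        then show ?thesis by simp
      qed
    qed
    finally show ?thesis by simp
  qed
  then show ?case by (simp add: fun_eq_iff)
next
  case (Suc n)
  obtain \<alpha> where \<alpha>: "\<alpha> \<ge> 0" "\<And>a b. \<bar>MM \<nu> T c n a b\<bar> \<le> \<alpha> * b0 a b" using MM_measurable_bounded by blast
  \<comment> \<open>Two singular factors are harmless: \<open>b0\<close> absorbs \<open>b1\<close>
    on its right and then on its left, each time at the cost \<open>C2\<close>.\<close>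
  have assoc: "kcomp (kcomp L (MM \<nu> T c n)) K a b = kcomp L (kcomp (MM \<nu> T c n) K) a b" for a b
  proof (rule kcomp_assoc[OF kmeas_L kmeas_MM kmeas_K])
    have [measurable]: "(\<lambda>m'. b0 m m') \<in> borel_measurable borel" "(\<lambda>m. b0 m b) \<in> borel_measurable borel"
      "(\<lambda>m. b1 a m) \<in> borel_measurable borel" "(\<lambda>m. b1 m b) \<in> borel_measurable borel" for m
      by (intro kmeas_compose[OF kmeas_b0] kmeas_compose[OF kmeas_b1]; measurable)+
    have "(\<integral>\<^sup>+ m. \<integral>\<^sup>+ m'. ennreal (\<bar>L a m\<bar> * \<bar>MM \<nu> T c n m m'\<bar> * \<bar>K m' b\<bar>) \<partial>lborel \<partial>lborel) \<le>
      (\<integral>\<^sup>+ m. \<integral>\<^sup>+ m'. ennreal (C1 * \<alpha> * C1 * b1 a m) * ennreal (b0 m m' * b1 m' b) \<partial>lborel \<partial>lborel)"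
    proof (intro nn_integral_mono)
      fix m m'
      have "\<bar>L a m\<bar> * \<bar>MM \<nu> T c n m m'\<bar> * \<bar>K m' b\<bar> \<le> (C1 * b1 a m) * (\<alpha> * b0 m m') * (C1 * b1 m' b)"
        by (intro mult_mono L_bound K_bound \<alpha>) (auto simp: C_nonneg \<alpha>)
      then show "ennreal (\<bar>L a m\<bar> * \<bar>MM \<nu> T c n m m'\<bar> * \<bar>K m' b\<bar>) \<le> ennreal (C1 * \<alpha> * C1 * b1 a m) * ennreal (b0 m m' * b1 m' b)"
        using \<alpha> C_nonneg by (simp add: ennreal_mult[symmetric] ennreal_leI mult_ac)
    qed
    also have "\<dots> = (\<integral>\<^sup>+ m. ennreal (C1 * \<alpha> * C1 * b1 a m) * (\<integral>\<^sup>+ m'. ennreal (b0 m m' * b1 m' b) \<partial>lborel) \<partial>lborel)"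
      by (intro nn_integral_cong nn_integral_cmult) measurable
    also have "\<dots> \<le> (\<integral>\<^sup>+ m. ennreal (C1 * \<alpha> * C1 * b1 a m) * ennreal (C2 * b0 m b) \<partial>lborel)"
      by (intro nn_integral_mono mult_left_mono nn_integral_b0_b1_le) auto
    also have "\<dots> = (\<integral>\<^sup>+ m. ennreal (C1 * \<alpha> * C1 * C2) * ennreal (b1 a m * b0 m b) \<partial>lborel)"
      using \<alpha> C_nonneg by (intro nn_integral_cong) (simp add: ennreal_mult[symmetric] mult_ac)
    also have "\<dots> = ennreal (C1 * \<alpha> * C1 * C2) * (\<integral>\<^sup>+ m. ennreal (b1 a m * b0 m b) \<partial>lborel)"
      by (rule nn_integral_cmult) measurable
    also have "\<dots> \<le> ennreal (C1 * \<alpha> * C1 * C2) * ennreal (C2 * b0 a b)"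
      by (intro mult_left_mono nn_integral_b1_b0_le) auto
    also have "\<dots> < \<infinity>" by (simp add: ennreal_mult_less_top)
    finally show "(\<integral>\<^sup>+ m. \<integral>\<^sup>+ m'. ennreal (\<bar>L a m\<bar> * \<bar>MM \<nu> T c n m m'\<bar> * \<bar>K m' b\<bar>) \<partial>lborel \<partial>lborel) < \<infinity>" .
  qed
  have "MM \<nu> T c (Suc (Suc n)) = kcomp (MM \<nu> T c (Suc n)) K" by simp
  also have "\<dots> = kcomp (kcomp L (MM \<nu> T c n)) K" unfolding Suc.IH ..
  also have "\<dots> = kcomp L (kcomp (MM \<nu> T c n) K)" using assoc by blast
  finally show ?case by simp
qed

end

section \<open>Reflection of the time axis\<close>

definition trev :: "real \<Rightarrow> real \<times> 'a \<Rightarrow> real \<times> 'a" where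
  "trev T a = (T - fst a, snd a)"

lemma distr_trev:
  "distr lborel borel (trev T) = (lborel :: (real \<times> 'a::euclidean_space) measure)"
proof -
  have 1: "distr lborel borel (\<lambda>t. T - t) = (lborel :: real measure)"
  proof -
    have "(lborel :: real measure) = density (distr lborel borel (\<lambda>x. T + (-1) * x)) (\<lambda>_. ennreal \<bar>-1\<bar>)"
      by (rule lborel_real_affine) simp
    also have "\<dots> = distr lborel borel (\<lambda>x. T + (-1) * x)"
      using density_1[of "distr lborel borel (\<lambda>x. T + (-1) * x)"] by simp
    finally show ?thesis by simp
  qed
  have 2: "distr lborel borel (\<lambda>x. x) = (lborel :: 'a measure)"
    by (rule distr_id2) simp
  have "distr lborel borel (\<lambda>t. T - t) \<Otimes>\<^sub>M distr lborel borel (\<lambda>x::'a. x) =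
     distr (lborel \<Otimes>\<^sub>M lborel) (borel \<Otimes>\<^sub>M borel) (\<lambda>(x, y). (T - x, y))"
    by (rule pair_measure_distr) (simp_all add: 2 lborel.sigma_finite_measure_axioms)
  then show ?thesis unfolding 1 2 lborel_prod borel_prod trev_def
    by (simp add: case_prod_beta')
qed

lemma integral_trev:
  fixes f :: "real \<times> 'a::euclidean_space \<Rightarrow> real"
  assumes [measurable]: "f \<in> borel_measurable borel"
  shows "(\<integral> m. f (trev T m) \<partial>lborel) = (\<integral> m. f m \<partial>lborel)"
proof -
  have "(trev T :: real \<times> 'a \<Rightarrow> real \<times> 'a) \<in> borel_measurable borel" unfolding trev_def
    by (intro borel_measurable_Pair borel_measurable_diff borel_measurable_const fst_snd_borel_measurable)
  then show ?thesis
    by (subst (2) distr_trev[of T, symmetric], subst integral_distr) auto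
qed

text \<open>Two signs cancel, that of the reversed drift and that of the odd \<open>dgau\<close>, so
  \<open>KK\<close> of \<open>c'\<close> reflects to \<open>LL\<close> of \<open>c\<close>.
  Reflection swaps the arguments, hence the recursion on the right for \<open>c'\<close> must be met
  by one on the left for \<open>c\<close>; this is the hypothesis \<open>left\<close>.\<close>

lemma MM_time_reversal:
  assumes "drift \<nu> T M c" and "drift \<nu> T M c'"
    and c': "\<And>a. c' (trev T a) = - c a"
    and left: "\<And>n. MM \<nu> T c (Suc n) = kcomp (LL \<nu> T c) (MM \<nu> T c n)"
  shows "MM \<nu> T c' n (trev T b) (trev T a) = MM \<nu> T c n a b"
proof (induction n arbitrary: a b)
  case 0
  show ?case by (auto simp: GK_def kreg_def trev_def gau_commute)
next
  case (Suc n)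
  interpret c': drift \<nu> T M c' by fact
  have K: "KK \<nu> T c' (trev T b) (trev T a) = LL \<nu> T c a b" for a b
  proof -
    have "dgau s (snd b - snd a) = - dgau s (snd a - snd b)" for s
      by (metis dgau_minus minus_diff_eq)
    then show ?thesis
      unfolding KK_def LL_def c' by (auto simp: kreg_def trev_def)
  qed
  have [measurable]: "(\<lambda>m. MM \<nu> T c' n (trev T b) m) \<in> borel_measurable borel"
     "(\<lambda>m. KK \<nu> T c' m (trev T a)) \<in> borel_measurable borel"
    by (intro kmeas_compose[OF c'.kmeas_MM] kmeas_compose[OF c'.kmeas_K]; measurable)+
  have "MM \<nu> T c' (Suc n) (trev T b) (trev T a) = (\<integral> m. MM \<nu> T c' n (trev T b) m * KK \<nu> T c' m (trev T a) \<partial>lborel)"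
    by (simp add: kcomp_def)
  also have "\<dots> = (\<integral> m. MM \<nu> T c' n (trev T b) (trev T m) * KK \<nu> T c' (trev T m) (trev T a) \<partial>lborel)"
    by (rule integral_trev[symmetric]) measurable
  also have "\<dots> = (\<integral> m. LL \<nu> T c a m * MM \<nu> T c n m b \<partial>lborel)"
    by (simp only: K Suc.IH mult.commute)
  also have "\<dots> = MM \<nu> T c (Suc n) a b" unfolding left kcomp_def ..
  finally show ?case .
qed

section \<open>Passing from test functions to Gaussians\<close>

lemma borel_measurable_indicator_fst [measurable]:
  "S \<in> sets borel \<Longrightarrow> (\<lambda>m :: real \<times> 'b::second_countable_topology. indicator S (fst m) :: real) \<in> borel_measurable borel"
  using measurable_compose[OF fst_snd_borel_measurable(1) borel_measurable_indicator[of S borel]] by simp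

subsection \<open>Removing the compact support of test functions\<close>

lemma elem_smooth_grad_continuous: "elem_smooth f \<Longrightarrow> continuous_on UNIV (grad f)"
  unfolding grad_def by (intro continuous_on_vec_lambda elem_smooth_continuous elem_smooth_pd)

lemma elem_smooth_laplacian_continuous: "elem_smooth f \<Longrightarrow> continuous_on UNIV (laplacian f)"
  unfolding laplacian_def by (intro continuous_on_sum elem_smooth_continuous elem_smooth_iter_pd)

lemma elem_smooth_grad_measurable [measurable_dest]: "elem_smooth f \<Longrightarrow> grad f \<in> borel_measurable borel"
  by (intro borel_measurable_continuous_onI elem_smooth_grad_continuous)

lemma elem_smooth_laplacian_measurable [measurable_dest]: "elem_smooth f \<Longrightarrow> laplacian f \<in> borel_measurable borel"
  by (intro borel_measurable_continuous_onI elem_smooth_laplacian_continuous)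

lemma grad_cutoff_mult:
  assumes f: "elem_smooth f"
  shows "grad (\<lambda>x. cutoff n x * f x) x = cutoff n x *\<^sub>R grad f x + f x *\<^sub>R grad (cutoff n) x"
  unfolding grad_def pd_mult[OF elem_smooth_cutoff f] by (simp add: vec_eq_iff del: iter_pd.simps)

lemma laplacian_cutoff_mult:
  assumes f: "elem_smooth f"
  shows "laplacian (\<lambda>x. cutoff n x * f x) x =
    cutoff n x * laplacian f x + 2 * (grad (cutoff n) x \<bullet> grad f x) + laplacian (cutoff n) x * f x"
  unfolding grad_def laplacian_def pd2_mult[OF elem_smooth_cutoff f]
  by (simp add: sum.distrib sum_distrib_left sum_distrib_right inner_vec_def del: iter_pd.simps)

lemma norm_grad_cutoff_le: "norm (grad (cutoff n) (x::real^'d)) \<le> real CARD('d) * (4 * exp 1)"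
proof -
  have "norm (grad (cutoff n) x) \<le> (\<Sum>i\<in>UNIV. \<bar>grad (cutoff n) x $ i\<bar>)" by (rule norm_le_l1_cart)
  also have "\<dots> \<le> (\<Sum>i\<in>(UNIV::'d set). 4 * exp 1)"
  proof (rule sum_mono)
    fix i :: 'd
    have "\<bar>grad (cutoff n) x $ i\<bar> \<le> 4 * exp 1 / real (Suc n)"
      unfolding grad_def using abs_pd_cutoff_le[of i n x] by (simp del: iter_pd.simps)
    also have "\<dots> \<le> 4 * exp 1" by (simp add: divide_le_eq)
    finally show "\<bar>grad (cutoff n) x $ i\<bar> \<le> 4 * exp 1" .
  qed
  finally show ?thesis by simp
qed

lemma abs_laplacian_cutoff_le: "\<bar>laplacian (cutoff n) (x::real^'d)\<bar> \<le> real CARD('d) * (200 * exp 1)"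
proof -
  have "\<bar>laplacian (cutoff n) x\<bar> \<le> (\<Sum>i\<in>(UNIV::'d set). \<bar>iter_pd [i, i] (cutoff n) x\<bar>)"
    unfolding laplacian_def by (rule sum_abs)
  also have "\<dots> \<le> (\<Sum>i\<in>(UNIV::'d set). 200 * exp 1)"
  proof (rule sum_mono)
    fix i :: 'd
    have "\<bar>iter_pd [i, i] (cutoff n) x\<bar> \<le> 200 * exp 1 / real (Suc n)" by (rule abs_pd2_cutoff_le)
    also have "\<dots> \<le> 200 * exp 1" by (simp add: divide_le_eq)
    finally show "\<bar>iter_pd [i, i] (cutoff n) x\<bar> \<le> 200 * exp 1" .
  qed
  finally show ?thesis by simp
qed

lemma grad_cutoff_tendsto: "(\<lambda>n. grad (cutoff n) x) \<longlonglongrightarrow> 0"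
  unfolding grad_def by (intro vec_tendstoI) (simp add: pd_cutoff_tendsto del: iter_pd.simps)

lemma laplacian_cutoff_tendsto: "(\<lambda>n. laplacian (cutoff n) x) \<longlonglongrightarrow> 0"
  unfolding laplacian_def by (rule tendsto_null_sum) (rule pd2_cutoff_tendsto)

lemma grad_cutoff_mult_tendsto:
  assumes f: "elem_smooth f"
  shows "(\<lambda>n. grad (\<lambda>x. cutoff n x * f x) x) \<longlonglongrightarrow> grad f x"
proof -
  have "(\<lambda>n. cutoff n x *\<^sub>R grad f x + f x *\<^sub>R grad (cutoff n) x) \<longlonglongrightarrow> 1 *\<^sub>R grad f x + f x *\<^sub>R 0"
    by (intro tendsto_intros cutoff_tendsto grad_cutoff_tendsto)
  then show ?thesis by (simp add: grad_cutoff_mult[OF f])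
qed

lemma laplacian_cutoff_mult_tendsto:
  assumes f: "elem_smooth f"
  shows "(\<lambda>n. laplacian (\<lambda>x. cutoff n x * f x) x) \<longlonglongrightarrow> laplacian f x"
proof -
  have "(\<lambda>n. cutoff n x * laplacian f x + 2 * (grad (cutoff n) x \<bullet> grad f x) + laplacian (cutoff n) x * f x)
     \<longlonglongrightarrow> 1 * laplacian f x + 2 * (0 \<bullet> grad f x) + 0 * f x"
    by (intro tendsto_intros cutoff_tendsto grad_cutoff_tendsto laplacian_cutoff_tendsto)
  then show ?thesis by (simp add: laplacian_cutoff_mult[OF f])
qed

lemma norm_grad_cutoff_mult_le:
  assumes f: "elem_smooth f"
  shows "norm (grad (\<lambda>x. cutoff n x * f x) (x::real^'d)) \<le> exp 1 * norm (grad f x) + real CARD('d) * (4 * exp 1) * \<bar>f x\<bar>"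
proof -
  have "norm (grad (\<lambda>x. cutoff n x * f x) x) \<le> \<bar>cutoff n x\<bar> * norm (grad f x) + \<bar>f x\<bar> * norm (grad (cutoff n) x)"
    unfolding grad_cutoff_mult[OF f] using norm_triangle_ineq[of "cutoff n x *\<^sub>R grad f x" "f x *\<^sub>R grad (cutoff n) x"] by simp
  also have "\<dots> \<le> exp 1 * norm (grad f x) + \<bar>f x\<bar> * (real CARD('d) * (4 * exp 1))"
    by (intro add_mono mult_mono abs_cutoff_le norm_grad_cutoff_le) auto
  finally show ?thesis by (simp add: mult_ac)
qed

lemma abs_laplacian_cutoff_mult_le:
  assumes f: "elem_smooth f"
  shows "\<bar>laplacian (\<lambda>x. cutoff n x * f x) (x::real^'d)\<bar> \<le>
    exp 1 * \<bar>laplacian f x\<bar> + 2 * (real CARD('d) * (4 * exp 1) * norm (grad f x)) + real CARD('d) * (200 * exp 1) * \<bar>f x\<bar>"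
proof -
  have "\<bar>laplacian (\<lambda>x. cutoff n x * f x) x\<bar> \<le> \<bar>cutoff n x\<bar> * \<bar>laplacian f x\<bar> + 2 * \<bar>grad (cutoff n) x \<bullet> grad f x\<bar> + \<bar>laplacian (cutoff n) x\<bar> * \<bar>f x\<bar>"
    unfolding laplacian_cutoff_mult[OF f] abs_mult[symmetric] by linarith
  also have "\<dots> \<le> exp 1 * \<bar>laplacian f x\<bar> + 2 * (real CARD('d) * (4 * exp 1) * norm (grad f x)) + real CARD('d) * (200 * exp 1) * \<bar>f x\<bar>"
  proof (intro add_mono mult_left_mono mult_right_mono abs_cutoff_le abs_laplacian_cutoff_le)
    have "\<bar>grad (cutoff n) x \<bullet> grad f x\<bar> \<le> norm (grad (cutoff n) x) * norm (grad f x)"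
      by (rule Cauchy_Schwarz_ineq2)
    also have "\<dots> \<le> real CARD('d) * (4 * exp 1) * norm (grad f x)"
      by (intro mult_right_mono norm_grad_cutoff_le) auto
    finally show "\<bar>grad (cutoff n) x \<bullet> grad f x\<bar> \<le> real CARD('d) * (4 * exp 1) * norm (grad f x)" .
  qed auto
  finally show ?thesis .
qed

text \<open>Test with \<open>cutoff n\<close> times \<open>g\<close>. The term in which the cutoff
  is differentiated tends to 0, and the integrability of \<open>g\<close> and its gradient, with the
  bound on \<open>v\<close>, gives the dominating function.\<close>

lemma divergence_free_elem_smooth:
  fixes v :: "real^'d::finite \<Rightarrow> real^'d"
  assumes [measurable]: "v \<in> borel_measurable borel" and vb: "\<And>x. norm (v x) \<le> M"
    and div: "\<And>\<phi>. test_fun \<phi> \<Longrightarrow> (\<integral> x. v x \<bullet> grad \<phi> x \<partial>lborel) = 0"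
    and g: "elem_smooth g" and gi: "integrable lborel g" and ggi: "integrable lborel (\<lambda>x. norm (grad g x))"
  shows "(\<integral> x. v x \<bullet> grad g x \<partial>lborel) = 0"
proof -
  let ?g = "\<lambda>n x. cutoff n x * g x"
  have gn: "elem_smooth (?g n)" for n by (intro elem_smooth.mult elem_smooth_cutoff g)
  have M0: "M \<ge> 0" using vb[of 0] norm_ge_zero order_trans by blast
  have gm: "(\<lambda>x. v x \<bullet> grad (?g n) x) \<in> borel_measurable lborel" for n
    using elem_smooth_grad_measurable[OF gn[of n]] by simp
  have gm': "(\<lambda>x. v x \<bullet> grad g x) \<in> borel_measurable lborel"
    using elem_smooth_grad_measurable[OF g] by simp
  have "(\<lambda>n. \<integral> x. v x \<bullet> grad (?g n) x \<partial>lborel) \<longlonglongrightarrow> (\<integral> x. v x \<bullet> grad g x \<partial>lborel)"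
  proof (rule integral_dominated_convergence[where w = "\<lambda>x. M * (exp 1 * norm (grad g x) + real CARD('d) * (4 * exp 1) * \<bar>g x\<bar>)"])
    show "integrable lborel (\<lambda>x. M * (exp 1 * norm (grad g x) + real CARD('d) * (4 * exp 1) * \<bar>g x\<bar>))"
      by (intro integrable_mult_right Bochner_Integration.integrable_add ggi integrable_abs gi)
    show "AE x in lborel. (\<lambda>n. v x \<bullet> grad (?g n) x) \<longlonglongrightarrow> v x \<bullet> grad g x"
      by (intro AE_I2 tendsto_intros grad_cutoff_mult_tendsto g)
    show "AE x in lborel. norm (v x \<bullet> grad (?g n) x) \<le> M * (exp 1 * norm (grad g x) + real CARD('d) * (4 * exp 1) * \<bar>g x\<bar>)" for n
    proof (intro AE_I2)
      fix x
      have "norm (v x \<bullet> grad (?g n) x) \<le> norm (v x) * norm (grad (?g n) x)"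
        by (simp add: Cauchy_Schwarz_ineq2)
      also have "\<dots> \<le> M * (exp 1 * norm (grad g x) + real CARD('d) * (4 * exp 1) * \<bar>g x\<bar>)"
        by (intro mult_mono vb norm_grad_cutoff_mult_le g) (auto simp: M0)
      finally show "norm (v x \<bullet> grad (?g n) x) \<le> M * (exp 1 * norm (grad g x) + real CARD('d) * (4 * exp 1) * \<bar>g x\<bar>)" .
    qed
  qed (fact gm gm')+
  moreover have "(\<integral> x. v x \<bullet> grad (?g n) x \<partial>lborel) = 0" for n
    by (rule div[OF test_fun_cutoff_mult[OF g]])
  ultimately show ?thesis using LIMSEQ_unique[OF _ tendsto_const] by simp
qed

lemma integrable_gau_shift:
  assumes "s > 0" shows "integrable lborel (\<lambda>z. gau s (z - y))"
  by (rule integrableI_bounded) (simp_all add: nn_integral_gau_shift[OF assms])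

lemma integral_gau_shift:
  assumes "s > 0" shows "(\<integral> z. gau s (z - y) \<partial>lborel) = 1"
  by (subst integral_eq_nn_integral) (simp_all add: nn_integral_gau_shift[OF assms])

lemma gau_le_max: "s > 0 \<Longrightarrow> gau s (x::real^'d) \<le> exp (- (real CARD('d) / 2) * ln (pi * s))"
  by (simp add: gau_def)

text \<open>The vector in the integrand is the gradient of a product of two Gaussians. In each term
  one factor is bounded by its peak and the other is integrable. This supplies \<open>df\<close> in
  \<open>MM_Suc_left\<close>.\<close>

lemma divergence_free_gau:
  fixes v :: "real^'d::finite \<Rightarrow> real^'d"
  assumes v: "v \<in> borel_measurable borel" "\<And>x. norm (v x) \<le> M"
    and div: "\<And>\<phi>. test_fun \<phi> \<Longrightarrow> (\<integral> x. v x \<bullet> grad \<phi> x \<partial>lborel) = 0"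
    and p: "\<alpha> > 0" "\<gamma> > 0"
  shows "(\<integral> z. v z \<bullet> (gau \<alpha> (x - z) *\<^sub>R dgau \<gamma> (z - y) + gau \<gamma> (z - y) *\<^sub>R dgau \<alpha> (z - x)) \<partial>lborel) = 0"
proof -
  let ?g = "\<lambda>z. gau \<alpha> (z - x) * gau \<gamma> (z - y)"
  have g: "elem_smooth ?g" by (intro elem_smooth.mult elem_smooth_gau)
  have gr: "grad ?g z = gau \<alpha> (x - z) *\<^sub>R dgau \<gamma> (z - y) + gau \<gamma> (z - y) *\<^sub>R dgau \<alpha> (z - x)" for z
  proof (rule grad_eqI)
    have "(?g has_derivative (\<lambda>h. gau \<alpha> (z - x) * (dgau \<gamma> (z - y) \<bullet> h) + dgau \<alpha> (z - x) \<bullet> h * gau \<gamma> (z - y))) (at z)"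
      by (intro has_derivative_mult has_derivative_gau)
    then show "(?g has_derivative (\<lambda>h. (gau \<alpha> (x - z) *\<^sub>R dgau \<gamma> (z - y) + gau \<gamma> (z - y) *\<^sub>R dgau \<alpha> (z - x)) \<bullet> h)) (at z)"
      by (rule has_derivative_eq_rhs) (simp add: fun_eq_iff inner_add_left gau_commute[of \<alpha> x z] mult.commute)
  qed
  define A where "A = exp (- (real CARD('d) / 2) * ln (pi * \<alpha>))"
  define C where "C = exp (- (real CARD('d) / 2) * ln (pi * \<gamma>))"
  define a where "a s = 2 * exp (real CARD('d) / 2 * ln 2) / sqrt s" for s
  have mx: "gau \<alpha> (z - x) \<le> A" for z unfolding A_def by (rule gau_le_max[OF p(1)])
  have AC: "A \<ge> 0" "C \<ge> 0" by (auto simp: A_def C_def)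
  have "integrable lborel ?g"
  proof (rule Bochner_Integration.integrable_bound)
    show "integrable lborel (\<lambda>z. A * gau \<gamma> (z - y))" by (intro integrable_mult_right integrable_gau_shift p)
    show "AE z in lborel. norm (?g z) \<le> norm (A * gau \<gamma> (z - y))"
      by (intro AE_I2) (simp add: abs_mult AC mx mult_right_mono)
  qed measurable
  moreover have "integrable lborel (\<lambda>z. norm (grad ?g z))"
  proof (rule Bochner_Integration.integrable_bound)
    show "integrable lborel (\<lambda>z. A * (a \<gamma> * gau (2 * \<gamma>) (z - y)) + C * (a \<alpha> * gau (2 * \<alpha>) (z - x)))"
      by (intro Bochner_Integration.integrable_add integrable_mult_right integrable_gau_shift) (use p in auto)
    show "(\<lambda>z. norm (grad ?g z)) \<in> borel_measurable lborel" unfolding gr by measurable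
    have "norm (grad ?g z) \<le> A * (a \<gamma> * gau (2 * \<gamma>) (z - y)) + C * (a \<alpha> * gau (2 * \<alpha>) (z - x))" for z
    proof -
      have "norm (grad ?g z) \<le> gau \<alpha> (x - z) * norm (dgau \<gamma> (z - y)) + gau \<gamma> (z - y) * norm (dgau \<alpha> (z - x))"
        unfolding gr by (rule order_trans[OF norm_triangle_ineq]) simp
      also have "\<dots> \<le> A * (a \<gamma> * gau (2 * \<gamma>) (z - y)) + C * (a \<alpha> * gau (2 * \<alpha>) (z - x))"
        unfolding A_def C_def a_def using p by (intro add_mono mult_mono gau_le_max norm_dgau_le) auto
      finally show ?thesis .
    qed
    then show "AE z in lborel. norm (norm (grad ?g z)) \<le> norm (A * (a \<gamma> * gau (2 * \<gamma>) (z - y)) + C * (a \<alpha> * gau (2 * \<alpha>) (z - x)))"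
      by (intro AE_I2) (simp add: order_trans[OF _ abs_ge_self])
  qed
  ultimately have "(\<integral> z. v z \<bullet> grad ?g z \<partial>lborel) = 0"
    by (intro divergence_free_elem_smooth[OF v div g])
  then show ?thesis unfolding gr .
qed

subsection \<open>Gaussian approximate identity\<close>

lemma exp_neg_le_inverse: "v > 0 \<Longrightarrow> exp (- v) \<le> 1 / (v::real)"
proof -
  assume v: "v > 0"
  have "v \<le> exp v" using exp_ge_add_one_self[of v] by linarith
  then show ?thesis using v by (simp add: exp_minus field_simps)
qed

text \<open>Half of the exponent is at least \<open>\<delta>\<^sup>2 / (2 * b)\<close> and yields
  the small factor through \<open>exp (- v) \<le> 1 / v\<close>; the other half survives as an
  integrable Gaussian, so the bound can be used against a constant.\<close>

lemma gau_off_le_gau: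
  assumes "b > 0" "\<delta> > 0" "\<delta> \<le> norm (w::real^'d)"
  shows "gau b w \<le> exp (real CARD('d) / 2 * ln 2) * (2 * b / \<delta>\<^sup>2) * gau (2 * b) w"
proof -
  have N: "\<delta>\<^sup>2 \<le> w \<bullet> w" using assms by (simp add: dot_square_norm power_mono)
  have e: "exp (- ((w \<bullet> w) / (2 * b))) \<le> 2 * b / \<delta>\<^sup>2"
  proof -
    have "exp (- ((w \<bullet> w) / (2 * b))) \<le> exp (- (\<delta>\<^sup>2 / (2 * b)))"
      using N assms by (simp add: divide_right_mono)
    also have "\<dots> \<le> 1 / (\<delta>\<^sup>2 / (2 * b))" by (rule exp_neg_le_inverse) (use assms in auto)
    finally show ?thesis by simp
  qed
  have "gau b w = exp (real CARD('d) / 2 * ln 2) * exp (- ((w \<bullet> w) / (2 * b))) * gau (2 * b) w"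
  proof -
    have l: "ln (pi * (2 * b)) = ln 2 + ln (pi * b)" using assms by (simp add: ln_mult)
    have h: "w \<bullet> w / b = w \<bullet> w / (2 * b) + w \<bullet> w / (2 * b)" using assms by (simp add: field_simps)
    show ?thesis unfolding gau_def mult_exp_exp l h by (simp add: algebra_simps)
  qed
  also have "\<dots> \<le> exp (real CARD('d) / 2 * ln 2) * (2 * b / \<delta>\<^sup>2) * gau (2 * b) w"
    by (intro mult_right_mono mult_left_mono e) auto
  finally show ?thesis .
qed

text \<open>Off the ball the exponential beats the normalisation of order \<open>- d / 2\<close> in
  \<open>b\<close>, with one power of \<open>b\<close> to spare. Being uniform in \<open>w\<close>,
  this bound can be used against an integrable function.\<close>

lemma gau_off_le:
  assumes d: "\<delta> > 0"
  obtains C where "C \<ge> 0" "\<And>b (w::real^'d). b > 0 \<Longrightarrow> \<delta> \<le> norm w \<Longrightarrow> gau b w \<le> C * b"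
proof -
  let ?d = "CARD('d)"
  define C where "C = 1 / \<delta>\<^sup>2 + fact (Suc ?d) / (pi ^ ?d * (\<delta>\<^sup>2) ^ Suc ?d)"
  have C0: "C \<ge> 0" using d by (simp add: C_def)
  have "gau b w \<le> C * b" if b: "b > 0" and w: "\<delta> \<le> norm w" for b and w :: "real^'d"
  proof -
    have N: "\<delta>\<^sup>2 \<le> w \<bullet> w" using d w by (simp add: dot_square_norm power_mono)
    define L where "L = ln (pi * b)"
    define V where "V = \<delta>\<^sup>2 / b"
    have V: "V > 0" using d b by (simp add: V_def)
    define q where "q = exp (- (real ?d / 2) * L)"
    \<comment> \<open>This avoids half-integer powers, as \<open>q\<^sup>2\<close> is
      \<open>1 / (pi * b) ^ d\<close>. The summand 1 is paired with \<open>1 / V\<close> and the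
      other with the power \<open>d + 1\<close> of \<open>1 / V\<close>, so both come out linear in
      \<open>b\<close>.\<close>
    have q: "q \<le> 1 + q\<^sup>2"
      using sum_squares_bound[of q 1] zero_le_power2[of q] by (simp only: one_power2 mult_1_right)
    have q2: "q\<^sup>2 = 1 / (pi * b) ^ ?d"
    proof -
      have "q\<^sup>2 = exp (- (real ?d * L))" by (simp add: q_def power2_eq_square mult_exp_exp)
      also have "\<dots> = 1 / exp L ^ ?d" by (simp add: exp_minus exp_of_nat_mult inverse_eq_divide)
      finally show ?thesis using b by (simp add: L_def)
    qed
    have e1: "exp (- V) \<le> 1 / V" by (rule exp_neg_le_inverse[OF V])
    have e2: "exp (- V) \<le> fact (Suc ?d) / V ^ Suc ?d"
      using power_le_fact_exp[of V "Suc ?d"] V by (simp add: exp_minus field_simps del: power_Suc fact_Suc)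
    have "gau b w = q * exp (- ((w \<bullet> w) / b))"
      unfolding gau_def q_def L_def mult_exp_exp by simp
    also have "\<dots> \<le> (1 + q\<^sup>2) * exp (- V)"
      using q N b by (intro mult_mono) (auto simp: V_def divide_right_mono)
    also have "\<dots> = exp (- V) + q\<^sup>2 * exp (- V)" by (simp add: distrib_right)
    also have "\<dots> \<le> 1 / V + q\<^sup>2 * (fact (Suc ?d) / V ^ Suc ?d)"
      by (intro add_mono mult_left_mono e1 e2) auto
    also have "\<dots> = C * b"
    proof -
      have "q\<^sup>2 * (fact (Suc ?d) / V ^ Suc ?d) = fact (Suc ?d) / (pi ^ ?d * (\<delta>\<^sup>2) ^ Suc ?d) * b"
        unfolding q2 V_def using b d by (simp add: power_mult_distrib power_divide del: fact_Suc)
      moreover have "1 / V = 1 / \<delta>\<^sup>2 * b" by (simp add: V_def)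
      ultimately show ?thesis unfolding C_def distrib_right by simp
    qed
    finally show ?thesis .
  qed
  then show ?thesis by (rule that[OF C0])
qed

text \<open>\<open>f\<close> may be unbounded and is continuous at \<open>y\<close> only. Near
  \<open>y\<close> continuity gives \<open>r / 2\<close>; away from it the term with
  \<open>f z\<close> is estimated by \<open>gau_off_le\<close> and the one with \<open>f y\<close>
  by \<open>gau_off_le_gau\<close>, both \<open>O(b n)\<close>.\<close>

lemma gau_approximate_identity:
  fixes f :: "real^'d::finite \<Rightarrow> real"
  assumes [measurable]: "f \<in> borel_measurable borel" and f0: "\<And>z. f z \<ge> 0" and fi: "integrable lborel f"
    and cont: "isCont f y" and b0: "\<And>n. b n > 0" and b: "b \<longlonglongrightarrow> 0"
  shows "(\<lambda>n. \<integral> z. f z * gau (b n) (z - y) \<partial>lborel) \<longlonglongrightarrow> f y"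
proof (rule LIMSEQ_I)
  fix r :: real assume r: "r > 0"
  obtain \<delta> where \<delta>: "\<delta> > 0" and close: "\<And>z. dist z y < \<delta> \<Longrightarrow> dist (f z) (f y) < r / 2"
    using cont[unfolded continuous_at_eps_delta] r by (meson half_gt_zero)
  obtain C where C: "C \<ge> 0" "\<And>b (w::real^'d). b > 0 \<Longrightarrow> \<delta> \<le> norm w \<Longrightarrow> gau b w \<le> C * b"
    using gau_off_le[OF \<delta>] by blast
  define k where "k = exp (real CARD('d) / 2 * ln 2) * (2 / \<delta>\<^sup>2)"
  define m where "m = (\<integral> z. f z \<partial>lborel)"
  have est: "\<bar>(\<integral> z. f z * gau (b n) (z - y) \<partial>lborel) - f y\<bar> \<le> r / 2 + b n * (C * m + f y * k)" for n
  proof -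
    have bp: "b n > 0" by (rule b0)
    define E where "E = exp (- (real CARD('d) / 2) * ln (pi * b n))"
    have E: "E \<ge> 0" "gau (b n) (z - y) \<le> E" for z using gau_le_max[OF bp] by (auto simp: E_def)
    have i1: "integrable lborel (\<lambda>z. f z * gau (b n) (z - y))"
    proof (rule Bochner_Integration.integrable_bound)
      show "integrable lborel (\<lambda>z. f z * E)"
        by (intro integrable_mult_left fi)
      show "AE z in lborel. norm (f z * gau (b n) (z - y)) \<le> norm (f z * E)"
        by (intro AE_I2) (simp add: abs_mult f0 mult_left_mono E)
    qed measurable
    have i2: "integrable lborel (\<lambda>z. f y * gau (b n) (z - y))"
      by (intro integrable_mult_right integrable_gau_shift bp)
    have i3: "integrable lborel (\<lambda>z. gau (2 * b n) (z - y))"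
      by (rule integrable_gau_shift) (use bp in simp)
    let ?h = "\<lambda>z. r / 2 * gau (b n) (z - y) + C * b n * f z + f y * k * b n * gau (2 * b n) (z - y)"
    have "\<bar>f z * gau (b n) (z - y) - f y * gau (b n) (z - y)\<bar> \<le> ?h z" for z
    proof -
      have nn: "C * b n * f z \<ge> 0" "f y * k * b n * gau (2 * b n) (z - y) \<ge> 0" "r / 2 * gau (b n) (z - y) \<ge> 0"
        using C bp f0 r \<delta> by (auto simp: k_def)
      show ?thesis
      proof (cases "dist z y < \<delta>")
        case True
        have "\<bar>f z * gau (b n) (z - y) - f y * gau (b n) (z - y)\<bar> = \<bar>f z - f y\<bar> * gau (b n) (z - y)"
          by (simp add: left_diff_distrib[symmetric] abs_mult)
        also have "\<dots> \<le> r / 2 * gau (b n) (z - y)"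
          using close[OF True] by (intro mult_right_mono) (auto simp: dist_real_def)
        finally show ?thesis using nn by linarith
      next
        case False
        then have w: "\<delta> \<le> norm (z - y)" by (simp add: dist_norm)
        have "f z * gau (b n) (z - y) \<le> f z * (C * b n)"
          by (intro mult_left_mono C(2)[OF bp w] f0)
        moreover have "f y * gau (b n) (z - y) \<le> f y * (k * b n * gau (2 * b n) (z - y))"
          using gau_off_le_gau[OF bp \<delta> w] by (intro mult_left_mono f0) (simp add: k_def mult_ac)
        moreover have "f z * gau (b n) (z - y) \<ge> 0" "f y * gau (b n) (z - y) \<ge> 0" using f0 by auto
        ultimately have "\<bar>f z * gau (b n) (z - y) - f y * gau (b n) (z - y)\<bar> \<le> f z * (C * b n) + f y * (k * b n * gau (2 * b n) (z - y))"
          by linarith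
        also have "\<dots> = C * b n * f z + f y * k * b n * gau (2 * b n) (z - y)" by (simp add: mult_ac)
        finally show ?thesis using nn by linarith
      qed
    qed
    then have "(\<integral> z. \<bar>f z * gau (b n) (z - y) - f y * gau (b n) (z - y)\<bar> \<partial>lborel) \<le> (\<integral> z. ?h z \<partial>lborel)"
      by (intro integral_mono integrable_abs Bochner_Integration.integrable_diff Bochner_Integration.integrable_add
         integrable_mult_right integrable_gau_shift i1 i2 i3 fi bp)
    also have "(\<integral> z. ?h z \<partial>lborel) = r / 2 + C * b n * m + f y * k * b n"
      using integrable_gau_shift[OF bp, of y] i3 fi integral_gau_shift[OF bp, of y] integral_gau_shift[of "2 * b n" y] bp
      by (simp add: m_def)
    finally have 1: "(\<integral> z. \<bar>f z * gau (b n) (z - y) - f y * gau (b n) (z - y)\<bar> \<partial>lborel) \<le> r / 2 + C * b n * m + f y * k * b n" .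
    have "(\<integral> z. f z * gau (b n) (z - y) \<partial>lborel) - f y = (\<integral> z. f z * gau (b n) (z - y) - f y * gau (b n) (z - y) \<partial>lborel)"
      using i1 i2 integral_gau_shift[OF bp, of y] by simp
    then have "\<bar>(\<integral> z. f z * gau (b n) (z - y) \<partial>lborel) - f y\<bar> \<le> (\<integral> z. \<bar>f z * gau (b n) (z - y) - f y * gau (b n) (z - y)\<bar> \<partial>lborel)"
      using integral_abs_bound[of lborel "\<lambda>z. f z * gau (b n) (z - y) - f y * gau (b n) (z - y)"] by simp
    with 1 show ?thesis by (simp add: algebra_simps)
  qed
  have "(\<lambda>n. b n * (C * m + f y * k)) \<longlonglongrightarrow> 0 * (C * m + f y * k)"
    by (intro tendsto_intros b)
  then have "\<forall>\<^sub>F n in sequentially. b n * (C * m + f y * k) < r / 2"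
    using r by (intro order_tendstoD) auto
  then obtain N where N: "\<And>n. n \<ge> N \<Longrightarrow> b n * (C * m + f y * k) < r / 2"
    unfolding eventually_sequentially by blast
  show "\<exists>no. \<forall>n\<ge>no. norm ((\<integral> z. f z * gau (b n) (z - y) \<partial>lborel) - f y) < r"
  proof (intro exI allI impI)
    fix n assume "N \<le> n"
    then show "norm ((\<integral> z. f z * gau (b n) (z - y) \<partial>lborel) - f y) < r"
      using est[of n] N[OF \<open>N \<le> n\<close>] unfolding real_norm_def by linarith
  qed
qed

section \<open>The mild form of the Fokker--Planck equation\<close>

text \<open>A transition density with its starting point \<open>(s, \<xi>)\<close> frozen, seen as
  one function \<open>u\<close> of the later space-time point and extended by 0 to times up to
  \<open>s\<close>, so that it can be integrated over all of space-time.\<close>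

locale fokker_planck = drift \<nu> T M c for \<nu> T M and c :: "real \<times> (real^'d::finite) \<Rightarrow> real^'d" +
  fixes s :: real and \<xi> :: "real^'d" and u :: "real \<times> (real^'d) \<Rightarrow> real"
  assumes s0: "0 \<le> s"
    and u_meas [measurable]: "u \<in> borel_measurable borel"
    and u_nonneg: "u m \<ge> 0"
    and u_zero: "t \<le> s \<Longrightarrow> u (t, y) = 0"
    and u_mass: "s < t \<Longrightarrow> t \<le> T \<Longrightarrow> (\<integral>\<^sup>+ y. ennreal (u (t, y)) \<partial>lborel) = 1"
    and u_cont: "continuous_on {m. s < fst m} u"
    and u_weak: "s < t \<Longrightarrow> t \<le> T \<Longrightarrow> test_fun f \<Longrightarrow>
      (\<integral> x. u (t, x) * f x \<partial>lborel) = f \<xi> + (\<integral> r. indicator {s<..<t} r *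
         (\<integral> x. u (r, x) * (\<nu> * laplacian f x + c (r, x) \<bullet> grad f x) \<partial>lborel) \<partial>lborel)"
begin

lemma u_slice_meas [measurable]: "(\<lambda>y. u (t, y)) \<in> borel_measurable borel"
  by (rule measurable_compose[OF _ u_meas]) measurable

lemma u_slice_integrable:
  assumes "s < t" "t \<le> T" and [measurable]: "f \<in> borel_measurable borel" and B: "\<And>y. \<bar>f y\<bar> \<le> B"
  shows "integrable lborel (\<lambda>y. u (t, y) * f y)"
proof -
  have "integrable lborel (\<lambda>y. u (t, y))"
    by (rule integrableI_bounded) (simp_all add: u_nonneg u_mass[OF assms(1,2)])
  then have "integrable lborel (\<lambda>y. u (t, y) * B)" by (rule integrable_mult_left)
  then show ?thesis
  proof (rule Bochner_Integration.integrable_bound)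
    show "AE y in lborel. norm (u (t, y) * f y) \<le> norm (u (t, y) * B)"
      using order_trans[OF B abs_ge_self] by (intro AE_I2) (simp add: abs_mult u_nonneg mult_left_mono)
  qed measurable
qed

text \<open>The weight of the space-time integral in the weak equation: the occupation density of
  the process on \<open>(s, t)\<close>. Its total mass is \<open>t - s\<close>, so bounded functions
  are integrable against it.\<close>

definition "wt t m = indicator {s<..<t} (fst m) * u m"

lemma wt_meas [measurable]: "wt t \<in> borel_measurable borel"
  unfolding wt_def[abs_def] by measurable

lemma wt_nonneg: "wt t m \<ge> 0" by (simp add: wt_def u_nonneg)

lemma wt_pair: "wt t (r, z) = indicator {s<..<t} r * u (r, z)" by (simp add: wt_def)

lemma wt_integrable:
  assumes t: "s < t" "t \<le> T" and [measurable]: "F \<in> borel_measurable borel"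
    and B: "\<And>m. s < fst m \<Longrightarrow> fst m < t \<Longrightarrow> \<bar>F m\<bar> \<le> B"
  shows "integrable lborel (\<lambda>m. wt t m * F m)"
proof -
  have "(\<integral>\<^sup>+ m. ennreal (wt t m) \<partial>lborel) = (\<integral>\<^sup>+ r. \<integral>\<^sup>+ z. ennreal (wt t (r, z)) \<partial>lborel \<partial>lborel)"
    by (rule nn_integral_lborel_iterated) measurable
  also have "\<dots> = (\<integral>\<^sup>+ r. indicator {s<..<t} r \<partial>lborel)"
  proof (rule nn_integral_cong)
    fix r show "(\<integral>\<^sup>+ z. ennreal (wt t (r, z)) \<partial>lborel) = indicator {s<..<t} r"
      using u_mass[of r] t by (auto simp: wt_pair indicator_def)
  qed
  also have "\<dots> < \<infinity>" using t by simp
  finally have "integrable lborel (wt t)"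
    by (intro integrableI_bounded) (simp_all add: wt_nonneg)
  then have "integrable lborel (\<lambda>m. wt t m * B)" by (rule integrable_mult_left)
  then show ?thesis
  proof (rule Bochner_Integration.integrable_bound)
    show "AE m in lborel. norm (wt t m * F m) \<le> norm (wt t m * B)"
    proof (intro AE_I2)
      fix m
      show "norm (wt t m * F m) \<le> norm (wt t m * B)"
        using order_trans[OF B abs_ge_self, of m]
        by (cases "s < fst m \<and> fst m < t") (auto simp: abs_mult wt_def intro: mult_left_mono)
    qed
  qed measurable
qed

lemma wt_integral:
  assumes "integrable lborel (\<lambda>m. wt t m * F m)"
  shows "(\<integral> m. wt t m * F m \<partial>lborel) = (\<integral> r. indicator {s<..<t} r * (\<integral> x. u (r, x) * F (r, x) \<partial>lborel) \<partial>lborel)"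
  unfolding integral_lborel_iterated[OF assms] wt_pair
  by (intro Bochner_Integration.integral_cong refl) (simp add: mult.assoc)

definition "Lgen f m = \<nu> * laplacian f (snd m) + c m \<bullet> grad f (snd m)"

lemma Lgen_meas:
  assumes "elem_smooth f" shows "Lgen f \<in> borel_measurable borel"
proof -
  have [measurable]: "(\<lambda>m :: real \<times> (real^'d). laplacian f (snd m)) \<in> borel_measurable borel"
    "(\<lambda>m :: real \<times> (real^'d). grad f (snd m)) \<in> borel_measurable borel"
    using measurable_compose[OF fst_snd_borel_measurable(2) elem_smooth_laplacian_measurable[OF assms]]
      measurable_compose[OF fst_snd_borel_measurable(2) elem_smooth_grad_measurable[OF assms]] by auto
  show ?thesis unfolding Lgen_def[abs_def] by measurable
qed

lemma Lgen_bound: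
  assumes "norm (grad f (snd m)) \<le> B" "\<bar>laplacian f (snd m)\<bar> \<le> B'"
  shows "\<bar>Lgen f m\<bar> \<le> \<nu> * B' + M * B"
proof -
  have "\<bar>c m \<bullet> grad f (snd m)\<bar> \<le> norm (c m) * norm (grad f (snd m))" by (rule Cauchy_Schwarz_ineq2)
  also have "\<dots> \<le> M * B" using M_nonneg by (intro mult_mono c_bound assms) auto
  finally have 1: "\<bar>c m \<bullet> grad f (snd m)\<bar> \<le> M * B" .
  have 2: "\<bar>\<nu> * laplacian f (snd m)\<bar> \<le> \<nu> * B'"
    using nu assms(2) by (simp add: abs_mult)
  show ?thesis unfolding Lgen_def using abs_triangle_ineq[of "\<nu> * laplacian f (snd m)" "c m \<bullet> grad f (snd m)"] 1 2
    by linarith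
qed

text \<open>Truncate \<open>f\<close> by \<open>cutoff n\<close> and let \<open>n\<close> grow. As
  \<open>u\<close> has mass one in each slice and \<open>wt t\<close> is finite, the common bound
  \<open>B\<close> dominates all truncated terms.\<close>

lemma u_weak_elem_smooth:
  assumes f: "elem_smooth f"
    and B: "\<And>x. \<bar>f x\<bar> \<le> B \<and> norm (grad f x) \<le> B \<and> \<bar>laplacian f x\<bar> \<le> B"
    and t: "s < t" "t \<le> T"
  shows "(\<integral> x. u (t, x) * f x \<partial>lborel) = f \<xi> + (\<integral> m. wt t m * Lgen f m \<partial>lborel)"
proof -
  let ?f = "\<lambda>n x. cutoff n x * f x"
  let ?d = "real CARD('d)"
  have fn: "elem_smooth (?f n)" for n by (intro elem_smooth.mult elem_smooth_cutoff f)
  note [measurable] = elem_smooth_measurable[OF f] elem_smooth_measurable[OF fn] Lgen_meas[OF f] Lgen_meas[OF fn]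
  have B0: "B \<ge> 0" using B[of 0] by linarith
  define B1 where "B1 = exp 1 * B + ?d * (4 * exp 1) * B"
  define B2 where "B2 = exp 1 * B + 2 * (?d * (4 * exp 1) * B) + ?d * (200 * exp 1) * B"
  have b0: "\<bar>?f n x\<bar> \<le> exp 1 * B" for n x
    unfolding abs_mult using B by (intro mult_mono abs_cutoff_le) auto
  have b1: "norm (grad (?f n) x) \<le> B1" for n x
    unfolding B1_def using B by (intro order_trans[OF norm_grad_cutoff_mult_le[OF f]] add_mono mult_left_mono) auto
  have b2: "\<bar>laplacian (?f n) x\<bar> \<le> B2" for n x
    unfolding B2_def using B by (intro order_trans[OF abs_laplacian_cutoff_mult_le[OF f]] add_mono mult_left_mono) auto
  have Lb: "\<bar>Lgen (?f n) m\<bar> \<le> \<nu> * B2 + M * B1" for n m by (intro Lgen_bound b1 b2)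
  have Li: "integrable lborel (\<lambda>m. wt t m * Lgen (?f n) m)" for n
    by (rule wt_integrable[OF t]) (measurable, rule Lb)
  have eq: "(\<integral> x. u (t, x) * ?f n x \<partial>lborel) = ?f n \<xi> + (\<integral> m. wt t m * Lgen (?f n) m \<partial>lborel)" for n
    unfolding u_weak[OF t test_fun_cutoff_mult[OF f]] wt_integral[OF Li] by (simp add: Lgen_def)
  have "(\<lambda>n. \<integral> x. u (t, x) * ?f n x \<partial>lborel) \<longlonglongrightarrow> (\<integral> x. u (t, x) * f x \<partial>lborel)"
  proof (rule integral_dominated_convergence[where w = "\<lambda>x. u (t, x) * (exp 1 * B)"])
    show "integrable lborel (\<lambda>x. u (t, x) * (exp 1 * B))"
      by (rule u_slice_integrable[OF t, where B = "\<bar>exp 1 * B\<bar>"]) auto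
    have "(\<lambda>n. u (t, x) * (cutoff n x * f x)) \<longlonglongrightarrow> u (t, x) * (1 * f x)" for x
      by (intro tendsto_intros cutoff_tendsto)
    then show "AE x in lborel. (\<lambda>n. u (t, x) * (cutoff n x * f x)) \<longlonglongrightarrow> u (t, x) * f x" by simp
    show "AE x in lborel. norm (u (t, x) * ?f n x) \<le> u (t, x) * (exp 1 * B)" for n
      using b0[of n] by (intro AE_I2) (simp add: abs_mult u_nonneg mult_left_mono)
  qed measurable
  moreover have "(\<lambda>n. \<integral> m. wt t m * Lgen (?f n) m \<partial>lborel) \<longlonglongrightarrow> (\<integral> m. wt t m * Lgen f m \<partial>lborel)"
  proof (rule integral_dominated_convergence[where w = "\<lambda>m. wt t m * (\<nu> * B2 + M * B1)"])
    show "integrable lborel (\<lambda>m. wt t m * (\<nu> * B2 + M * B1))"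
      by (rule wt_integrable[OF t, where B = "\<bar>\<nu> * B2 + M * B1\<bar>"]) auto
    show "AE m in lborel. (\<lambda>n. wt t m * Lgen (?f n) m) \<longlonglongrightarrow> wt t m * Lgen f m"
      unfolding Lgen_def
      by (intro AE_I2 tendsto_intros grad_cutoff_mult_tendsto laplacian_cutoff_mult_tendsto f)
    show "AE m in lborel. norm (wt t m * Lgen (?f n) m) \<le> wt t m * (\<nu> * B2 + M * B1)" for n
      using Lb[of n] by (intro AE_I2) (simp add: abs_mult wt_nonneg mult_left_mono)
  qed measurable
  then have "(\<lambda>n. ?f n \<xi> + (\<integral> m. wt t m * Lgen (?f n) m \<partial>lborel)) \<longlonglongrightarrow> 1 * f \<xi> + (\<integral> m. wt t m * Lgen f m \<partial>lborel)"
    by (intro tendsto_intros cutoff_tendsto)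
  ultimately show ?thesis unfolding eq using LIMSEQ_unique by fastforce
qed

text \<open>\<open>Ga\<close> and \<open>Ha\<close> are the generator applied to the heat kernel after time \<open>a\<close> and to
  its Laplacian; the latter is (up to \<open>\<nu>\<close>) the \<open>a\<close>-derivative of the former.\<close>

definition "Ga y a m = \<nu> * lgau (4 * \<nu> * a) (snd m - y) + c m \<bullet> dgau (4 * \<nu> * a) (snd m - y)"
definition "Ha y a m = \<nu> * llgau (4 * \<nu> * a) (snd m - y) + c m \<bullet> dlgau (4 * \<nu> * a) (snd m - y)"

lemma DERIV_Ga:
  assumes "a > 0" shows "((\<lambda>a. Ga y a m) has_real_derivative \<nu> * Ha y a m) (at a)"
proof -
  have p: "4 * \<nu> * a > 0" using nu assms by simp
  have l: "((\<lambda>a. 4 * \<nu> * a) has_real_derivative 4 * \<nu>) (at a)"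
    using DERIV_cmult[OF DERIV_ident, of "4 * \<nu>"] by simp
  have "((\<lambda>a. \<nu> * lgau (4 * \<nu> * a) (snd m - y) + c m \<bullet> dgau (4 * \<nu> * a) (snd m - y)) has_real_derivative
     \<nu> * (llgau (4 * \<nu> * a) (snd m - y) / 4 * (4 * \<nu>)) + (c m \<bullet> dlgau (4 * \<nu> * a) (snd m - y)) / 4 * (4 * \<nu>)) (at a)"
    by (intro DERIV_add DERIV_cmult DERIV_chain2[OF DERIV_lgau[OF p] l] DERIV_chain2[OF DERIV_dgau[OF p] l])
  then show ?thesis unfolding Ga_def by (rule DERIV_cong) (simp add: Ha_def algebra_simps)
qed

lemma DERIV_gau_time:
  assumes "a > 0" shows "((\<lambda>a. gau (4 * \<nu> * a) x) has_real_derivative \<nu> * lgau (4 * \<nu> * a) x) (at a)"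
proof -
  have p: "4 * \<nu> * a > 0" using nu assms by simp
  have l: "((\<lambda>a. 4 * \<nu> * a) has_real_derivative 4 * \<nu>) (at a)"
    using DERIV_cmult[OF DERIV_ident, of "4 * \<nu>"] by simp
  show ?thesis by (rule DERIV_cong[OF DERIV_chain2[OF DERIV_gau[OF p] l]]) simp
qed

lemma Ga_Lgen: "Ga y a = Lgen (\<lambda>z. gau (4 * \<nu> * a) (z - y))"
  by (simp add: fun_eq_iff Ga_def Lgen_def laplacian_gau grad_gau)

lemma Ha_Lgen: "Ha y a = Lgen (\<lambda>z. lgau (4 * \<nu> * a) (z - y))"
  by (simp add: fun_eq_iff Ha_def Lgen_def laplacian_lgau grad_lgau)

lemma DERIV_imp_continuous_on:
  assumes "\<And>a. a \<in> S \<Longrightarrow> (F has_real_derivative F' a) (at a)" shows "continuous_on S F"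
  using assms by (meson DERIV_isCont continuous_at_imp_continuous_on)

lemma integral_FTC:
  fixes F f :: "real \<Rightarrow> real"
  assumes ab: "a \<le> b" and F: "\<And>x. a \<le> x \<Longrightarrow> x \<le> b \<Longrightarrow> (F has_real_derivative f x) (at x)"
    and f: "continuous_on {a..b} f"
  shows "(\<integral> x. indicator {a<..<b} x * f x \<partial>lborel) = F b - F a"
proof -
  have "interval_lebesgue_integral lborel (ereal a) (ereal b) f = F b - F a"
    using ab F f by (intro interval_integral_FTC_finite)
      (auto simp: min_def max_def has_real_derivative_iff_has_vector_derivative[symmetric] intro: has_field_derivative_at_within)
  then show ?thesis
    using ab by (simp add: interval_lebesgue_integral_def set_lebesgue_integral_def)
qed

lemma llgau_continuous: "continuous_on {0<..} (\<lambda>s. llgau s x)"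
  unfolding llgau_def lapfac_def gau_def by (intro continuous_intros) (auto simp: less_imp_neq)

lemma dlgau_continuous: "continuous_on {0<..} (\<lambda>s. dlgau s x)"
  unfolding dlgau_def lapfac_def gau_def by (intro continuous_intros) (auto simp: less_imp_neq)

lemma Ha_continuous: "continuous_on {0<..} (\<lambda>a. Ha y a m)"
  unfolding Ha_def
proof (intro continuous_intros)
  have i: "(\<lambda>a. 4 * \<nu> * a) ` {0<..} \<subseteq> {0<..}" using nu by auto
  have l: "continuous_on {0<..} (\<lambda>a. 4 * \<nu> * a)" by (intro continuous_intros)
  show "continuous_on {0<..} (\<lambda>a. llgau (4 * \<nu> * a) (snd m - y))"
    using continuous_on_compose2[OF llgau_continuous l i] .
  show "continuous_on {0<..} (\<lambda>a. dlgau (4 * \<nu> * a) (snd m - y))"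
    using continuous_on_compose2[OF dlgau_continuous l i] .
qed

lemma lgau_time_continuous: "continuous_on {0<..} (\<lambda>a. lgau (4 * \<nu> * a) x)"
proof -
  have i: "(\<lambda>a. 4 * \<nu> * a) ` {0<..} \<subseteq> {0<..}" using nu by auto
  have l: "continuous_on {0<..} (\<lambda>a. 4 * \<nu> * a)" by (intro continuous_intros)
  have "continuous_on {0<..} (\<lambda>s. lgau s x)" by (rule DERIV_imp_continuous_on) (auto intro: DERIV_lgau)
  from continuous_on_compose2[OF this l i] show ?thesis .
qed

text \<open>Time-dependent test functions are avoided: \<open>Ga\<close> at the time \<open>\<epsilon>\<close> is written as \<open>Ga\<close> at the time
  \<open>t + \<epsilon> - r\<close> minus the integral of its derivative \<open>\<nu> * Ha\<close>, and after Fubini the weak equation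
  is applied once more, to the Laplacian of the heat kernel.\<close>

lemma u_mild_regularized:
  assumes e: "\<epsilon> > 0" and t: "s < t" "t \<le> T"
  shows "(\<integral> z. u (t, z) * gau (4 * \<nu> * \<epsilon>) (z - y) \<partial>lborel) = gau (4 * \<nu> * (t + \<epsilon> - s)) (\<xi> - y) +
     (\<integral> m. wt t m * (c m \<bullet> dgau (4 * \<nu> * (t + \<epsilon> - fst m)) (snd m - y)) \<partial>lborel)"
proof -
  let ?A = "t + \<epsilon> - s"
  \<comment> \<open>All kernel times below lie between \<open>\<epsilon>\<close> and
    \<open>t + \<epsilon> - s\<close>, so one constant \<open>B\<close> dominates every
    derivative.\<close>
  have "0 < 4 * \<nu> * \<epsilon>" "4 * \<nu> * \<epsilon> \<le> 4 * \<nu> * ?A" using e nu t by auto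
  then obtain B where B0: "B \<ge> 0" and B: "\<And>q (x::real^'d). 4 * \<nu> * \<epsilon> \<le> q \<Longrightarrow> q \<le> 4 * \<nu> * ?A \<Longrightarrow>
     gau q x \<le> B \<and> norm (dgau q x) \<le> B \<and> \<bar>lgau q x\<bar> \<le> B \<and> norm (dlgau q x) \<le> B \<and> \<bar>llgau q x\<bar> \<le> B"
    using gau_bounds by metis
  have rng: "4 * \<nu> * \<epsilon> \<le> 4 * \<nu> * a \<and> 4 * \<nu> * a \<le> 4 * \<nu> * ?A" if "\<epsilon> \<le> a" "a \<le> ?A" for a
    using that nu by auto
  have Bg: "\<bar>gau (4 * \<nu> * a) x\<bar> \<le> B" "norm (dgau (4 * \<nu> * a) x) \<le> B" "\<bar>lgau (4 * \<nu> * a) x\<bar> \<le> B"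
     "norm (dlgau (4 * \<nu> * a) x) \<le> B" "\<bar>llgau (4 * \<nu> * a) x\<bar> \<le> B" if "\<epsilon> \<le> a" "a \<le> ?A" for a and x :: "real^'d"
    using B[of "4 * \<nu> * a" x] rng[OF that] by auto
  define D where "D = \<nu> * B + M * B"
  have Gb: "\<bar>Ga y a m\<bar> \<le> D" and Hb: "\<bar>Ha y a m\<bar> \<le> D" if "\<epsilon> \<le> a" "a \<le> ?A" for a m
    unfolding Ga_Lgen Ha_Lgen D_def
    by (intro Lgen_bound; simp only: grad_gau laplacian_gau grad_lgau laplacian_lgau; intro Bg that)+
  have W1: "(\<integral> x. u (t, x) * gau (4 * \<nu> * \<epsilon>) (x - y) \<partial>lborel) = gau (4 * \<nu> * \<epsilon>) (\<xi> - y) + (\<integral> m. wt t m * Ga y \<epsilon> m \<partial>lborel)"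
    unfolding Ga_Lgen
    by (rule u_weak_elem_smooth[OF elem_smooth_gau _ t, where B = B])
       (use e t in \<open>simp only: grad_gau laplacian_gau, intro conjI Bg; simp\<close>)
  have W2: "(\<integral> x. u (r, x) * lgau (4 * \<nu> * a) (x - y) \<partial>lborel) = lgau (4 * \<nu> * a) (\<xi> - y) + (\<integral> m. wt r m * Ha y a m \<partial>lborel)"
    if "s < r" "r \<le> T" "\<epsilon> \<le> a" "a \<le> ?A" for r a
    unfolding Ha_Lgen
    by (rule u_weak_elem_smooth[OF elem_smooth_lgau _ that(1,2), where B = B])
       (simp only: grad_lgau laplacian_lgau, intro conjI Bg that)
  have Gm [measurable]: "(\<lambda>w. Ga y (f w) (g w)) \<in> borel_measurable N"
    if [measurable]: "f \<in> borel_measurable N" "g \<in> borel_measurable N" for f g and N :: "'z measure"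
    unfolding Ga_def by measurable
  have Hm: "(\<lambda>w. Ha y (f w) (g w)) \<in> borel_measurable N"
    if [measurable]: "f \<in> borel_measurable N" "g \<in> borel_measurable N" for f g and N :: "'z measure"
    unfolding Ha_def by measurable
  \<comment> \<open>The double integral runs over \<open>s < r < t\<close> and
    \<open>\<epsilon> < a < t + \<epsilon> - r\<close>; both constraints are put into the integrand
    so that Fubini applies on the full product.\<close>
  define \<phi> where "\<phi> m a = wt t m * (indicator {\<epsilon><..<t + \<epsilon> - fst m} a * (\<nu> * Ha y a m))" for m a
  have \<phi>m: "(\<lambda>p. \<phi> (fst p) (snd p)) \<in> borel_measurable (borel :: ((real \<times> (real^'d)) \<times> real) measure)"
  proof -
    let ?S = "{p :: (real \<times> (real^'d)) \<times> real. \<epsilon> < snd p \<and> snd p < t + \<epsilon> - fst (fst p)}"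
    have 1: "indicator {\<epsilon><..<t + \<epsilon> - fst (fst p)} (snd p) = (indicator ?S p :: real)" for p
      by (auto simp: indicator_def)
    have "open ?S" by (intro open_Collect_conj open_Collect_less continuous_intros)
    then have 2: "indicator ?S \<in> borel_measurable borel"
      by (intro borel_measurable_indicator borel_open)
    have 3: "(\<lambda>p :: (real \<times> (real^'d)) \<times> real. Ha y (snd p) (fst p)) \<in> borel_measurable borel"
      by (intro Hm fst_snd_borel_measurable)
    have 4: "(\<lambda>p :: (real \<times> (real^'d)) \<times> real. wt t (fst p)) \<in> borel_measurable borel"
      by (rule measurable_compose[OF fst_snd_borel_measurable(1) wt_meas])
    show ?thesis unfolding \<phi>_def 1 by (intro borel_measurable_times borel_measurable_const 2 3 4)
  qed
  have \<phi>b: "\<bar>\<phi> m a\<bar> \<le> wt t m * (\<nu> * D) * indicator {\<epsilon><..<?A} a" for m a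
  proof (cases "s < fst m \<and> fst m < t \<and> \<epsilon> < a \<and> a < t + \<epsilon> - fst m")
    case True
    then have "\<bar>\<nu> * Ha y a m\<bar> \<le> \<nu> * D" using nu by (simp add: abs_mult Hb)
    then have "wt t m * \<bar>\<nu> * Ha y a m\<bar> \<le> wt t m * (\<nu> * D)" by (intro mult_left_mono wt_nonneg)
    then show ?thesis using True by (simp add: \<phi>_def abs_mult wt_nonneg)
  next
    case False
    then have "\<phi> m a = 0" by (auto simp: \<phi>_def wt_def)
    moreover have "D \<ge> 0" using B0 nu M_nonneg by (simp add: D_def)
    ultimately show ?thesis using nu wt_nonneg[of t m] by simp
  qed
  have \<phi>i: "integrable (lborel \<Otimes>\<^sub>M lborel) (\<lambda>(m, a). \<phi> m a)"
  proof (rule integrableI_bounded)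
    show "(\<lambda>(m, a). \<phi> m a) \<in> borel_measurable (lborel \<Otimes>\<^sub>M lborel)"
      using borel_measurable_pairI(2)[OF \<phi>m] by (simp add: case_prod_unfold)
    have wi: "integrable lborel (\<lambda>m. wt t m * (\<nu> * D))"
      by (rule wt_integrable[OF t, where B = "\<bar>\<nu> * D\<bar>"]) auto
    have D0: "D \<ge> 0" using B0 nu M_nonneg by (simp add: D_def)
    have "(\<integral>\<^sup>+ p. ennreal (norm (case p of (m, a) \<Rightarrow> \<phi> m a)) \<partial>(lborel \<Otimes>\<^sub>M lborel)) =
       (\<integral>\<^sup>+ m. \<integral>\<^sup>+ a. ennreal \<bar>\<phi> m a\<bar> \<partial>lborel \<partial>lborel)"
      using borel_measurable_pairI(2)[OF \<phi>m]
      by (subst lborel.nn_integral_fst[symmetric]) (simp_all add: case_prod_unfold)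
    also have "\<dots> \<le> (\<integral>\<^sup>+ m. \<integral>\<^sup>+ a. ennreal (wt t m * (\<nu> * D)) * indicator {\<epsilon><..<?A} a \<partial>lborel \<partial>lborel)"
      using \<phi>b by (intro nn_integral_mono) (simp add: ennreal_indicator[symmetric] ennreal_mult[symmetric] wt_nonneg nu less_imp_le D0 ennreal_leI del: ennreal_indicator)
    also have "\<dots> = (\<integral>\<^sup>+ m. ennreal (wt t m * (\<nu> * D)) * ennreal (t - s) \<partial>lborel)"
      using t by (intro nn_integral_cong) (simp add: nn_integral_cmult_indicator)
    also have "\<dots> = (\<integral>\<^sup>+ m. ennreal (wt t m * (\<nu> * D)) \<partial>lborel) * ennreal (t - s)"
      by (rule nn_integral_multc) measurable
    also have "\<dots> < \<infinity>"
    proof -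
      have "(\<integral>\<^sup>+ m. ennreal (wt t m * (\<nu> * D)) \<partial>lborel) \<le> (\<integral>\<^sup>+ m. ennreal (norm (wt t m * (\<nu> * D))) \<partial>lborel)"
        by (intro nn_integral_mono ennreal_leI) (simp only: real_norm_def abs_ge_self)
      also have "\<dots> < \<infinity>" using wi unfolding integrable_iff_bounded by blast
      finally show ?thesis by (simp add: ennreal_mult_less_top)
    qed
    finally show "(\<integral>\<^sup>+ p. ennreal (norm (case p of (m, a) \<Rightarrow> \<phi> m a)) \<partial>(lborel \<Otimes>\<^sub>M lborel)) < \<infinity>" .
  qed
  have Gi: "integrable lborel (\<lambda>m. wt t m * Ga y (t + \<epsilon> - fst m) m)"
    by (rule wt_integrable[OF t, where B = D]) (measurable, rule Gb, use e in auto)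
  have li: "integrable lborel (\<lambda>m. wt t m * (\<nu> * lgau (4 * \<nu> * (t + \<epsilon> - fst m)) (snd m - y)))"
  proof (rule wt_integrable[OF t, where B = "\<nu> * B"])
    fix m :: "real \<times> (real^'d)" assume "s < fst m" "fst m < t"
    then have "\<bar>lgau (4 * \<nu> * (t + \<epsilon> - fst m)) (snd m - y)\<bar> \<le> B" using e by (intro Bg) auto
    then show "\<bar>\<nu> * lgau (4 * \<nu> * (t + \<epsilon> - fst m)) (snd m - y)\<bar> \<le> \<nu> * B" using nu by (simp add: abs_mult)
  qed measurable
  have ftc: "wt t m * Ga y \<epsilon> m = wt t m * Ga y (t + \<epsilon> - fst m) m - (\<integral> a. \<phi> m a \<partial>lborel)" for m
  proof (cases "s < fst m \<and> fst m < t")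
    case True
    have "(\<integral> a. indicator {\<epsilon><..<t + \<epsilon> - fst m} a * (\<nu> * Ha y a m) \<partial>lborel) = Ga y (t + \<epsilon> - fst m) m - Ga y \<epsilon> m"
      using True e by (intro integral_FTC DERIV_Ga continuous_intros continuous_on_subset[OF Ha_continuous]) auto
    then have "(\<integral> a. \<phi> m a \<partial>lborel) = wt t m * (Ga y (t + \<epsilon> - fst m) m - Ga y \<epsilon> m)"
      unfolding \<phi>_def integral_mult_right_zero by simp
    then show ?thesis by (simp add: right_diff_distrib)
  next
    case False
    then show ?thesis by (auto simp: \<phi>_def wt_def)
  qed
  have "(\<integral> m. wt t m * Ga y \<epsilon> m \<partial>lborel) = (\<integral> m. wt t m * Ga y (t + \<epsilon> - fst m) m \<partial>lborel) - (\<integral> m. \<integral> a. \<phi> m a \<partial>lborel \<partial>lborel)"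
    unfolding ftc by (rule Bochner_Integration.integral_diff[OF Gi]) (use lborel_pair.integrable_fst'[OF \<phi>i] in simp)
  also have "(\<integral> m. \<integral> a. \<phi> m a \<partial>lborel \<partial>lborel) = (\<integral> a. \<integral> m. \<phi> m a \<partial>lborel \<partial>lborel)"
    using lborel_pair.Fubini_integral[OF \<phi>i] by simp
  also have "\<dots> = (\<integral> a. indicator {\<epsilon><..<?A} a * (\<nu> * (\<integral> x. u (t + \<epsilon> - a, x) * lgau (4 * \<nu> * a) (x - y) \<partial>lborel))
       - indicator {\<epsilon><..<?A} a * (\<nu> * lgau (4 * \<nu> * a) (\<xi> - y)) \<partial>lborel)"
  proof (rule Bochner_Integration.integral_cong[OF refl])
    fix a
    show "(\<integral> m. \<phi> m a \<partial>lborel) = indicator {\<epsilon><..<?A} a * (\<nu> * (\<integral> x. u (t + \<epsilon> - a, x) * lgau (4 * \<nu> * a) (x - y) \<partial>lborel))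
       - indicator {\<epsilon><..<?A} a * (\<nu> * lgau (4 * \<nu> * a) (\<xi> - y))"
    proof (cases "\<epsilon> < a \<and> a < ?A")
      case True
      \<comment> \<open>For fixed \<open>a\<close> the constraint reads
        \<open>r < t + \<epsilon> - a\<close>: the slab ends at that time, and \<open>W2\<close> is
        the weak equation there.\<close>
      have "\<phi> m a = \<nu> * (wt (t + \<epsilon> - a) m * Ha y a m)" for m
        using True by (auto simp: \<phi>_def wt_def indicator_def)
      then have "(\<integral> m. \<phi> m a \<partial>lborel) = \<nu> * (\<integral> m. wt (t + \<epsilon> - a) m * Ha y a m \<partial>lborel)" by simp
      also have "(\<integral> m. wt (t + \<epsilon> - a) m * Ha y a m \<partial>lborel) = (\<integral> x. u (t + \<epsilon> - a, x) * lgau (4 * \<nu> * a) (x - y) \<partial>lborel) - lgau (4 * \<nu> * a) (\<xi> - y)"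
        using W2[of "t + \<epsilon> - a" a] True t by simp
      finally show ?thesis using True by (simp add: algebra_simps)
    next
      case False
      then have "\<phi> m a = 0" for m by (auto simp: \<phi>_def wt_def indicator_def)
      then show ?thesis using False by auto
    qed
  qed
  also have "\<dots> = (\<integral> a. indicator {\<epsilon><..<?A} a * (\<nu> * (\<integral> x. u (t + \<epsilon> - a, x) * lgau (4 * \<nu> * a) (x - y) \<partial>lborel)) \<partial>lborel)
      - (\<integral> a. indicator {\<epsilon><..<?A} a * (\<nu> * lgau (4 * \<nu> * a) (\<xi> - y)) \<partial>lborel)"
  proof (rule Bochner_Integration.integral_diff)
    have "integrable lborel (\<lambda>r. \<integral> x. wt t (r, x) * (\<nu> * lgau (4 * \<nu> * (t + \<epsilon> - r)) (x - y)) \<partial>lborel)"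
      using lborel_pair.integrable_fst'[of "\<lambda>m. wt t m * (\<nu> * lgau (4 * \<nu> * (t + \<epsilon> - fst m)) (snd m - y))"] li
      by (simp add: lborel_prod)
    \<comment> \<open>Substitution \<open>r = t + \<epsilon> - a\<close>, spelled as an affine map
      with slope -1.\<close>
    then have "integrable lborel (\<lambda>a. \<integral> x. wt t ((t + \<epsilon>) + (-1) * a, x) * (\<nu> * lgau (4 * \<nu> * (t + \<epsilon> - ((t + \<epsilon>) + (-1) * a))) (x - y)) \<partial>lborel)"
      by (rule lborel_integrable_real_affine) simp
    moreover have "(\<integral> x. wt t ((t + \<epsilon>) + (-1) * a, x) * (\<nu> * lgau (4 * \<nu> * (t + \<epsilon> - ((t + \<epsilon>) + (-1) * a))) (x - y)) \<partial>lborel)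
      = indicator {\<epsilon><..<?A} a * (\<nu> * (\<integral> x. u (t + \<epsilon> - a, x) * lgau (4 * \<nu> * a) (x - y) \<partial>lborel))" for a
    proof -
      have z: "wt t ((t + \<epsilon>) + (-1) * a, x) * (\<nu> * lgau (4 * \<nu> * (t + \<epsilon> - ((t + \<epsilon>) + (-1) * a))) (x - y))
        = indicator {\<epsilon><..<?A} a * (\<nu> * (u (t + \<epsilon> - a, x) * lgau (4 * \<nu> * a) (x - y)))" for x
        by (auto simp: wt_pair indicator_def)
      show ?thesis unfolding z integral_mult_right_zero ..
    qed
    ultimately show "integrable lborel (\<lambda>a. indicator {\<epsilon><..<?A} a * (\<nu> * (\<integral> x. u (t + \<epsilon> - a, x) * lgau (4 * \<nu> * a) (x - y) \<partial>lborel)))"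
      by simp
    have "continuous_on {\<epsilon>..?A} (\<lambda>a. \<nu> * lgau (4 * \<nu> * a) (\<xi> - y))"
      using e by (intro continuous_intros continuous_on_subset[OF lgau_time_continuous]) auto
    then have "set_integrable lborel {\<epsilon>..?A} (\<lambda>a. \<nu> * lgau (4 * \<nu> * a) (\<xi> - y))"
      by (intro borel_integrable_atLeastAtMost') auto
    then have "set_integrable lborel {\<epsilon><..<?A} (\<lambda>a. \<nu> * lgau (4 * \<nu> * a) (\<xi> - y))"
      by (rule set_integrable_subset) auto
    then show "integrable lborel (\<lambda>a. indicator {\<epsilon><..<?A} a * (\<nu> * lgau (4 * \<nu> * a) (\<xi> - y)))"
      by (simp add: set_integrable_def)
  qed
  \<comment> \<open>The initial values integrate to a difference of heat kernels: the one at
    \<open>\<epsilon>\<close> cancels against \<open>W1\<close>, the one at \<open>?A\<close> is the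
    free term of the formula.\<close>
  also have "(\<integral> a. indicator {\<epsilon><..<?A} a * (\<nu> * lgau (4 * \<nu> * a) (\<xi> - y)) \<partial>lborel) = gau (4 * \<nu> * ?A) (\<xi> - y) - gau (4 * \<nu> * \<epsilon>) (\<xi> - y)"
    using e t by (intro integral_FTC DERIV_gau_time continuous_intros continuous_on_subset[OF lgau_time_continuous]) auto
  also have "(\<integral> a. indicator {\<epsilon><..<?A} a * (\<nu> * (\<integral> x. u (t + \<epsilon> - a, x) * lgau (4 * \<nu> * a) (x - y) \<partial>lborel)) \<partial>lborel)
     = (\<integral> m. wt t m * (\<nu> * lgau (4 * \<nu> * (t + \<epsilon> - fst m)) (snd m - y)) \<partial>lborel)"
  proof -
    have "(\<integral> m. wt t m * (\<nu> * lgau (4 * \<nu> * (t + \<epsilon> - fst m)) (snd m - y)) \<partial>lborel) =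
      (\<integral> r. indicator {s<..<t} r * (\<integral> x. u (r, x) * (\<nu> * lgau (4 * \<nu> * (t + \<epsilon> - r)) (x - y)) \<partial>lborel) \<partial>lborel)"
      unfolding wt_integral[OF li] by simp
    also have "\<dots> = (\<integral> a. indicator {s<..<t} ((t + \<epsilon>) + (-1) * a) * (\<integral> x. u ((t + \<epsilon>) + (-1) * a, x) * (\<nu> * lgau (4 * \<nu> * (t + \<epsilon> - ((t + \<epsilon>) + (-1) * a))) (x - y)) \<partial>lborel) \<partial>lborel)"
      by (subst lborel_integral_real_affine[where c = "-1" and t = "t + \<epsilon>"]) auto
    also have "\<dots> = (\<integral> a. indicator {\<epsilon><..<?A} a * (\<nu> * (\<integral> x. u (t + \<epsilon> - a, x) * lgau (4 * \<nu> * a) (x - y) \<partial>lborel)) \<partial>lborel)"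
    proof (rule Bochner_Integration.integral_cong[OF refl])
      fix a
      have z1: "u ((t + \<epsilon>) + (-1) * a, x) * (\<nu> * lgau (4 * \<nu> * (t + \<epsilon> - ((t + \<epsilon>) + (-1) * a))) (x - y)) = \<nu> * (u (t + \<epsilon> - a, x) * lgau (4 * \<nu> * a) (x - y))" for x
        by (simp add: mult.left_commute)
      have z2: "indicator {s<..<t} ((t + \<epsilon>) + (-1) * a) = (indicator {\<epsilon><..<?A} a :: real)"
        by (auto simp: indicator_def)
      show "indicator {s<..<t} ((t + \<epsilon>) + (-1) * a) * (\<integral> x. u ((t + \<epsilon>) + (-1) * a, x) * (\<nu> * lgau (4 * \<nu> * (t + \<epsilon> - ((t + \<epsilon>) + (-1) * a))) (x - y)) \<partial>lborel)
        = indicator {\<epsilon><..<?A} a * (\<nu> * (\<integral> x. u (t + \<epsilon> - a, x) * lgau (4 * \<nu> * a) (x - y) \<partial>lborel))"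
        unfolding z1 z2 integral_mult_right_zero ..
    qed
    finally show ?thesis ..
  qed
  finally have "(\<integral> m. wt t m * Ga y \<epsilon> m \<partial>lborel) =
     ((\<integral> m. wt t m * Ga y (t + \<epsilon> - fst m) m \<partial>lborel) - (\<integral> m. wt t m * (\<nu> * lgau (4 * \<nu> * (t + \<epsilon> - fst m)) (snd m - y)) \<partial>lborel))
      + gau (4 * \<nu> * ?A) (\<xi> - y) - gau (4 * \<nu> * \<epsilon>) (\<xi> - y)" by simp
  \<comment> \<open>The Laplacian part of \<open>Ga\<close> is exactly the second integral, so only
    the drift part survives.\<close>
  also have "(\<integral> m. wt t m * Ga y (t + \<epsilon> - fst m) m \<partial>lborel) - (\<integral> m. wt t m * (\<nu> * lgau (4 * \<nu> * (t + \<epsilon> - fst m)) (snd m - y)) \<partial>lborel)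
     = (\<integral> m. wt t m * (c m \<bullet> dgau (4 * \<nu> * (t + \<epsilon> - fst m)) (snd m - y)) \<partial>lborel)"
    unfolding Bochner_Integration.integral_diff[OF Gi li, symmetric]
    by (intro Bochner_Integration.integral_cong refl) (simp add: Ga_def algebra_simps)
  finally show ?thesis using W1 by simp
qed

text \<open>As \<open>r\<close> tends to \<open>t\<close> and \<open>\<epsilon>\<close> to 0 the
  Gaussian concentrates at \<open>y\<close>, so the mass of \<open>u\<close> alone gives no uniform
  bound. Continuity at \<open>(t, y)\<close> bounds \<open>u\<close> in a neighbourhood, where the
  Gaussian has mass at most one; outside it the Gaussian is bounded and \<open>u (r, _)\<close> has
  mass one.\<close>

lemma u_bound_near:
  assumes t: "s < t" "t \<le> T"
  obtains Kc where "Kc \<ge> 0" "\<And>r \<epsilon>. s < r \<Longrightarrow> r < t \<Longrightarrow> 0 \<le> \<epsilon> \<Longrightarrow> \<epsilon> \<le> 1 \<Longrightarrow>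
     (\<integral>\<^sup>+ z. ennreal (u (r, z) * gau (8 * \<nu> * (t + \<epsilon> - r)) (z - y)) \<partial>lborel) \<le> ennreal Kc"
proof -
  have op: "open {m :: real \<times> (real^'d). s < fst m}"
    by (intro open_Collect_less continuous_intros)
  have "isCont u (t, y)"
    using u_cont op t continuous_on_eq_continuous_at by fastforce
  then obtain \<delta>' where \<delta>': "\<delta>' > 0" "\<And>m. dist m (t, y) < \<delta>' \<Longrightarrow> dist (u m) (u (t, y)) < 1"
    unfolding continuous_at_eps_delta by (metis zero_less_one)
  \<comment> \<open>The distance of pairs is at most the sum of the distances of the components,
    hence the half.\<close>
  define \<delta> where "\<delta> = \<delta>' / 2"
  have \<delta>: "\<delta> > 0" using \<delta>' by (simp add: \<delta>_def)
  define U where "U = u (t, y) + 1"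
  have U0: "U \<ge> 0" using u_nonneg[of "(t, y)"] by (simp add: U_def)
  have U: "u (r, z) \<le> U" if "\<bar>r - t\<bar> < \<delta>" "norm (z - y) < \<delta>" for r z
  proof -
    have "dist (r, z) (t, y) \<le> dist r t + dist z y"
      unfolding dist_Pair_Pair by (rule sqrt_sum_squares_le_sum) auto
    also have "\<dots> < \<delta>'" using that by (simp add: dist_norm \<delta>_def)
    finally have "dist (u (r, z)) (u (t, y)) < 1" by (rule \<delta>'(2))
    then show ?thesis by (simp add: U_def dist_real_def abs_less_iff)
  qed
  obtain C where C: "C \<ge> 0" "\<And>b (w::real^'d). b > 0 \<Longrightarrow> \<delta> \<le> norm w \<Longrightarrow> gau b w \<le> C * b"
    using gau_off_le[OF \<delta>] by blast
  \<comment> \<open>\<open>C'\<close> serves positions far from \<open>y\<close> at times near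
    \<open>t\<close>; the kernel parameter is at most \<open>8 * \<nu> * (T + 1)\<close> since
    \<open>\<epsilon> \<le> 1\<close>. \<open>C''\<close> serves times at distance at least
    \<open>\<delta>\<close> from \<open>t\<close>, where the peak of the Gaussian is
    bounded.\<close>
  define C' where "C' = C * (8 * \<nu> * (T + 1))"
  define C'' where "C'' = exp (- (real CARD('d) / 2) * ln (pi * (8 * \<nu> * \<delta>)))"
  have C0: "C' \<ge> 0" "C'' \<ge> 0" using C nu T by (auto simp: C'_def C''_def)
  show ?thesis
  proof (rule that[of "U + (C' + C'')"])
    show "U + (C' + C'') \<ge> 0" using U0 C0 by simp
    fix r \<epsilon> :: real assume r: "s < r" "r < t" and e: "0 \<le> \<epsilon>" "\<epsilon> \<le> 1"
    let ?b = "8 * \<nu> * (t + \<epsilon> - r)"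
    have b: "?b > 0" using nu r e by simp
    have bT: "?b \<le> 8 * \<nu> * (T + 1)" using nu r e t s0 by simp
    have "u (r, z) * gau ?b (z - y) \<le> U * gau ?b (z - y) + (C' + C'') * u (r, z)" for z
    proof (cases "\<bar>r - t\<bar> < \<delta>")
      case near: True
      show ?thesis
      proof (cases "norm (z - y) < \<delta>")
        case True
        have "u (r, z) * gau ?b (z - y) \<le> U * gau ?b (z - y)" by (intro mult_right_mono U near True) auto
        moreover have "(C' + C'') * u (r, z) \<ge> 0" using C0 u_nonneg by simp
        ultimately show ?thesis by linarith
      next
        case False
        have "gau ?b (z - y) \<le> C * ?b" using False by (intro C(2) b) auto
        also have "\<dots> \<le> C'" unfolding C'_def by (intro mult_left_mono bT C)
        also have "\<dots> \<le> C' + C''" using C0 by simp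
        finally have "u (r, z) * gau ?b (z - y) \<le> u (r, z) * (C' + C'')" by (intro mult_left_mono u_nonneg)
        moreover have "U * gau ?b (z - y) \<ge> 0" using U0 by simp
        ultimately show ?thesis by (simp add: mult.commute)
      qed
    next
      case False
      then have d: "8 * \<nu> * \<delta> \<le> ?b" using nu r e by simp
      have "gau ?b (z - y) \<le> exp (- (real CARD('d) / 2) * ln (pi * ?b))" by (rule gau_le_max[OF b])
      also have "\<dots> \<le> C''" unfolding C''_def using d b nu \<delta>
        by (simp add: mult_left_mono)
      also have "\<dots> \<le> C' + C''" using C0 by simp
      finally have "u (r, z) * gau ?b (z - y) \<le> u (r, z) * (C' + C'')" by (intro mult_left_mono u_nonneg)
      moreover have "U * gau ?b (z - y) \<ge> 0" using U0 by simp
      ultimately show ?thesis by (simp add: mult.commute)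
    qed
    then have "(\<integral>\<^sup>+ z. ennreal (u (r, z) * gau ?b (z - y)) \<partial>lborel) \<le>
      (\<integral>\<^sup>+ z. ennreal U * ennreal (gau ?b (z - y)) + ennreal (C' + C'') * ennreal (u (r, z)) \<partial>lborel)"
      using U0 C0 u_nonneg
      by (intro nn_integral_mono) (simp add: ennreal_mult[symmetric] ennreal_plus[symmetric] ennreal_leI del: ennreal_plus)
    also have "\<dots> = ennreal U * (\<integral>\<^sup>+ z. ennreal (gau ?b (z - y)) \<partial>lborel) + ennreal (C' + C'') * (\<integral>\<^sup>+ z. ennreal (u (r, z)) \<partial>lborel)"
      by (simp add: nn_integral_add nn_integral_cmult)
    also have "\<dots> = ennreal (U + (C' + C''))"
      using U0 C0 r t b by (simp add: nn_integral_gau_shift u_mass ennreal_plus[symmetric] del: ennreal_plus)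
    finally show "(\<integral>\<^sup>+ z. ennreal (u (r, z) * gau ?b (z - y)) \<partial>lborel) \<le> ennreal (U + (C' + C''))" .
  qed
qed

text \<open>Let \<open>\<epsilon>\<close> tend to 0 in \<open>u_mild_regularized\<close>. The left
  side tends to \<open>u (t, y)\<close> by the approximate identity. On the right
  \<open>u_bound_near\<close> dominates the position integral by a multiple of
  \<open>1 / sqrt (t - r)\<close>, uniformly for \<open>0 \<le> \<epsilon> \<le> 1\<close>; the
  value \<open>\<epsilon> = 0\<close> gives the integrability.\<close>

lemma u_mild:
  assumes t: "s < t" "t \<le> T"
  shows "integrable lborel (\<lambda>m. u m * K m (t, y))"
    and "u (t, y) = G (s, \<xi>) (t, y) + (\<integral> m. u m * K m (t, y) \<partial>lborel)"
proof -
  obtain Kc where Kc: "Kc \<ge> 0" "\<And>r \<epsilon>. s < r \<Longrightarrow> r < t \<Longrightarrow> 0 \<le> \<epsilon> \<Longrightarrow> \<epsilon> \<le> 1 \<Longrightarrow>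
     (\<integral>\<^sup>+ z. ennreal (u (r, z) * gau (8 * \<nu> * (t + \<epsilon> - r)) (z - y)) \<partial>lborel) \<le> ennreal Kc"
    using u_bound_near[OF t] by blast
  define k where "k \<epsilon> m = c m \<bullet> dgau (4 * \<nu> * (t + \<epsilon> - fst m)) (snd m - y)" for \<epsilon> and m :: "real \<times> (real^'d)"
  have km [measurable]: "k \<epsilon> \<in> borel_measurable borel" for \<epsilon> unfolding k_def[abs_def] by measurable
  have kmz [measurable]: "(\<lambda>z. k \<epsilon> (r, z)) \<in> borel_measurable borel" for \<epsilon> r
    by (rule measurable_compose[OF _ km]) measurable
  \<comment> \<open>\<open>u\<close> vanishes up to time \<open>s\<close> and \<open>K\<close> from
    time \<open>t\<close> on, so the integral over all of space-time is one over the slab.\<close>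
  have uK: "u m * K m (t, y) = wt t m * k 0 m" for m
  proof -
    obtain r z where m: "m = (r, z)" by fastforce
    show ?thesis using u_zero[of r z] s0 t
      by (auto simp: m KK_def kreg_def wt_def k_def indicator_def not_less)
  qed
  have nnb: "(\<integral>\<^sup>+ z. ennreal (norm (u (r, z) * k \<epsilon> (r, z))) \<partial>lborel) \<le> ennreal (C1 * Kc * (1 / sqrt (t - r)))"
    if r: "s < r" "r < t" and e: "0 \<le> \<epsilon>" "\<epsilon> \<le> 1" for r \<epsilon>
  proof -
    have st: "1 / sqrt (t + \<epsilon> - r) \<le> 1 / sqrt (t - r)"
      using r e by (intro divide_left_mono) auto
    have "(\<integral>\<^sup>+ z. ennreal (norm (u (r, z) * k \<epsilon> (r, z))) \<partial>lborel) \<le>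
       (\<integral>\<^sup>+ z. ennreal (C1 * (1 / sqrt (t - r))) * ennreal (u (r, z) * gau (8 * \<nu> * (t + \<epsilon> - r)) (z - y)) \<partial>lborel)"
    proof (rule nn_integral_mono)
      fix z
      have "norm (u (r, z) * k \<epsilon> (r, z)) = u (r, z) * \<bar>k \<epsilon> (r, z)\<bar>" by (simp add: abs_mult u_nonneg)
      also have "\<dots> \<le> u (r, z) * (C1 * (1 / sqrt (t + \<epsilon> - r) * gau (8 * \<nu> * (t + \<epsilon> - r)) (z - y)))"
        unfolding k_def using r e drift_dgau_bound[of r "t + \<epsilon>" "(r, z)" "z - y"]
        by (intro mult_left_mono u_nonneg) auto
      also have "\<dots> \<le> u (r, z) * (C1 * (1 / sqrt (t - r) * gau (8 * \<nu> * (t + \<epsilon> - r)) (z - y)))"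
        by (intro mult_left_mono mult_right_mono st u_nonneg C_nonneg) auto
      finally have "norm (u (r, z) * k \<epsilon> (r, z)) \<le> C1 * (1 / sqrt (t - r)) * (u (r, z) * gau (8 * \<nu> * (t + \<epsilon> - r)) (z - y))"
        by (simp add: mult_ac)
      then show "ennreal (norm (u (r, z) * k \<epsilon> (r, z))) \<le> ennreal (C1 * (1 / sqrt (t - r))) * ennreal (u (r, z) * gau (8 * \<nu> * (t + \<epsilon> - r)) (z - y))"
        using C_nonneg u_nonneg r by (subst ennreal_mult[symmetric]) (auto intro!: ennreal_leI)
    qed
    also have "\<dots> = ennreal (C1 * (1 / sqrt (t - r))) * (\<integral>\<^sup>+ z. ennreal (u (r, z) * gau (8 * \<nu> * (t + \<epsilon> - r)) (z - y)) \<partial>lborel)"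
      by (rule nn_integral_cmult) measurable
    also have "\<dots> \<le> ennreal (C1 * (1 / sqrt (t - r))) * ennreal Kc"
      by (intro mult_left_mono Kc r e) auto
    also have "\<dots> = ennreal (C1 * Kc * (1 / sqrt (t - r)))"
      using C_nonneg Kc r by (simp add: ennreal_mult[symmetric] mult_ac)
    finally show ?thesis .
  qed
  let ?w = "\<lambda>r. C1 * Kc * (indicator {s<..<t} r * (1 / sqrt (t - r)))"
  have wi: "integrable lborel ?w"
  proof (rule integrable_mult_right, rule integrableI_bounded)
    have "(\<integral>\<^sup>+ r. ennreal (norm (indicator {s<..<t} r * (1 / sqrt (t - r)))) \<partial>lborel) = (\<integral>\<^sup>+ r. ennreal (indicator {s<..<t} r * (1 / sqrt (t - r))) \<partial>lborel)"
      by (intro nn_integral_cong) (simp add: indicator_def)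
    also have "\<dots> \<le> ennreal (2 * sqrt (t - s))" by (rule nn_integral_inverse_sqrt_right)
    also have "\<dots> < \<infinity>" by simp
    finally show "(\<integral>\<^sup>+ r. ennreal (norm (indicator {s<..<t} r * (1 / sqrt (t - r)))) \<partial>lborel) < \<infinity>" .
  qed measurable
  have wki: "integrable lborel (\<lambda>m. wt t m * k \<epsilon> m)" if e: "0 \<le> \<epsilon>" "\<epsilon> \<le> 1" for \<epsilon>
  proof (rule integrableI_bounded)
    have "(\<integral>\<^sup>+ m. ennreal (norm (wt t m * k \<epsilon> m)) \<partial>lborel) = (\<integral>\<^sup>+ r. \<integral>\<^sup>+ z. ennreal (norm (wt t (r, z) * k \<epsilon> (r, z))) \<partial>lborel \<partial>lborel)"
      by (rule nn_integral_lborel_iterated) measurable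
    also have "\<dots> \<le> (\<integral>\<^sup>+ r. ennreal (?w r) \<partial>lborel)"
    proof (rule nn_integral_mono)
      fix r show "(\<integral>\<^sup>+ z. ennreal (norm (wt t (r, z) * k \<epsilon> (r, z))) \<partial>lborel) \<le> ennreal (?w r)"
        using nnb[of r \<epsilon>] e by (cases "s < r \<and> r < t") (auto simp: wt_pair)
    qed
    also have "\<dots> < \<infinity>"
    proof -
      have "(\<integral>\<^sup>+ r. ennreal (?w r) \<partial>lborel) \<le> (\<integral>\<^sup>+ r. ennreal (norm (?w r)) \<partial>lborel)"
        by (intro nn_integral_mono ennreal_leI) (simp only: real_norm_def abs_ge_self)
      also have "\<dots> < \<infinity>" using wi unfolding integrable_iff_bounded by blast
      finally show ?thesis .
    qed
    finally show "(\<integral>\<^sup>+ m. ennreal (norm (wt t m * k \<epsilon> m)) \<partial>lborel) < \<infinity>" .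
  qed measurable
  show "integrable lborel (\<lambda>m. u m * K m (t, y))" unfolding uK by (rule wki) auto
  define \<epsilon> where "\<epsilon> n = inverse (real (Suc n))" for n
  have e: "0 < \<epsilon> n" "\<epsilon> n \<le> 1" for n by (auto simp: \<epsilon>_def inverse_le_1_iff)
  have e0: "\<epsilon> \<longlonglongrightarrow> 0" unfolding \<epsilon>_def by (rule LIMSEQ_inverse_real_of_nat)
  \<comment> \<open>The limit is taken in two stages. At fixed \<open>r < t\<close> the kernels are
    bounded uniformly in \<open>\<epsilon>\<close>, which allows the limit under the position
    integral; that bound degenerates as \<open>r\<close> tends to \<open>t\<close>, but the
    integrated quantity is dominated by \<open>?w\<close>.\<close>
  define I where "I \<epsilon> r = indicator {s<..<t} r * (\<integral> z. u (r, z) * k \<epsilon> (r, z) \<partial>lborel)" for \<epsilon> r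
  have Im: "I \<epsilon> \<in> borel_measurable lborel" for \<epsilon>
  proof -
    have "(\<lambda>p. u p * k \<epsilon> p) \<in> borel_measurable borel" by measurable
    from borel_measurable_pairI(1)[OF this]
    have "(\<lambda>r. \<integral> z. u (r, z) * k \<epsilon> (r, z) \<partial>lborel) \<in> borel_measurable borel"
      by (intro lborel.borel_measurable_lebesgue_integral) (simp add: case_prod_unfold)
    then show ?thesis unfolding I_def[abs_def] by simp
  qed
  have lim: "(\<lambda>n. \<integral> r. I (\<epsilon> n) r \<partial>lborel) \<longlonglongrightarrow> (\<integral> r. I 0 r \<partial>lborel)"
  proof (rule integral_dominated_convergence[where w = ?w])
    show "AE r in lborel. (\<lambda>n. I (\<epsilon> n) r) \<longlonglongrightarrow> I 0 r"
    proof (intro AE_I2)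
      fix r
      show "(\<lambda>n. I (\<epsilon> n) r) \<longlonglongrightarrow> I 0 r"
      proof (cases "s < r \<and> r < t")
        case True
        then have q: "0 < 4 * \<nu> * (t - r)" "4 * \<nu> * (t - r) \<le> 4 * \<nu> * (t + 1 - r)" using nu by auto
        obtain B where B: "B \<ge> 0" "\<And>q (x::real^'d). 4 * \<nu> * (t - r) \<le> q \<Longrightarrow> q \<le> 4 * \<nu> * (t + 1 - r) \<Longrightarrow> norm (dgau q x) \<le> B"
          using gau_bounds[OF q] by metis
        have kb: "\<bar>k (\<epsilon> n) (r, z)\<bar> \<le> M * B" for n z
        proof -
          have "\<bar>k (\<epsilon> n) (r, z)\<bar> \<le> norm (c (r, z)) * norm (dgau (4 * \<nu> * (t + \<epsilon> n - r)) (z - y))"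
            unfolding k_def fst_conv snd_conv by (rule Cauchy_Schwarz_ineq2)
          also have "\<dots> \<le> M * B" using True M_nonneg nu less_imp_le[OF e(1)[of n]] e(2)[of n]
            by (intro mult_mono c_bound B) (auto simp: mult_left_mono)
          finally show ?thesis .
        qed
        have "(\<lambda>n. \<integral> z. u (r, z) * k (\<epsilon> n) (r, z) \<partial>lborel) \<longlonglongrightarrow> (\<integral> z. u (r, z) * k 0 (r, z) \<partial>lborel)"
        proof (rule integral_dominated_convergence[where w = "\<lambda>z. u (r, z) * (M * B)"])
          show "integrable lborel (\<lambda>z. u (r, z) * (M * B))"
            using True t by (intro u_slice_integrable[where B = "\<bar>M * B\<bar>"]) auto
          show "AE z in lborel. norm (u (r, z) * k (\<epsilon> n) (r, z)) \<le> u (r, z) * (M * B)" for n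
            using kb by (intro AE_I2) (simp add: abs_mult u_nonneg mult_left_mono)
          show "AE z in lborel. (\<lambda>n. u (r, z) * k (\<epsilon> n) (r, z)) \<longlonglongrightarrow> u (r, z) * k 0 (r, z)"
          proof (intro AE_I2 tendsto_mult tendsto_const)
            fix z
            have ic: "isCont (\<lambda>q. c (r, z) \<bullet> dgau q (z - y)) (4 * \<nu> * (t + 0 - r))"
              using q by (intro DERIV_isCont[OF DERIV_dgau]) simp
            have "(\<lambda>n. 4 * \<nu> * (t + \<epsilon> n - r)) \<longlonglongrightarrow> 4 * \<nu> * (t + 0 - r)"
              by (intro tendsto_intros e0)
            from isCont_tendsto_compose[OF ic this]
            show "(\<lambda>n. k (\<epsilon> n) (r, z)) \<longlonglongrightarrow> k 0 (r, z)" by (simp add: k_def)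
          qed
        qed measurable
        then show ?thesis unfolding I_def by (intro tendsto_mult tendsto_const)
      next
        case False
        then show ?thesis by (auto simp: I_def indicator_def)
      qed
    qed
    show "AE r in lborel. norm (I (\<epsilon> n) r) \<le> ?w r" for n
    proof (intro AE_I2)
      fix r
      show "norm (I (\<epsilon> n) r) \<le> ?w r"
      proof (cases "s < r \<and> r < t")
        case True
        let ?h = "\<lambda>z. u (r, z) * k (\<epsilon> n) (r, z)"
        have b: "(\<integral>\<^sup>+ z. ennreal (norm (?h z)) \<partial>lborel) \<le> ennreal (C1 * Kc * (1 / sqrt (t - r)))"
          using True e by (intro nnb) (auto intro: less_imp_le)
        have hi: "integrable lborel ?h"
          by (rule integrableI_bounded) (measurable, rule le_less_trans[OF b], simp)
        have "ennreal (norm (\<integral> z. ?h z \<partial>lborel)) \<le> ennreal (C1 * Kc * (1 / sqrt (t - r)))"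
          by (rule order_trans[OF integral_norm_bound_ennreal[OF hi] b])
        then have "norm (\<integral> z. ?h z \<partial>lborel) \<le> C1 * Kc * (1 / sqrt (t - r))"
          using C_nonneg Kc True by (subst (asm) ennreal_le_iff) auto
        then show ?thesis using True by (simp add: I_def)
      qed (auto simp: I_def)
    qed
  qed (fact Im wi)+
  have Iint: "(\<integral> m. wt t m * k \<epsilon> m \<partial>lborel) = (\<integral> r. I \<epsilon> r \<partial>lborel)" if "0 \<le> \<epsilon>" "\<epsilon> \<le> 1" for \<epsilon>
    unfolding wt_integral[OF wki[OF that]] I_def ..
  have eqn: "(\<integral> z. u (t, z) * gau (4 * \<nu> * \<epsilon> n) (z - y) \<partial>lborel) = gau (4 * \<nu> * (t + \<epsilon> n - s)) (\<xi> - y) + (\<integral> r. I (\<epsilon> n) r \<partial>lborel)" for n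
    using u_mild_regularized[OF e(1) t, of n y] Iint[OF less_imp_le[OF e(1)] e(2), of n] by (simp add: k_def)
  have "(\<lambda>n. \<integral> z. u (t, z) * gau (4 * \<nu> * \<epsilon> n) (z - y) \<partial>lborel) \<longlonglongrightarrow> u (t, y)"
  proof (rule gau_approximate_identity)
    show "integrable lborel (\<lambda>z. u (t, z))"
      by (rule integrableI_bounded) (simp_all add: u_nonneg u_mass[OF t])
    have op: "open {m :: real \<times> (real^'d). s < fst m}"
      by (intro open_Collect_less continuous_intros)
    have "isCont u (t, y)" using u_cont op t continuous_on_eq_continuous_at by fastforce
    then show "isCont (\<lambda>z. u (t, z)) y"
      by (intro isCont_o2[where g = u and f = "\<lambda>z. (t, z)"] continuous_intros)
    show "4 * \<nu> * \<epsilon> n > 0" for n using nu e by simp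
    have "(\<lambda>n. 4 * \<nu> * \<epsilon> n) \<longlonglongrightarrow> 4 * \<nu> * 0" by (intro tendsto_intros e0)
    then show "(\<lambda>n. 4 * \<nu> * \<epsilon> n) \<longlonglongrightarrow> 0" by simp
  qed (simp_all add: u_nonneg)
  moreover have "(\<lambda>n. gau (4 * \<nu> * (t + \<epsilon> n - s)) (\<xi> - y) + (\<integral> r. I (\<epsilon> n) r \<partial>lborel)) \<longlonglongrightarrow> gau (4 * \<nu> * (t + 0 - s)) (\<xi> - y) + (\<integral> r. I 0 r \<partial>lborel)"
  proof (intro tendsto_add lim)
    have ic: "isCont (\<lambda>q. gau q (\<xi> - y)) (4 * \<nu> * (t + 0 - s))"
      using nu t by (intro DERIV_isCont[OF DERIV_gau]) simp
    have "(\<lambda>n. 4 * \<nu> * (t + \<epsilon> n - s)) \<longlonglongrightarrow> 4 * \<nu> * (t + 0 - s)"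
      by (intro tendsto_intros e0)
    from isCont_tendsto_compose[OF ic this]
    show "(\<lambda>n. gau (4 * \<nu> * (t + \<epsilon> n - s)) (\<xi> - y)) \<longlonglongrightarrow> gau (4 * \<nu> * (t + 0 - s)) (\<xi> - y)" .
  qed
  ultimately have "u (t, y) = gau (4 * \<nu> * (t + 0 - s)) (\<xi> - y) + (\<integral> r. I 0 r \<partial>lborel)"
    unfolding eqn by (rule LIMSEQ_unique)
  then show "u (t, y) = G (s, \<xi>) (t, y) + (\<integral> m. u m * K m (t, y) \<partial>lborel)"
    using t s0 unfolding uK Iint[OF order_refl zero_le_one] by (simp add: GK_def kreg_def)
qed

lemma u_series:
  obtains \<Lambda> where "\<And>n t. s < t \<Longrightarrow> t \<le> T \<Longrightarrow>
    (\<integral>\<^sup>+ y. ennreal \<bar>u (t, y) - (\<Sum>k<n. MM \<nu> T c k (s, \<xi>) (t, y))\<bar> \<partial>lborel) \<le> ennreal (\<Lambda> / 2 ^ n)"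
proof (rule mild_solution_series[OF s0 u_meas, of \<xi>])
  show "\<And>t y. t \<le> s \<Longrightarrow> u (t, y) = 0" by (rule u_zero)
  show "\<And>t. s < t \<Longrightarrow> t \<le> T \<Longrightarrow> (\<integral>\<^sup>+ y. ennreal \<bar>u (t, y)\<bar> \<partial>lborel) \<le> 1"
    by (simp add: u_nonneg u_mass)
qed (use u_mild that in blast)+

end

section \<open>Time reversal\<close>

subsection \<open>Duality of transition densities\<close>

text \<open>\<open>bounded_field\<close> and \<open>borel_field\<close> say nothing about negative
  times. Extension by 0 outside \<open>[0, T]\<close> gives a bounded field that is Borel
  everywhere, with a time support invariant under \<open>trev T\<close>. Time and position change
  places to match the kernels.\<close>

lemma drift_extension:
  fixes b :: "real^'d::finite \<Rightarrow> real \<Rightarrow> real^'d"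
  assumes "\<nu> > 0" "T > 0" "bounded_field b" "borel_field b"
  obtains M where "drift \<nu> T M (\<lambda>a. if 0 \<le> fst a \<and> fst a \<le> T then b (snd a) (fst a) else 0)"
proof -
  obtain M where M: "\<And>x t. 0 \<le> t \<Longrightarrow> norm (b x t) \<le> M"
    using assms(3) unfolding bounded_field_def by blast
  have M0: "M \<ge> 0" using M[of 0 undefined] norm_ge_zero order_trans by blast
  let ?D = "UNIV \<times> {0..} :: ((real^'d) \<times> real) set"
  have "closed ?D" by (intro closed_Times closed_UNIV closed_atLeast)
  then have "?D \<inter> space borel \<in> sets borel" by (simp add: borel_closed)
  then have m: "(\<lambda>z. indicator ?D z *\<^sub>R b (fst z) (snd z)) \<in> borel_measurable borel"
    using assms(4) unfolding borel_field_def by (simp add: borel_measurable_restrict_space_iff)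
  have sw: "(\<lambda>a :: real \<times> (real^'d). (snd a, fst a)) \<in> borel_measurable borel"
    by (intro borel_measurable_Pair fst_snd_borel_measurable)
  have "(\<lambda>a. indicator ?D (snd a, fst a) *\<^sub>R b (snd a) (fst a)) \<in> borel_measurable borel"
    using measurable_compose[OF sw m] by (simp only: fst_conv snd_conv)
  then have "(\<lambda>a. indicator {0..T} (fst a) *\<^sub>R (indicator ?D (snd a, fst a) *\<^sub>R b (snd a) (fst a))) \<in> borel_measurable borel"
    by (rule borel_measurable_scaleR[OF borel_measurable_indicator_fst, rotated]) simp
  moreover have "(\<lambda>a. indicator {0..T} (fst a) *\<^sub>R (indicator ?D (snd a, fst a) *\<^sub>R b (snd a) (fst a)))
     = (\<lambda>a. if 0 \<le> fst a \<and> fst a \<le> T then b (snd a) (fst a) else 0)"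
    by (auto simp: indicator_def fun_eq_iff)
  ultimately have cm: "(\<lambda>a. if 0 \<le> fst a \<and> fst a \<le> T then b (snd a) (fst a) else 0) \<in> borel_measurable borel"
    by (simp only:)
  show ?thesis
  proof (rule that, rule drift.intro)
    show "norm (if 0 \<le> fst a \<and> fst a \<le> T then b (snd a) (fst a) else 0) \<le> M" for a
      using M M0 by simp
  qed (fact assms(1,2) cm)+
qed

text \<open>The weak equation is integrated over \<open>(s, t)\<close> with
  \<open>t \<le> T\<close>, so any \<open>c\<close> that agrees with \<open>f\<close> on
  \<open>[0, T]\<close> may stand for it.\<close>

lemma trans_density_fokker_planck:
  fixes f :: "real^'d::finite \<Rightarrow> real \<Rightarrow> real^'d"
  assumes d: "drift \<nu> T M c" and p: "trans_density \<nu> f p"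
    and c: "\<And>r x. 0 \<le> r \<Longrightarrow> r \<le> T \<Longrightarrow> c (r, x) = f x r" and s: "0 \<le> s"
  shows "fokker_planck \<nu> T M c s \<xi> (\<lambda>m. if s < fst m then p s \<xi> (fst m) (snd m) else 0)"
proof -
  interpret drift \<nu> T M c by fact
  let ?u = "\<lambda>m. if s < fst m then p s \<xi> (fst m) (snd m) else 0"
  let ?S = "{m :: real \<times> (real^'d). s < fst m}"
  have "open ?S" by (intro open_Collect_less continuous_intros)
  then have S: "?S \<in> sets borel" by simp
  have pc: "continuous_on {(\<tau>, \<xi>, t, x). 0 \<le> \<tau> \<and> \<tau> < t} (\<lambda>(\<tau>, \<xi>, t, x). p \<tau> \<xi> t x)"
    using p unfolding trans_density_def by blast
  have "continuous_on ?S (\<lambda>m. case (s, \<xi>, fst m, snd m) of (\<tau>, \<xi>, t, x) \<Rightarrow> p \<tau> \<xi> t x)"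
    by (rule continuous_on_compose2[OF pc]) (use s in \<open>auto intro!: continuous_intros\<close>)
  then have pS: "continuous_on ?S (\<lambda>m. p s \<xi> (fst m) (snd m))" by (simp add: case_prod_unfold)
  show ?thesis
  proof (unfold_locales)
    show "0 \<le> s" by (rule s)
    have "(\<lambda>m. if m \<in> ?S then p s \<xi> (fst m) (snd m) else 0) \<in> borel_measurable borel"
      by (rule borel_measurable_continuous_on_if[OF S pS]) simp
    then show "?u \<in> borel_measurable borel" by simp
    show "continuous_on {m. s < fst m} ?u"
      by (rule continuous_on_eq[OF pS]) simp
    show "0 \<le> ?u m" for m
      using p s unfolding trans_density_def by (auto intro: less_imp_le)
    show "?u (t, y) = 0" if "t \<le> s" for t y using that by simp
    show "(\<integral>\<^sup>+ y. ennreal (?u (t, y)) \<partial>lborel) = 1" if "s < t" "t \<le> T" for t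
      using p s that unfolding trans_density_def by simp
    fix t :: real and g :: "real^'d \<Rightarrow> real" assume t: "s < t" "t \<le> T" and g: "test_fun g"
    have "(\<integral> x. ?u (t, x) * g x \<partial>lborel) = (\<integral> x. p s \<xi> t x * g x \<partial>lborel)" using t by simp
    also have "\<dots> = g \<xi> + (LBINT r=s..t. (\<integral> x. p s \<xi> r x * gen \<nu> f g r x \<partial>lborel))"
      using p s t g unfolding trans_density_def by blast
    also have "(LBINT r=s..t. (\<integral> x. p s \<xi> r x * gen \<nu> f g r x \<partial>lborel)) =
       (\<integral> r. indicator {s<..<t} r * (\<integral> x. p s \<xi> r x * gen \<nu> f g r x \<partial>lborel) \<partial>lborel)"
      using t by (simp add: interval_lebesgue_integral_def set_lebesgue_integral_def)
    also have "\<dots> = (\<integral> r. indicator {s<..<t} r * (\<integral> x. ?u (r, x) * (\<nu> * laplacian g x + c (r, x) \<bullet> grad g x) \<partial>lborel) \<partial>lborel)"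
    proof (rule Bochner_Integration.integral_cong[OF refl])
      fix r
      show "indicator {s<..<t} r * (\<integral> x. p s \<xi> r x * gen \<nu> f g r x \<partial>lborel) =
        indicator {s<..<t} r * (\<integral> x. ?u (r, x) * (\<nu> * laplacian g x + c (r, x) \<bullet> grad g x) \<partial>lborel)"
      proof (cases "s < r \<and> r < t")
        case True
        then have "c (r, x) = f x r" for x using s t by (intro c) auto
        then show ?thesis using True by (simp add: gen_def)
      qed simp
    qed
    finally show "(\<integral> x. ?u (t, x) * g x \<partial>lborel) = g \<xi> + (\<integral> r. indicator {s<..<t} r * (\<integral> x. ?u (r, x) * (\<nu> * laplacian g x + c (r, x) \<bullet> grad g x) \<partial>lborel) \<partial>lborel)" .
  qed
qed

text \<open>Geometric decay of the \<open>L1\<close> errors makes their sum integrable, hence finite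
  almost everywhere, which forces convergence of the whole sequence. Phrased as finiteness of a
  measurable function, the conclusion fits the later exchange of almost-everywhere
  quantifiers.\<close>

lemma AE_suminf_finite:
  fixes g :: "nat \<Rightarrow> 'a \<Rightarrow> real"
  assumes [measurable]: "\<And>n. g n \<in> borel_measurable N"
    and b: "\<And>n. (\<integral>\<^sup>+ x. ennreal \<bar>g n x\<bar> \<partial>N) \<le> ennreal (\<Lambda> / 2 ^ n)"
  shows "AE x in N. (\<Sum>n. ennreal \<bar>g n x\<bar>) \<noteq> \<top>"
proof -
  \<comment> \<open>The sign of \<open>\<Lambda>\<close> is not known, hence the absolute
    value.\<close>
  have s: "summable (\<lambda>n. \<bar>\<Lambda>\<bar> / 2 ^ n)"
  proof -
    have "summable (\<lambda>n. \<bar>\<Lambda>\<bar> * (1 / 2 :: real) ^ n)" by (intro summable_mult summable_geometric) simp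
    moreover have "\<bar>\<Lambda>\<bar> * (1 / 2 :: real) ^ n = \<bar>\<Lambda>\<bar> / 2 ^ n" for n by (simp add: power_divide)
    ultimately show ?thesis by (simp only:)
  qed
  have "(\<integral>\<^sup>+ x. (\<Sum>n. ennreal \<bar>g n x\<bar>) \<partial>N) = (\<Sum>n. \<integral>\<^sup>+ x. ennreal \<bar>g n x\<bar> \<partial>N)"
    by (rule nn_integral_suminf) measurable
  also have "\<dots> \<le> (\<Sum>n. ennreal (\<bar>\<Lambda>\<bar> / 2 ^ n))"
    by (intro suminf_le order_trans[OF b] ennreal_leI divide_right_mono) auto
  also have "\<dots> < \<top>"
    unfolding less_top[symmetric] by (rule ennreal_suminf_neq_top[OF s]) simp
  finally have "(\<integral>\<^sup>+ x. (\<Sum>n. ennreal \<bar>g n x\<bar>) \<partial>N) \<noteq> \<infinity>" by simp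
  moreover have "(\<lambda>x. \<Sum>n. ennreal \<bar>g n x\<bar>) \<in> borel_measurable N" by measurable
  ultimately show ?thesis using nn_integral_PInf_AE unfolding infinity_ennreal_def by blast
qed

lemma suminf_finite_tendsto:
  assumes "(\<Sum>n. ennreal \<bar>p - S n\<bar>) \<noteq> \<top>" shows "S \<longlonglongrightarrow> (p::real)"
proof -
  have "summable (\<lambda>n. \<bar>p - S n\<bar>)" using assms by (intro summable_suminf_not_top) auto
  from summable_LIMSEQ_zero[OF this] have "(\<lambda>n. p - S n) \<longlonglongrightarrow> 0" by (simp add: tendsto_rabs_zero_iff)
  from tendsto_diff[OF tendsto_const[of p] this] show ?thesis by simp
qed

text \<open>The set of disagreement is open and null, hence empty.\<close>

lemma continuous_AE_eq:
  fixes f g :: "'a::euclidean_space \<Rightarrow> real"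
  assumes f: "continuous_on UNIV f" and g: "continuous_on UNIV g" and ae: "AE x in lborel. f x = g x"
  shows "f x = g x"
proof -
  have op: "open {x. f x \<noteq> g x}" by (intro open_Collect_neq f g)
  have "{x. f x \<noteq> g x} \<in> null_sets lborel"
    using ae op by (subst AE_iff_null_sets) auto
  then have "negligible {x. f x \<noteq> g x}"
    by (simp add: negligible_iff_null_sets null_sets_completionI)
  with open_not_negligible[OF op] have "{x. f x \<noteq> g x} = {}" by blast
  then show ?thesis by blast
qed

lemma trans_density_continuous_space:
  assumes "trans_density \<nu> f p" "0 \<le> s" "s < t"
  shows "continuous_on UNIV (\<lambda>z. p s (fst z) t (snd z))"
proof -
  have "continuous_on {(\<tau>, \<xi>, t, x). 0 \<le> \<tau> \<and> \<tau> < t} (\<lambda>(\<tau>, \<xi>, t, x). p \<tau> \<xi> t x)"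
    using assms unfolding trans_density_def by blast
  then have "continuous_on UNIV (\<lambda>z. case (s, fst z, t, snd z) of (\<tau>, \<xi>, t, x) \<Rightarrow> p \<tau> \<xi> t x)"
    by (rule continuous_on_compose2) (use assms in \<open>auto intro!: continuous_intros\<close>)
  then show ?thesis by simp
qed

text \<open>Both densities are limits of the same partial sums \<open>S\<close>: the series of
  \<open>c\<close> started at \<open>(s, x)\<close> and, through \<open>MM_time_reversal\<close>,
  the series of the reversed drift started at \<open>(T - t, y)\<close>.\<close>

lemma trans_density_duality:
  fixes b bT :: "real^'d::finite \<Rightarrow> real \<Rightarrow> real^'d"
  assumes nu: "\<nu> > 0" and T: "T > 0" and b: "bounded_field b" "borel_field b" "div_free b"
    and bT: "\<And>x t. 0 \<le> t \<Longrightarrow> t \<le> T \<Longrightarrow> bT x t = b x (T - t)"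
    and p: "trans_density \<nu> b p" and pT: "trans_density \<nu> (\<lambda>x t. - bT x t) pT"
    and st: "0 \<le> s" "s < t" "t \<le> T"
  shows "p s x t y = pT (T - t) y (T - s) x"
proof -
  define c where "c = (\<lambda>a :: real \<times> (real^'d). if 0 \<le> fst a \<and> fst a \<le> T then b (snd a) (fst a) else 0)"
  \<comment> \<open>Reversing the extended field, instead of extending \<open>- bT\<close>, makes
    the relation of \<open>MM_time_reversal\<close> hold at every space-time point; on
    \<open>[0, T]\<close> it is \<open>- bT\<close>.\<close>
  define c' where "c' = (\<lambda>a. - c (trev T a))"
  obtain M where d: "drift \<nu> T M c"
    using drift_extension[OF nu T b(1,2)] unfolding c_def by blast
  interpret c: drift \<nu> T M c by fact
  have d': "drift \<nu> T M c'"
  proof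
    have "(trev T :: real \<times> (real^'d) \<Rightarrow> _) \<in> borel_measurable borel" unfolding trev_def
      by (intro borel_measurable_Pair borel_measurable_diff borel_measurable_const fst_snd_borel_measurable)
    from measurable_compose[OF this c.c_meas] show "c' \<in> borel_measurable borel"
      unfolding c'_def by (rule borel_measurable_uminus)
    show "norm (c' a) \<le> M" for a by (simp add: c'_def c.c_bound)
  qed (fact nu T)+
  have cb: "c (r, x) = b x r" if "0 \<le> r" "r \<le> T" for r x using that by (simp add: c_def)
  have c'b: "c' (r, x) = - bT x r" if "0 \<le> r" "r \<le> T" for r x
    using that by (simp add: c'_def c_def trev_def bT)
  have left: "MM \<nu> T c (Suc n) = kcomp (LL \<nu> T c) (MM \<nu> T c n)" for n
  proof (rule c.MM_Suc_left)
    fix r x y \<alpha> \<gamma> assume r: "0 \<le> r" "r \<le> T" and pos: "(\<alpha>::real) > 0" "(\<gamma>::real) > 0"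
    show "(\<integral> z. c (r, z) \<bullet> (gau \<alpha> (x - z) *\<^sub>R dgau \<gamma> (z - y) + gau \<gamma> (z - y) *\<^sub>R dgau \<alpha> (z - x)) \<partial>lborel) = 0"
    proof (rule divergence_free_gau[OF _ _ _ pos])
      show "(\<lambda>z. c (r, z)) \<in> borel_measurable borel"
        by (rule measurable_compose[OF _ c.c_meas]) measurable
      show "norm (c (r, x)) \<le> M" for x by (rule c.c_bound)
      show "(\<integral> x. c (r, x) \<bullet> grad \<phi> x \<partial>lborel) = 0" if "test_fun \<phi>" for \<phi>
        using b(3) r that unfolding div_free_def by (simp add: cb)
    qed
  qed
  have sym: "MM \<nu> T c' k (T - t, y) (T - s, x) = MM \<nu> T c k (s, x) (t, y)" for k x y
    using MM_time_reversal[OF d d' _ left, of k "(t, y)" "(s, x)"]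
    by (simp add: c'_def trev_def)
  define S where "S n x y = (\<Sum>k<n. MM \<nu> T c k (s, x) (t, y))" for n x y
  have Sm: "(\<lambda>z. S n (fst z) (snd z)) \<in> borel_measurable borel" for n
    unfolding S_def
    by (intro borel_measurable_sum kmeas_compose[OF c.kmeas_MM] borel_measurable_Pair borel_measurable_const fst_snd_borel_measurable)
  have pm: "(\<lambda>z. p s (fst z) t (snd z)) \<in> borel_measurable borel"
    by (intro borel_measurable_continuous_onI trans_density_continuous_space[OF p] st)
  have qc: "continuous_on UNIV (\<lambda>z. pT (T - t) (fst z) (T - s) (snd z))"
    by (rule trans_density_continuous_space[OF pT]) (use st in auto)
  have slice1: "(\<lambda>y. F (x, y)) \<in> borel_measurable borel" and slice2: "(\<lambda>x. F (x, y)) \<in> borel_measurable borel"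
    if "F \<in> borel_measurable borel" for F :: "(real^'d) \<times> (real^'d) \<Rightarrow> real" and x y
    by (rule measurable_compose[OF _ that], measurable)+
  have qm: "(\<lambda>z. pT (T - t) (snd z) (T - s) (fst z)) \<in> borel_measurable borel"
    by (intro borel_measurable_continuous_onI continuous_on_compose2[OF qc, of UNIV "\<lambda>z. (snd z, fst z)", simplified] continuous_intros)
  have P: "AE y in lborel. (\<Sum>n. ennreal \<bar>p s x t y - S n x y\<bar>) \<noteq> \<top>" for x
  proof -
    interpret fp: fokker_planck \<nu> T M c s x "\<lambda>m. if s < fst m then p s x (fst m) (snd m) else 0"
      by (rule trans_density_fokker_planck[OF d p cb st(1)])
    obtain \<Lambda> where "\<And>n t. s < t \<Longrightarrow> t \<le> T \<Longrightarrow>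
      (\<integral>\<^sup>+ y. ennreal \<bar>(if s < fst (t, y) then p s x (fst (t, y)) (snd (t, y)) else 0) - (\<Sum>k<n. MM \<nu> T c k (s, x) (t, y))\<bar> \<partial>lborel) \<le> ennreal (\<Lambda> / 2 ^ n)"
      using fp.u_series by blast
    from this[OF st(2,3)] have "(\<integral>\<^sup>+ y. ennreal \<bar>p s x t y - S n x y\<bar> \<partial>lborel) \<le> ennreal (\<Lambda> / 2 ^ n)" for n
      using st by (simp add: S_def)
    moreover have "(\<lambda>y. p s x t y - S n x y) \<in> borel_measurable lborel" for n
      using slice1[OF pm, of x] slice1[OF Sm, of n x] by simp
    ultimately show ?thesis by (intro AE_suminf_finite)
  qed
  have Q: "AE x in lborel. (\<Sum>n. ennreal \<bar>pT (T - t) y (T - s) x - S n x y\<bar>) \<noteq> \<top>" for y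
  proof -
    have st': "0 \<le> T - t" "T - t < T - s" "T - s \<le> T" using st by auto
    interpret fp: fokker_planck \<nu> T M c' "T - t" y "\<lambda>m. if T - t < fst m then pT (T - t) y (fst m) (snd m) else 0"
      by (rule trans_density_fokker_planck[OF d' pT c'b st'(1)])
    obtain \<Lambda> where "\<And>n r. T - t < r \<Longrightarrow> r \<le> T \<Longrightarrow>
      (\<integral>\<^sup>+ x. ennreal \<bar>(if T - t < fst (r, x) then pT (T - t) y (fst (r, x)) (snd (r, x)) else 0) - (\<Sum>k<n. MM \<nu> T c' k (T - t, y) (r, x))\<bar> \<partial>lborel) \<le> ennreal (\<Lambda> / 2 ^ n)"
      using fp.u_series by blast
    from this[OF st'(2,3)] have "(\<integral>\<^sup>+ x. ennreal \<bar>pT (T - t) y (T - s) x - S n x y\<bar> \<partial>lborel) \<le> ennreal (\<Lambda> / 2 ^ n)" for n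
      using st' by (simp add: S_def sym)
    moreover have "(\<lambda>x. pT (T - t) y (T - s) x - S n x y) \<in> borel_measurable lborel" for n
      using slice2[OF qm, of y] slice2[OF Sm, of n y] by simp
    ultimately show ?thesis by (intro AE_suminf_finite)
  qed
  \<comment> \<open>\<open>Q\<close> holds for almost every \<open>x\<close> at each
    \<open>y\<close>, while \<open>P\<close> holds for almost every \<open>y\<close> at each
    \<open>x\<close>; joint measurability lets the quantifiers be exchanged so that both can be used
    together.\<close>
  have "AE x in lborel. AE y in lborel. (\<Sum>n. ennreal \<bar>pT (T - t) y (T - s) x - S n x y\<bar>) \<noteq> \<top>"
  proof (subst lborel_pair.AE_commute)
    have "(\<lambda>z. \<Sum>n. ennreal \<bar>pT (T - t) (snd z) (T - s) (fst z) - S n (fst z) (snd z)\<bar>) \<in> borel_measurable borel"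
      by (intro borel_measurable_suminf_order measurable_compose[OF _ measurable_ennreal] borel_measurable_abs borel_measurable_diff qm Sm)
    from borel_measurable_pairI(2)[OF this]
    show "{z \<in> space (lborel \<Otimes>\<^sub>M lborel). (\<Sum>n. ennreal \<bar>pT (T - t) (snd z) (T - s) (fst z) - S n (fst z) (snd z)\<bar>) \<noteq> \<top>} \<in> sets (lborel \<Otimes>\<^sub>M lborel)"
      by measurable
    show "AE y in lborel. AE x in lborel. (\<Sum>n. ennreal \<bar>pT (T - t) y (T - s) x - S n x y\<bar>) \<noteq> \<top>"
      using Q by simp
  qed
  \<comment> \<open>For almost every \<open>x\<close> the equality holds for almost every
    \<open>y\<close>, hence by continuity for every \<open>y\<close>; the same argument in
    \<open>x\<close> finishes.\<close>
  then have "AE x in lborel. p s x t y = pT (T - t) y (T - s) x"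
  proof eventually_elim
    case (elim x)
    have "AE y in lborel. p s x t y = pT (T - t) y (T - s) x"
      using elim P[of x]
    proof eventually_elim
      case (elim y)
      show ?case
        by (rule LIMSEQ_unique[OF suminf_finite_tendsto[OF elim(2)] suminf_finite_tendsto[OF elim(1)]])
    qed
    moreover have "continuous_on UNIV (\<lambda>y. p s x t y)"
      using continuous_on_compose2[OF trans_density_continuous_space[OF p st(1,2)], of UNIV "\<lambda>y. (x, y)"] by (simp add: continuous_on_Pair continuous_on_id continuous_on_const)
    moreover have "continuous_on UNIV (\<lambda>y. pT (T - t) y (T - s) x)"
      using continuous_on_compose2[OF qc, of UNIV "\<lambda>y. (y, x)"] by (simp add: continuous_on_Pair continuous_on_id continuous_on_const)
    ultimately show ?case by (rule continuous_AE_eq[rotated 2])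
  qed
  moreover have "continuous_on UNIV (\<lambda>x. p s x t y)"
    using continuous_on_compose2[OF trans_density_continuous_space[OF p st(1,2)], of UNIV "\<lambda>x. (x, y)"] by (simp add: continuous_on_Pair continuous_on_id continuous_on_const)
  moreover have "continuous_on UNIV (\<lambda>x. pT (T - t) y (T - s) x)"
    using continuous_on_compose2[OF qc, of UNIV "\<lambda>x. (y, x)"] by (simp add: continuous_on_Pair continuous_on_id continuous_on_const)
  ultimately show ?thesis by (rule continuous_AE_eq[rotated 2])
qed

subsection \<open>Finite-dimensional distributions of bridges\<close>

text \<open>The side conditions on the partition in \<open>is_bridge\<close>, packed so that the
  finite-dimensional laws can be quoted under one hypothesis. All times are interior.\<close>

definition grid :: "real \<Rightarrow> nat \<Rightarrow> (nat \<Rightarrow> real) \<Rightarrow> bool" where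
  "grid T n t \<longleftrightarrow> 0 < n \<and> 0 < t 0 \<and> (\<forall>k. Suc k < n \<longrightarrow> t k < t (Suc k)) \<and> t (n - 1) < T"

lemma grid_mono:
  assumes "grid T n t" "i < j" "j < n" shows "t i < t j"
  using assms(2,3)
proof (induction j)
  case (Suc j)
  then have "t j < t (Suc j)" using assms(1) by (auto simp: grid_def)
  then show ?case using Suc by (cases "i = j") auto
qed simp

lemma grid_bounds:
  assumes "grid T n t" "k < n" shows "0 < t k" "t k < T"
proof -
  show "0 < t k" using assms grid_mono[OF assms(1), of 0 k] by (cases k) (auto simp: grid_def)
  show "t k < T"
  proof (cases "k = n - 1")
    case False
    then have "t k < t (n - 1)" using assms(2) by (intro grid_mono[OF assms(1)]) auto
    then show ?thesis using assms(1) by (simp add: grid_def)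
  qed (use assms(1) in \<open>simp add: grid_def\<close>)
qed

lemma grid_rev:
  assumes g: "grid T n t" shows "grid T n (\<lambda>k. T - t (n - 1 - k))"
  unfolding grid_def
proof (intro conjI allI impI)
  show "0 < n" using g by (simp add: grid_def)
  then show "0 < T - t (n - 1 - 0)" "T - t (n - 1 - (n - 1)) < T" using g by (simp_all add: grid_def)
  fix k assume k: "Suc k < n"
  then show "T - t (n - 1 - k) < T - t (n - 1 - Suc k)"
    using grid_mono[OF g, of "n - 1 - Suc k" "n - 1 - k"] by auto
qed

text \<open>Neighbouring factors share \<open>p (t k) (x k) T \<eta>\<close>, once as numerator and
  once as denominator, and positivity lets it cancel. In the resulting form the two end points enter
  symmetrically.\<close>

lemma bridge_density_telescope:
  assumes p: "trans_density \<nu> f p" and g: "grid T n t"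
  shows "bridge_density p 0 \<xi> T \<eta> n t x =
    p 0 \<xi> (t 0) (x 0) * (\<Prod>k<n - 1. p (t k) (x k) (t (Suc k)) (x (Suc k))) * p (t (n - 1)) (x (n - 1)) T \<eta> / p 0 \<xi> T \<eta>"
proof -
  have nz: "p (t k) (x k) T \<eta> \<noteq> 0" if "k < n" for k
  proof -
    have "0 < p (t k) (x k) T \<eta>"
      using p grid_bounds[OF g that] unfolding trans_density_def by (auto intro: less_imp_le)
    then show ?thesis by simp
  qed
  have *: "m < n \<Longrightarrow> (\<Prod>k<m. bridge_q p T \<eta> (t k) (x k) (t (Suc k)) (x (Suc k))) =
    (\<Prod>k<m. p (t k) (x k) (t (Suc k)) (x (Suc k))) * p (t m) (x m) T \<eta> / p (t 0) (x 0) T \<eta>" for m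
  proof (induction m)
    case 0
    then show ?case using nz[of 0] by simp
  next
    case (Suc m)
    then show ?case using nz[of m] by (simp add: bridge_q_def)
  qed
  have "0 < n" using g by (simp add: grid_def)
  then show ?thesis unfolding bridge_density_def using *[of "n - 1"] nz[of 0]
    by (simp add: bridge_q_def)
qed

text \<open>Duality acts factor by factor on the telescoped form: the first and last factors
  exchange roles, the normalisation is preserved, and the inner product is traversed
  backwards.\<close>

lemma bridge_density_reversal:
  assumes dual: "\<And>s t x y. 0 \<le> s \<Longrightarrow> s < t \<Longrightarrow> t \<le> T \<Longrightarrow> p s x t y = pT (T - t) y (T - s) x"
    and p: "trans_density \<nu> f p" and pT: "trans_density \<nu> f' pT" and g: "grid T n t"
  shows "bridge_density pT 0 \<eta> T \<xi> n (\<lambda>k. T - t (n - 1 - k)) (\<lambda>k. x (n - 1 - k)) = bridge_density p 0 \<xi> T \<eta> n t x"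
proof -
  have n: "0 < n" using g by (simp add: grid_def)
  note gb = grid_bounds[OF g]
  have "T > 0" using gb(1)[OF n] gb(2)[OF n] by linarith
  have "(\<Prod>k<n - 1. pT (T - t (n - 1 - k)) (x (n - 1 - k)) (T - t (n - 1 - Suc k)) (x (n - 1 - Suc k)))
    = (\<Prod>k<n - 1. p (t (n - 1 - Suc k)) (x (n - 1 - Suc k)) (t (Suc (n - 1 - Suc k))) (x (Suc (n - 1 - Suc k))))"
  proof (rule prod.cong[OF refl])
    fix k assume "k \<in> {..<n - 1}"
    \<comment> \<open>Subtraction of naturals is truncated; these index identities rest on
      \<open>k < n - 1\<close>.\<close>
    then have k: "Suc (n - 1 - Suc k) = n - 1 - k" "n - 1 - Suc k < n - 1 - k" "n - 1 - k < n" by auto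
    show "pT (T - t (n - 1 - k)) (x (n - 1 - k)) (T - t (n - 1 - Suc k)) (x (n - 1 - Suc k)) =
       p (t (n - 1 - Suc k)) (x (n - 1 - Suc k)) (t (Suc (n - 1 - Suc k))) (x (Suc (n - 1 - Suc k)))"
      unfolding k(1) using grid_mono[OF g k(2,3)] gb[OF k(3)] gb(1)[of "n - 1 - Suc k"] k
      by (subst dual) auto
  qed
  also have "\<dots> = (\<Prod>k<n - 1. p (t k) (x k) (t (Suc k)) (x (Suc k)))"
    by (rule prod.nat_diff_reindex)
  finally have 1: "(\<Prod>k<n - 1. pT (T - t (n - 1 - k)) (x (n - 1 - k)) (T - t (n - 1 - Suc k)) (x (n - 1 - Suc k)))
    = (\<Prod>k<n - 1. p (t k) (x k) (t (Suc k)) (x (Suc k)))" .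
  have 2: "pT 0 \<eta> (T - t (n - 1)) (x (n - 1)) = p (t (n - 1)) (x (n - 1)) T \<eta>"
    using dual[of "t (n - 1)" T "x (n - 1)" \<eta>] gb[of "n - 1"] n by simp
  have 3: "pT (T - t 0) (x 0) T \<xi> = p 0 \<xi> (t 0) (x 0)"
    using dual[of 0 "t 0" \<xi> "x 0"] gb[of 0] n by simp
  have 4: "pT 0 \<eta> T \<xi> = p 0 \<xi> T \<eta>"
    using dual[of 0 T \<xi> \<eta>] \<open>T > 0\<close> by simp
  show ?thesis
    unfolding bridge_density_telescope[OF p g] bridge_density_telescope[OF pT grid_rev[OF g]] 1
    using 2 3 4 by simp
qed

lemma bridge_density_measurable:
  fixes p :: "real \<Rightarrow> real^'d::finite \<Rightarrow> real \<Rightarrow> real^'d \<Rightarrow> real"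
  assumes p: "trans_density \<nu> f p" and g: "grid T n t"
  shows "(\<lambda>x. bridge_density p 0 \<xi> T \<eta> n t x) \<in> borel_measurable (PiM {..<n} (\<lambda>_. lborel))"
proof -
  have n: "0 < n" using g by (simp add: grid_def)
  note gb = grid_bounds[OF g]
  have co: "(\<lambda>x. x k) \<in> borel_measurable (PiM {..<n} (\<lambda>_. lborel :: (real^'d) measure))" if "k < n" for k
    using measurable_component_singleton[of k "{..<n}" "\<lambda>_. lborel :: (real^'d) measure"] that by simp
  have pp: "(\<lambda>x. p r (F x) q (H x)) \<in> borel_measurable N" if "0 \<le> r" "r < q" "F \<in> borel_measurable N" "H \<in> borel_measurable N"
    for r q F H and N :: "'z measure"
    using measurable_compose[OF borel_measurable_Pair[OF that(3,4)] borel_measurable_continuous_onI[OF trans_density_continuous_space[OF p that(1,2)]]]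
    by simp
  show ?thesis unfolding bridge_density_telescope[OF p g]
  proof (intro borel_measurable_divide borel_measurable_times borel_measurable_prod pp co borel_measurable_const)
    fix k assume "k \<in> {..<n - 1}"
    then have "Suc k < n" by auto
    then show "0 \<le> t k" "t k < t (Suc k)" "k < n" "Suc k < n" using gb[of k] g by (auto simp: grid_def intro: less_imp_le)
  qed (use n gb[of 0] gb[of "n - 1"] in auto)
qed

section \<open>Reversing the order of the sample points\<close>

definition rev_coord :: "nat \<Rightarrow> (nat \<Rightarrow> 'a) \<Rightarrow> nat \<Rightarrow> 'a" where
  "rev_coord n x = (\<lambda>k\<in>{..<n}. x (n - 1 - k))"

lemma rev_coord_measurable:
  "rev_coord n \<in> measurable (PiM {..<n} (\<lambda>_. N)) (PiM {..<n} (\<lambda>_. N))"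
  unfolding rev_coord_def by (rule measurable_restrict) (auto intro!: measurable_component_singleton)

text \<open>A product of identical factors is invariant under permutations of the coordinates, and
  rectangles determine the product measure.\<close>

lemma distr_rev_coord:
  "distr (PiM {..<n} (\<lambda>_. lborel)) (PiM {..<n} (\<lambda>_. lborel)) (rev_coord n) = PiM {..<n} (\<lambda>_. lborel :: 'a::euclidean_space measure)"
proof -
  interpret product_sigma_finite "\<lambda>_::nat. lborel :: 'a measure" by unfold_locales
  show ?thesis
  proof (rule PiM_eqI)
    fix A :: "nat \<Rightarrow> 'a set" assume A: "\<And>i. i \<in> {..<n} \<Longrightarrow> A i \<in> sets lborel"
    let ?N = "PiM {..<n} (\<lambda>_. lborel :: 'a measure)"
    have pre: "rev_coord n -` Pi\<^sub>E {..<n} A \<inter> space ?N = Pi\<^sub>E {..<n} (\<lambda>k. A (n - 1 - k))"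
    proof (intro set_eqI iffI)
      fix x assume x: "x \<in> rev_coord n -` Pi\<^sub>E {..<n} A \<inter> space ?N"
      then have e: "x \<in> extensional {..<n}" by (auto simp: space_PiM PiE_def)
      have "x k \<in> A (n - 1 - k)" if "k < n" for k
      proof -
        have "rev_coord n x (n - 1 - k) \<in> A (n - 1 - k)" using x that by (auto simp: PiE_def Pi_def)
        moreover have "n - 1 - (n - 1 - k) = k" using that by simp
        ultimately show ?thesis using that by (simp add: rev_coord_def)
      qed
      with e show "x \<in> Pi\<^sub>E {..<n} (\<lambda>k. A (n - 1 - k))" by (auto simp: PiE_def)
    next
      fix x assume x: "x \<in> Pi\<^sub>E {..<n} (\<lambda>k. A (n - 1 - k))"
      have "rev_coord n x k \<in> A k" if "k < n" for k
      proof -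
        have xj: "x j \<in> A (n - 1 - j)" if "j < n" for j using x that by (auto simp: PiE_def Pi_def)
        have "x (n - 1 - k) \<in> A (n - 1 - (n - 1 - k))" by (rule xj) (use \<open>k < n\<close> in simp)
        moreover have "n - 1 - (n - 1 - k) = k" using that by simp
        ultimately show ?thesis using that by (simp add: rev_coord_def)
      qed
      then show "x \<in> rev_coord n -` Pi\<^sub>E {..<n} A \<inter> space ?N"
        using x by (auto simp: space_PiM PiE_def rev_coord_def)
    qed
    have A': "\<And>k. k < n \<Longrightarrow> A (n - 1 - k) \<in> sets lborel" using A by auto
    have "emeasure (distr ?N ?N (rev_coord n)) (Pi\<^sub>E {..<n} A) = emeasure ?N (Pi\<^sub>E {..<n} (\<lambda>k. A (n - 1 - k)))"
      by (subst emeasure_distr[OF rev_coord_measurable]) (auto simp: pre intro!: sets_PiM_I_finite A)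
    also have "\<dots> = (\<Prod>k<n. emeasure lborel (A (n - Suc k)))"
      using A' by (subst emeasure_PiM) auto
    also have "\<dots> = (\<Prod>k<n. emeasure lborel (A k))" by (rule prod.nat_diff_reindex)
    finally show "emeasure (distr ?N ?N (rev_coord n)) (Pi\<^sub>E {..<n} A) = (\<Prod>i<n. emeasure lborel (A i))" .
  qed simp_all
qed

subsection \<open>Measures on path space\<close>

lemma cylinders_subset: "{{w \<in> cpaths T. w t \<in> A} |t A. t \<in> {0..T} \<and> A \<in> sets borel} \<subseteq> Pow (cpaths T)"
  by auto

lemma space_cpath_space: "space (cpath_space T) = cpaths T"
  unfolding cpath_space_def by (rule space_measure_of[OF cylinders_subset])

lemma sets_cpath_space:
  "sets (cpath_space T) = sigma_sets (cpaths T) {{w \<in> cpaths T. w t \<in> A} |t A. t \<in> {0..T} \<and> A \<in> sets borel}"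
  unfolding cpath_space_def by (rule sets_measure_of[OF cylinders_subset])

lemma cylinder_sets: "t \<in> {0..T} \<Longrightarrow> A \<in> sets borel \<Longrightarrow> {w \<in> cpaths T. w t \<in> A} \<in> sets (cpath_space T)"
  unfolding sets_cpath_space by (rule sigma_sets.Basic) blast

lemma coordinate_measurable:
  assumes "sets P = sets (cpath_space T)" "t \<in> {0..T}"
  shows "(\<lambda>w. w t) \<in> measurable P borel"
proof (rule measurableI)
  have sp: "space P = cpaths T" using sets_eq_imp_space_eq[OF assms(1)] by (simp add: space_cpath_space)
  fix A :: "(real^'a) set" assume "A \<in> sets borel"
  then show "(\<lambda>w. w t) -` A \<inter> space P \<in> sets P"
    using cylinder_sets[OF assms(2)] unfolding assms(1) sp by (simp add: vimage_def Int_def conj_commute)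
qed simp

text \<open>\<open>time_rev\<close> restricts its result to \<open>[0, T]\<close>, so it stays among
  the extensional paths, and it pulls the cylinder at \<open>t\<close> back to the one at
  \<open>T - t\<close>.\<close>

lemma time_rev_measurable:
  assumes Q: "sets Q = sets (cpath_space T)"
  shows "time_rev T \<in> measurable Q (cpath_space T)"
  unfolding cpath_space_def
proof (rule measurable_measure_of[OF cylinders_subset])
  have sp: "space Q = cpaths T" using sets_eq_imp_space_eq[OF Q] by (simp add: space_cpath_space)
  show rv: "time_rev T \<in> space Q \<rightarrow> cpaths T"
  proof
    fix w :: "real \<Rightarrow> real^'a" assume "w \<in> space Q"
    then have w: "continuous_on {0..T} w" by (simp add: sp cpaths_def)
    have "continuous_on {0..T} (\<lambda>t. w (T - t))"
      by (rule continuous_on_compose2[OF w]) (auto intro!: continuous_intros)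
    then have "continuous_on {0..T} (time_rev T w)"
      by (rule continuous_on_eq) (simp add: time_rev_def)
    then show "time_rev T w \<in> cpaths T" by (simp add: cpaths_def time_rev_def)
  qed
  fix X :: "(real \<Rightarrow> real^'a) set" assume "X \<in> {{w \<in> cpaths T. w t \<in> A} |t A. t \<in> {0..T} \<and> A \<in> sets borel}"
  then obtain t A where X: "X = {w \<in> cpaths T. w t \<in> A}" and t: "t \<in> {0..T}" and A: "A \<in> sets borel" by blast
  have "time_rev T -` X \<inter> space Q = {w \<in> cpaths T. w (T - t) \<in> A}"
    using t rv unfolding X sp by (auto simp: time_rev_def)
  then show "time_rev T -` X \<inter> space Q \<in> sets Q"
    using cylinder_sets[of "T - t" T A] t A unfolding Q by simp
qed

lemma restrict_coordinates_measurable: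
  fixes P :: "(real \<Rightarrow> real^'d::finite) measure"
  assumes P: "sets P = sets (cpath_space T)" and t: "\<And>k. k < n \<Longrightarrow> t k \<in> {0..T}"
  shows "(\<lambda>w. \<lambda>k\<in>{..<n}. w (t k)) \<in> measurable P (PiM {..<n} (\<lambda>_. lborel))"
  by (rule measurable_restrict) (use coordinate_measurable[OF P t] in simp)

text \<open>Finite-dimensional cylinders form a pi-system that generates the path sigma-algebra.
  Since grids contain interior times only, the times 0 and \<open>T\<close> are covered by the
  almost sure end points: a cylinder constraining them is null or agrees almost surely with its
  interior part.\<close>

lemma path_law_eqI:
  fixes P R :: "(real \<Rightarrow> real^'d::finite) measure"
  assumes T: "T > 0"
    and P: "prob_space P" "sets P = sets (cpath_space T)" "AE w in P. w 0 = \<xi> \<and> w T = \<eta>"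
    and R: "prob_space R" "sets R = sets (cpath_space T)" "AE w in R. w 0 = \<xi> \<and> w T = \<eta>"
    and fdd: "\<And>n t. grid T n t \<Longrightarrow>
      distr P (PiM {..<n} (\<lambda>_. lborel)) (\<lambda>w. \<lambda>k\<in>{..<n}. w (t k)) = distr R (PiM {..<n} (\<lambda>_. lborel)) (\<lambda>w. \<lambda>k\<in>{..<n}. w (t k))"
  shows "P = R"
proof -
  interpret P: prob_space P by fact
  interpret R: prob_space R by fact
  have spP: "space P = cpaths T" and spR: "space R = cpaths T"
    using sets_eq_imp_space_eq[OF P(2)] sets_eq_imp_space_eq[OF R(2)] by (simp_all add: space_cpath_space)
  define cyl where "cyl J A = {w \<in> cpaths T. \<forall>t\<in>J. w t \<in> A t}" for J and A :: "real \<Rightarrow> (real^'d) set"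
  define E where "E = {cyl J A | J A. finite J \<and> J \<subseteq> {0..T} \<and> (\<forall>t. A t \<in> sets borel)}"
  have cylm: "cyl J A \<in> sets (cpath_space T)" if "finite J" "J \<subseteq> {0..T}" "\<forall>t. A t \<in> sets borel" for J A
  proof (cases "J = {}")
    case True
    then have "cyl J A = space (cpath_space T)" by (simp add: cyl_def space_cpath_space)
    then show ?thesis by simp
  next
    case False
    then have "cyl J A = (\<Inter>t\<in>J. {w \<in> cpaths T. w t \<in> A t})" by (auto simp: cyl_def)
    then show ?thesis using that False by (auto intro!: sets.finite_INT cylinder_sets)
  qed
  have interior: "emeasure P (cyl J A) = emeasure R (cyl J A)"
    if J: "finite J" "J \<subseteq> {0<..<T}" and A: "\<forall>t. A t \<in> sets borel" for J A
  \<comment> \<open>A grid has at least one point. Without constraints the cylinder is the whole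
    space, and both masses are 1.\<close>
  proof (cases "J = {}")
    case True
    then have "cyl J A = space P" "cyl J A = space R" by (simp_all add: cyl_def spP spR)
    then show ?thesis using P.emeasure_space_1 R.emeasure_space_1 by simp
  next
    case False
    define n where "n = card J"
    \<comment> \<open>Listing \<open>J\<close> in increasing order turns it into a grid.\<close>
    define t where "t k = sorted_list_of_set J ! k" for k
    have len: "length (sorted_list_of_set J) = n" by (simp add: n_def)
    have n: "n > 0" using False J by (simp add: n_def card_gt_0_iff)
    have Jt: "J = t ` {..<n}"
      using J(1) len set_conv_nth[of "sorted_list_of_set J"] by (auto simp: t_def)
    have sorted: "sorted_wrt (<) (sorted_list_of_set J)" by simp
    have g: "grid T n t"
      unfolding grid_def
    proof (intro conjI allI impI)
      have "t k \<in> {0<..<T}" if "k < n" for k using Jt J(2) that by blast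
      from this[of 0] this[of "n - 1"] show "0 < t 0" "t (n - 1) < T" using n by simp_all
      show "t k < t (Suc k)" if "Suc k < n" for k
        unfolding t_def by (rule sorted_wrt_nth_less[OF sorted]) (use that len in auto)
    qed (fact n)
    have t01: "\<And>k. k < n \<Longrightarrow> t k \<in> {0..T}" using grid_bounds[OF g] by (auto intro: less_imp_le)
    have *: "emeasure N (cyl J A) = emeasure (distr N (PiM {..<n} (\<lambda>_. lborel)) (\<lambda>w. \<lambda>k\<in>{..<n}. w (t k))) (Pi\<^sub>E {..<n} (\<lambda>k. A (t k)))"
      if N: "sets N = sets (cpath_space T)" for N
    proof -
      have "space N = cpaths T" using sets_eq_imp_space_eq[OF N] by (simp add: space_cpath_space)
      then have "(\<lambda>w. \<lambda>k\<in>{..<n}. w (t k)) -` (Pi\<^sub>E {..<n} (\<lambda>k. A (t k))) \<inter> space N = cyl J A"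
        unfolding cyl_def Jt by (auto simp: PiE_def Pi_def)
      then show ?thesis using A
        by (subst emeasure_distr[OF restrict_coordinates_measurable[OF N t01]]) (auto intro!: sets_PiM_I_finite)
    qed
    show ?thesis unfolding *[OF P(2)] *[OF R(2)] fdd[OF g] ..
  qed
  have ends: "emeasure N (cyl J A) = (if (0 \<in> J \<longrightarrow> \<xi> \<in> A 0) \<and> (T \<in> J \<longrightarrow> \<eta> \<in> A T) then emeasure N (cyl (J \<inter> {0<..<T}) A) else 0)"
    if J: "finite J" "J \<subseteq> {0..T}" and A: "\<forall>t. A t \<in> sets borel"
      and N: "sets N = sets (cpath_space T)" "AE w in N. w 0 = \<xi> \<and> w T = \<eta>" for J A N
  proof -
    have J': "finite (J \<inter> {0<..<T})" "J \<inter> {0<..<T} \<subseteq> {0..T}" using J by auto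
    have split: "(\<forall>t\<in>J. w t \<in> A t) \<longleftrightarrow> (0 \<in> J \<longrightarrow> w 0 \<in> A 0) \<and> (T \<in> J \<longrightarrow> w T \<in> A T) \<and> (\<forall>t\<in>J \<inter> {0<..<T}. w t \<in> A t)" for w
    proof
      assume r: "(0 \<in> J \<longrightarrow> w 0 \<in> A 0) \<and> (T \<in> J \<longrightarrow> w T \<in> A T) \<and> (\<forall>t\<in>J \<inter> {0<..<T}. w t \<in> A t)"
      show "\<forall>t\<in>J. w t \<in> A t"
      proof
        fix t assume t: "t \<in> J"
        then have "t = 0 \<or> t = T \<or> t \<in> J \<inter> {0<..<T}" using J(2) by force
        then show "w t \<in> A t" using r t by auto
      qed
    qed auto
    show ?thesis
    proof (cases "(0 \<in> J \<longrightarrow> \<xi> \<in> A 0) \<and> (T \<in> J \<longrightarrow> \<eta> \<in> A T)")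
      case True
      have "emeasure N (cyl J A) = emeasure N (cyl (J \<inter> {0<..<T}) A)"
      proof (rule emeasure_eq_AE)
        show "AE w in N. w \<in> cyl J A \<longleftrightarrow> w \<in> cyl (J \<inter> {0<..<T}) A"
          using N(2) by eventually_elim (use True in \<open>auto simp: cyl_def split\<close>)
      qed (use cylm[OF J A] cylm[OF J' A] N(1) in auto)
      then show ?thesis using True by simp
    next
      case False
      have "emeasure N (cyl J A) = emeasure N {}"
      proof (rule emeasure_eq_AE)
        show "AE w in N. w \<in> cyl J A \<longleftrightarrow> w \<in> {}"
          using N(2) by eventually_elim (use False in \<open>auto simp: cyl_def split\<close>)
      qed (use cylm[OF J A] N(1) in auto)
      then show ?thesis using False by auto
    qed
  qed
  have eqE: "emeasure P X = emeasure R X" if XE: "X \<in> E" for X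
  proof -
    obtain J A where X: "X = cyl J A" and J: "finite J" "J \<subseteq> {0..T}" and A: "\<forall>t. A t \<in> sets borel"
      using XE unfolding E_def by blast
    have "emeasure P (cyl (J \<inter> {0<..<T}) A) = emeasure R (cyl (J \<inter> {0<..<T}) A)"
      by (rule interior) (use J A in auto)
    then show ?thesis unfolding X ends[OF J A P(2,3)] ends[OF J A R(2,3)] by simp
  qed
  have stable: "Int_stable E"
  proof (rule Int_stableI)
    fix X Y assume "X \<in> E" "Y \<in> E"
    then obtain J A J' A' where X: "X = cyl J A" "finite J" "J \<subseteq> {0..T}" "\<forall>t. A t \<in> sets borel"
      and Y: "Y = cyl J' A'" "finite J'" "J' \<subseteq> {0..T}" "\<forall>t. A' t \<in> sets borel"
      unfolding E_def by blast
    \<comment> \<open>Outside its own index set each family imposes nothing, so \<open>UNIV\<close>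
      is the default on the union.\<close>
    let ?B = "\<lambda>t. (if t \<in> J then A t else UNIV) \<inter> (if t \<in> J' then A' t else UNIV)"
    have "X \<inter> Y = cyl (J \<union> J') ?B" unfolding X(1) Y(1) cyl_def by auto
    moreover have "\<forall>t. ?B t \<in> sets borel" using X(4) Y(4) by auto
    ultimately show "X \<inter> Y \<in> E" unfolding E_def using X(2,3) Y(2,3) by blast
  qed
  have EP: "E \<subseteq> Pow (cpaths T)" unfolding E_def cyl_def by auto
  have gen: "sets (cpath_space T) = sigma_sets (cpaths T) E"
  proof
    show "sets (cpath_space T) \<subseteq> sigma_sets (cpaths T) E"
      unfolding sets_cpath_space
    proof (rule sigma_sets_mono', safe)
      fix t A assume "t \<in> {0..T}" "(A :: (real^'d) set) \<in> sets borel"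
      then have "cyl {t} (\<lambda>_. A) \<in> E" unfolding E_def by blast
      then show "{w \<in> cpaths T. w t \<in> A} \<in> E" by (simp add: cyl_def)
    qed
    have "E \<subseteq> sets (cpath_space T)" unfolding E_def using cylm by blast
    then show "sigma_sets (cpaths T) E \<subseteq> sets (cpath_space T)"
      using sets.sigma_sets_subset[of E "cpath_space T"] by (simp add: space_cpath_space)
  qed
  have top: "cpaths T \<in> E"
  proof -
    have "cyl {} (\<lambda>_. UNIV) \<in> E"
      unfolding E_def by (intro CollectI exI[of _ "{}"] exI[of _ "\<lambda>_. UNIV"]) simp
    then show ?thesis by (simp add: cyl_def)
  qed
  show "P = R"
  proof (rule measure_eqI_generator_eq[OF stable EP eqE, where A = "\<lambda>_. cpaths T"])
    show "sets P = sigma_sets (cpaths T) E" "sets R = sigma_sets (cpaths T) E"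
      using gen P(2) R(2) by (simp_all only:)
    show "range (\<lambda>_. cpaths T) \<subseteq> E" using top by blast
    show "emeasure P (cpaths T) \<noteq> \<infinity>" using P.emeasure_space_1 by (simp add: spP)
    show "(\<Union>i::nat. cpaths T) = cpaths T" by blast
  qed
qed

text \<open>\<open>time_rev T\<close> is its own inverse on \<open>cpaths T\<close>, so the image of
  \<open>Q\<close> under it is the composition of \<open>Q\<close> with the reversal. The reversal
  exchanges the end points, and what has to be compared are the laws on grids.\<close>

theorem mainTheorem2:
  fixes b bT :: "real^'d::finite \<Rightarrow> real \<Rightarrow> real^'d"
    and \<nu> T :: real
    and p pT :: "real \<Rightarrow> real^'d \<Rightarrow> real \<Rightarrow> real^'d \<Rightarrow> real"
    and \<xi> \<eta> :: "real^'d"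
    and P Q :: "(real \<Rightarrow> real^'d) measure"
  assumes "\<nu> > 0" and "T > 0"
    and "bounded_field b" and "borel_field b" and "div_free b"
    and "bounded_field bT" and "borel_field bT" and "div_free bT"
    and "\<forall>x t. 0 \<le> t \<longrightarrow> t \<le> T \<longrightarrow> bT x t = b x (T - t)"
    and "trans_density \<nu> b p"
    and "trans_density \<nu> (\<lambda>x t. - bT x t) pT"
    and "is_bridge p \<xi> T \<eta> P"
    and "is_bridge pT \<eta> T \<xi> Q"
  shows "P = distr Q (cpath_space T) (time_rev T)"
proof -
  note T = assms(2) and p = assms(10) and pT = assms(11)
  have P: "prob_space P" "sets P = sets (cpath_space T)" "AE w in P. w 0 = \<xi> \<and> w T = \<eta>"
    and fddP: "\<And>n t. grid T n t \<Longrightarrow> distr P (PiM {..<n} (\<lambda>_. lborel)) (\<lambda>w. \<lambda>k\<in>{..<n}. w (t k))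
          = density (PiM {..<n} (\<lambda>_. lborel)) (\<lambda>x. ennreal (bridge_density p 0 \<xi> T \<eta> n t x))"
    using assms(12) unfolding is_bridge_def grid_def by blast+
  have Q: "prob_space Q" "sets Q = sets (cpath_space T)" "AE w in Q. w 0 = \<eta> \<and> w T = \<xi>"
    and fddQ: "\<And>n t. grid T n t \<Longrightarrow> distr Q (PiM {..<n} (\<lambda>_. lborel)) (\<lambda>w. \<lambda>k\<in>{..<n}. w (t k))
          = density (PiM {..<n} (\<lambda>_. lborel)) (\<lambda>x. ennreal (bridge_density pT 0 \<eta> T \<xi> n t x))"
    using assms(13) unfolding is_bridge_def grid_def by blast+
  have dual: "p s x t y = pT (T - t) y (T - s) x" if "0 \<le> s" "s < t" "t \<le> T" for s t x y
    by (rule trans_density_duality[OF assms(1-5) _ p pT that]) (use assms(9) in blast)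
  let ?R = "distr Q (cpath_space T) (time_rev T)"
  note rm = time_rev_measurable[OF Q(2)]
  show ?thesis
  proof (rule path_law_eqI[OF T P])
    show "prob_space ?R" by (rule prob_space.prob_space_distr[OF Q(1) rm])
    show "sets ?R = sets (cpath_space T)" by simp
    have ae: "AE w in Q. time_rev T w 0 = \<xi> \<and> time_rev T w T = \<eta>"
      using Q(3) by eventually_elim (use T in \<open>simp add: time_rev_def\<close>)
    have ends: "{w \<in> space (cpath_space T). w 0 = \<xi> \<and> w T = \<eta>} \<in> sets (cpath_space T)"
    proof -
      have "{w \<in> space (cpath_space T). w 0 = \<xi> \<and> w T = \<eta>} =
         {w \<in> cpaths T. w 0 \<in> {\<xi>}} \<inter> {w \<in> cpaths T. w T \<in> {\<eta>}}" by (auto simp: space_cpath_space)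
      then show ?thesis by (simp only:) (intro sets.Int cylinder_sets; use T in simp)
    qed
    show "AE w in ?R. w 0 = \<xi> \<and> w T = \<eta>"
      by (rule AE_distr_iff[OF rm ends, THEN iffD2, OF ae])
    fix n t assume g: "grid T n t"
    let ?N = "PiM {..<n} (\<lambda>_. lborel :: (real^'d) measure)"
    let ?t = "\<lambda>k. T - t (n - 1 - k)"
    note g' = grid_rev[OF g]
    have tk: "t k \<in> {0..T}" "?t k \<in> {0..T}" if "k < n" for k
      using grid_bounds[OF g that] grid_bounds[OF g' that] by auto
    have m1: "(\<lambda>w. \<lambda>k\<in>{..<n}. w (t k)) \<in> measurable (cpath_space T) ?N"
      by (rule restrict_coordinates_measurable[OF refl]) (rule tk(1))
    have m2: "(\<lambda>w. \<lambda>k\<in>{..<n}. w (?t k)) \<in> measurable Q ?N"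
      by (rule restrict_coordinates_measurable[OF Q(2)]) (rule tk(2))
    have "distr ?R ?N (\<lambda>w. \<lambda>k\<in>{..<n}. w (t k)) = distr Q ?N ((\<lambda>w. \<lambda>k\<in>{..<n}. w (t k)) \<circ> time_rev T)"
      by (rule distr_distr[OF m1 rm])
    \<comment> \<open>Sampling the reversed path along \<open>t\<close> amounts to sampling the path
      along the reversed grid and then reversing the order of the samples.\<close>
    also have "\<dots> = distr Q ?N (rev_coord n \<circ> (\<lambda>w. \<lambda>k\<in>{..<n}. w (?t k)))"
    proof (rule distr_cong[OF refl refl])
      fix w :: "real \<Rightarrow> real^'d"
      have "n - 1 - (n - 1 - k) = k" if "k < n" for k using that by simp
      then show "((\<lambda>w. \<lambda>k\<in>{..<n}. w (t k)) \<circ> time_rev T) w = (rev_coord n \<circ> (\<lambda>w. \<lambda>k\<in>{..<n}. w (?t k))) w"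
        using tk(1) by (auto simp: rev_coord_def time_rev_def fun_eq_iff restrict_def)
    qed
    also have "\<dots> = distr (distr Q ?N (\<lambda>w. \<lambda>k\<in>{..<n}. w (?t k))) ?N (rev_coord n)"
      by (rule distr_distr[symmetric, OF rev_coord_measurable m2])
    also have "\<dots> = distr (density ?N (\<lambda>x. ennreal (bridge_density p 0 \<xi> T \<eta> n t (rev_coord n x)))) ?N (rev_coord n)"
    proof -
      have "bridge_density pT 0 \<eta> T \<xi> n ?t x = bridge_density p 0 \<xi> T \<eta> n t (rev_coord n x)" for x
      proof -
        have n: "0 < n" using g by (simp add: grid_def)
        have rc: "rev_coord n x (n - 1 - k) = x k" if "k < n" for k
          using that by (simp add: rev_coord_def)
        \<comment> \<open>Undoing \<open>rev_coord\<close> returns \<open>x\<close> at indices below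
          \<open>n\<close> only; the density reads no others.\<close>
        have "bridge_density pT 0 \<eta> T \<xi> n ?t x = bridge_density pT 0 \<eta> T \<xi> n ?t (\<lambda>k. rev_coord n x (n - 1 - k))"
          unfolding bridge_density_def
        proof (intro arg_cong2[where f = times] prod.cong refl)
          show "bridge_q pT T \<xi> 0 \<eta> (?t 0) (x 0) = bridge_q pT T \<xi> 0 \<eta> (?t 0) (rev_coord n x (n - 1 - 0))"
            by (simp only: rc[OF n])
          fix k assume "k \<in> {..<n - 1}"
          then have "k < n" "Suc k < n" by auto
          then show "bridge_q pT T \<xi> (?t k) (x k) (?t (Suc k)) (x (Suc k)) =
              bridge_q pT T \<xi> (?t k) (rev_coord n x (n - 1 - k)) (?t (Suc k)) (rev_coord n x (n - 1 - Suc k))"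
            by (simp only: rc)
        qed
        also have "\<dots> = bridge_density p 0 \<xi> T \<eta> n t (rev_coord n x)"
          by (rule bridge_density_reversal[OF dual p pT g])
        finally show ?thesis .
      qed
      then show ?thesis unfolding fddQ[OF g'] by simp
    qed
    \<comment> \<open>The density depends on \<open>x\<close> through \<open>rev_coord n x\<close>,
      so it can be moved past the image measure, leaving a reference measure that is invariant under
      the reversal.\<close>
    also have "\<dots> = density (distr ?N ?N (rev_coord n)) (\<lambda>x. ennreal (bridge_density p 0 \<xi> T \<eta> n t x))"
      by (rule density_distr[symmetric])
         (auto intro!: measurable_compose[OF bridge_density_measurable[OF p g] measurable_ennreal] rev_coord_measurable)
    also have "\<dots> = density ?N (\<lambda>x. ennreal (bridge_density p 0 \<xi> T \<eta> n t x))"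
      unfolding distr_rev_coord ..
    also have "\<dots> = distr P ?N (\<lambda>w. \<lambda>k\<in>{..<n}. w (t k))" by (rule fddP[OF g, symmetric])
    finally show "distr P ?N (\<lambda>w. \<lambda>k\<in>{..<n}. w (t k)) = distr ?R ?N (\<lambda>w. \<lambda>k\<in>{..<n}. w (t k))" ..
  qed
qed

end
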